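(* A rule $\mathcal{R}$ is unique if and only if it is a symmetric deterministic rule or a rule of order $2$.
   Context: $\mathbb{N}$ is the set of positive integers and $[k]=\{1,\dots,k\}$. Graphs are finite, simple and undirected. $\mathbb{I}_{\{\cdot\}}$ denotes an indicator. Rules. For $k\in\mathbb{N}$, $\mathcal{H}_k$ is the set of all labelled graphs on vertex set $[k]$. A rule of order $k$ is a matrix $\mathcal{R}=(\mathcal{R}_{F,H})_{F,H\in\mathcal{H}_k}\in[0,1]^{\mathcal{H}_k\times\mathcal{H}_k}$ such that $\sum_{H\in\mathcal{H}_k}\mathcal{R}_{F,H}=1$ for every $F\in\mathcal{H}_k$. The symmetric group $S_k$ acts on $\mathcal{H}_k$: $\sigma\cdot F$ is the graph on $[k]$ with edge set $\{\sigma(i)\sigma(j):ij\in E(F)\}$. A rule $\mathcal{R}$ of order $k$ is symmetric if $\mathcal{R}_{\sigma\cdot F,\sigma\cdot H}=\mathcal{R}_{F,H}$ for all $F,H\in\mathcal{H}_k$ and $\sigma\in S_k$; it is deterministic if for each $F\in\mathcal{H}_k$ there is a unique $G\in\mathcal{H}_k$ such that $\mathcal{R}_{F,H}=\mathbb{I}_{\{H=G\}}$ for all $H\in\mathcal{H}_k$. A rule is unique if no other rule of the same order has the same trajectories (defined below). Kernels. $(\Omega,\pi)$ is a fixed atomless probability space with a separable sigma-algebra. $\mathcal{W}\subseteq L^\infty(\Omega^2)$ is the set of kernels, i.e. bounded symmetric measurable real-valued functions on $\Omega^2$, with the norm $\|\cdot\|_\infty$. Velocity. Let $\mathcal{G}_k=\mathcal{H}_k\times\{(a,b)\in[k]^2:a\neq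 b\}$; its element $(F,(a,b))$ is written $F^{a,b}$. For $F^{a,b}\in\mathcal{G}_k$ and $W\in\mathcal{W}$, $$T_{F^{a,b}}W(x,y)=\int\prod_{ij\in E(F)}W(x_i,x_j)\prod_{ij\notin E(F)}(1-W(x_i,x_j))\,\mathrm{d}\pi^{[k]\setminus\{a,b\}},$$ where the products are over unordered pairs $ij$ of distinct vertices in $[k]$, $x_a=x$ and $x_b=y$ are fixed, and the integral is over $(x_i)_{i\in[k]\setminus\{a,b\}}$. The velocity operator of a rule $\mathcal{R}$ of order $k$ is $\mathfrak{V}_{\mathcal{R}}:\mathcal{W}\to\mathcal{W}$, $$\mathfrak{V}_{\mathcal{R}}W=\sum_{F^{a,b}\in\mathcal{G}_k}\Big(\sum_{H\in\mathcal{H}_k}\mathcal{R}_{F,H}\mathbb{I}_{\{ab\in E(H)\}}-\mathbb{I}_{\{ab\in E(F)\}}\Big)T_{F^{a,b}}W$$ (the empty sum, i.e. zero, if $k=1$). Trajectories. A trajectory of $\mathcal{R}$ starting at $W\in\mathcal{W}$ is a differentiable function $\Phi_{\mathcal{R}}^{\cdot}W:I\to(\mathcal{W},\|\cdot\|_\infty)$ on an open interval $I\subseteq\mathbb{R}$ containing $0$ with $\frac{\mathrm{d}}{\mathrm{d}t}\Phi_{\mathcal{R}}^tW=\mathfrak{V}_{\mathcal{R}}\Phi_{\mathcal{R}}^tW$ and $\Phi_{\mathcal{R}}^0W=W$. It is known that for every rule $\mathcal{R}$ and kernel $W$ there is a trajectory starting at $W$ with maximal open interval domain $\mathcal{D}_{\mathcal{R},W}$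 such that every other trajectory starting at $W$ is its restriction to a subinterval; $\Phi_{\mathcal{R}}^{\cdot}W$ denotes this maximal trajectory. Rules $\mathcal{R}_1,\mathcal{R}_2$ have the same trajectories if for all $W\in\mathcal{W}$ we have $\mathcal{D}_{\mathcal{R}_1,W}=\mathcal{D}_{\mathcal{R}_2,W}$ and $\Phi_{\mathcal{R}_1}^tW=\Phi_{\mathcal{R}_2}^tW$ for all $t\in\mathcal{D}_{\mathcal{R}_1,W}$. *)

theory Defs
  imports "HOL-Probability.Probability" "HOL-Combinatorics.Permutations"
begin

section \<open>Graphs and rules\<close>

text \<open>A labelled graph on the vertex set \<open>{1..k}\<close> is represented by its edge set.\<close>

definition graphs :: "nat \<Rightarrow> nat set set set" where
  "graphs k = Pow {{i, j} | i j. i \<in> {1..k} \<and> j \<in> {1..k} \<and> i \<noteq> j}"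

text \<open>Matrices indexed by \<open>graphs k\<close> are functions of two arguments of which only the values on
  \<open>graphs k\<close> matter; accordingly, equality of rules of order \<open>k\<close> is \<open>rule_eq k\<close>.\<close>

definition is_rule :: "nat \<Rightarrow> (nat set set \<Rightarrow> nat set set \<Rightarrow> real) \<Rightarrow> bool" where
  "is_rule k R \<longleftrightarrow>
     (\<forall>F\<in>graphs k. \<forall>H\<in>graphs k. 0 \<le> R F H \<and> R F H \<le> 1) \<and>
     (\<forall>F\<in>graphs k. (\<Sum>H\<in>graphs k. R F H) = 1)"

definition rule_eq ::
  "nat \<Rightarrow> (nat set set \<Rightarrow> nat set set \<Rightarrow> real) \<Rightarrow> (nat set set \<Rightarrow> nat set set \<Rightarrow> real) \<Rightarrow> bool" where
  "rule_eq k R R' \<longleftrightarrow> (\<forall>F\<in>graphs k. \<forall>H\<in>graphs k. R F H = R' F H)"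

definition graph_act :: "(nat \<Rightarrow> nat) \<Rightarrow> nat set set \<Rightarrow> nat set set" where
  "graph_act \<sigma> F = (\<lambda>e. \<sigma> ` e) ` F"

definition symmetric_rule :: "nat \<Rightarrow> (nat set set \<Rightarrow> nat set set \<Rightarrow> real) \<Rightarrow> bool" where
  "symmetric_rule k R \<longleftrightarrow>
     (\<forall>F\<in>graphs k. \<forall>H\<in>graphs k. \<forall>\<sigma>. \<sigma> permutes {1..k} \<longrightarrow>
        R (graph_act \<sigma> F) (graph_act \<sigma> H) = R F H)"

definition deterministic_rule :: "nat \<Rightarrow> (nat set set \<Rightarrow> nat set set \<Rightarrow> real) \<Rightarrow> bool" where
  "deterministic_rule k R \<longleftrightarrow>
     (\<forall>F\<in>graphs k. \<exists>!G. G \<in> graphs k \<and> (\<forall>H\<in>graphs k. R F H = of_bool (H = G)))"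

section \<open>The ground space and kernels\<close>

definition atomless :: "'a measure \<Rightarrow> bool" where
  "atomless M \<longleftrightarrow>
     (\<forall>A\<in>sets M. 0 < emeasure M A \<longrightarrow>
        (\<exists>B\<in>sets M. B \<subseteq> A \<and> 0 < emeasure M B \<and> emeasure M B < emeasure M A))"

text \<open>Separability of the sigma-algebra as a pseudometric space under
  \<open>(A, B) \<mapsto> measure M (A \<triangle> B)\<close>. Every countably generated sigma-algebra with a
  finite measure is separable in this sense.\<close>

definition separable_sigma_algebra :: "'a measure \<Rightarrow> bool" where
  "separable_sigma_algebra M \<longleftrightarrow>
     (\<exists>C. countable C \<and> C \<subseteq> sets M \<and>
        (\<forall>A\<in>sets M. \<forall>\<epsilon>>0. \<exists>B\<in>C. measure M ((A - B) \<union> (B - A)) < \<epsilon>))"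

text \<open>A kernel is an element of \<open>L\<^sup>\<infinity>\<close>, that is, a class of functions modulo equality almost
  everywhere. Below, \<open>kernels M\<close> consists of the bounded, everywhere symmetric, measurable
  representatives; \<open>kernel_eq\<close> is equality of the represented classes, and \<open>Linf_norm\<close> is the
  (essential supremum) norm of the class.\<close>

definition kernels :: "'a measure \<Rightarrow> ('a \<times> 'a \<Rightarrow> real) set" where
  "kernels M =
     {W \<in> borel_measurable (M \<Otimes>\<^sub>M M).
        (\<exists>B. \<forall>x\<in>space M. \<forall>y\<in>space M. \<bar>W (x, y)\<bar> \<le> B) \<and>
        (\<forall>x\<in>space M. \<forall>y\<in>space M. W (x, y) = W (y, x))}"

definition kernel_eq :: "'a measure \<Rightarrow> ('a \<times> 'a \<Rightarrow> real) \<Rightarrow> ('a \<times> 'a \<Rightarrow> real) \<Rightarrow> bool" where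
  "kernel_eq M U W \<longleftrightarrow> (AE p in M \<Otimes>\<^sub>M M. U p = W p)"

definition Linf_norm :: "'a measure \<Rightarrow> ('a \<times> 'a \<Rightarrow> real) \<Rightarrow> ereal" where
  "Linf_norm M U = esssup (M \<Otimes>\<^sub>M M) (\<lambda>p. ereal \<bar>U p\<bar>)"

section \<open>Velocity\<close>

text \<open>Unordered pairs of distinct vertices are enumerated as \<open>(i, j)\<close> with \<open>i < j\<close>; the orientation
  is immaterial since kernels are symmetric.\<close>

definition vertex_pairs :: "nat \<Rightarrow> (nat \<times> nat) set" where
  "vertex_pairs k = {(i, j). i \<in> {1..k} \<and> j \<in> {1..k} \<and> i < j}"

definition T_op ::
  "'a measure \<Rightarrow> nat \<Rightarrow> nat set set \<Rightarrow> nat \<Rightarrow> nat \<Rightarrow> ('a \<times> 'a \<Rightarrow> real) \<Rightarrow> 'a \<times> 'a \<Rightarrow> real" where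
  "T_op M k F a b W = (\<lambda>(x, y).
     LINT z | PiM ({1..k} - {a, b}) (\<lambda>_. M).
       (let u = z(a := x, b := y) in
         (\<Prod>(i, j) \<in> {(i, j) \<in> vertex_pairs k. {i, j} \<in> F}. W (u i, u j)) *
         (\<Prod>(i, j) \<in> {(i, j) \<in> vertex_pairs k. {i, j} \<notin> F}. 1 - W (u i, u j))))"

definition velocity ::
  "'a measure \<Rightarrow> nat \<Rightarrow> (nat set set \<Rightarrow> nat set set \<Rightarrow> real) \<Rightarrow>
     ('a \<times> 'a \<Rightarrow> real) \<Rightarrow> 'a \<times> 'a \<Rightarrow> real" where
  "velocity M k R W = (\<lambda>p.
     \<Sum>(F, (a, b)) \<in> graphs k \<times> {(a, b). a \<in> {1..k} \<and> b \<in> {1..k} \<and> a \<noteq> b}.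
       ((\<Sum>H\<in>graphs k. R F H * of_bool ({a, b} \<in> H)) - of_bool ({a, b} \<in> F)) * T_op M k F a b W p)"

section \<open>Trajectories\<close>

definition has_Linf_derivative ::
  "'a measure \<Rightarrow> (real \<Rightarrow> 'a \<times> 'a \<Rightarrow> real) \<Rightarrow> ('a \<times> 'a \<Rightarrow> real) \<Rightarrow> real \<Rightarrow> bool" where
  "has_Linf_derivative M \<Phi> D t \<longleftrightarrow>
     ((\<lambda>s. Linf_norm M (\<lambda>p. (\<Phi> s p - \<Phi> t p) / (s - t) - D p)) \<longlongrightarrow> 0) (at t)"

text \<open>A partial function on the interval \<open>I\<close> is represented by a total function \<open>\<Phi>\<close>, whose values
  outside \<open>I\<close> are irrelevant.\<close>

definition trajectory ::
  "'a measure \<Rightarrow> nat \<Rightarrow> (nat set set \<Rightarrow> nat set set \<Rightarrow> real) \<Rightarrow> ('a \<times> 'a \<Rightarrow> real) \<Rightarrow>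
     real set \<Rightarrow> (real \<Rightarrow> 'a \<times> 'a \<Rightarrow> real) \<Rightarrow> bool" where
  "trajectory M k R W I \<Phi> \<longleftrightarrow>
     open I \<and> is_interval I \<and> 0 \<in> I \<and>
     (\<forall>t\<in>I. \<Phi> t \<in> kernels M) \<and>
     (\<forall>t\<in>I. has_Linf_derivative M \<Phi> (velocity M k R (\<Phi> t)) t) \<and>
     kernel_eq M (\<Phi> 0) W"

definition maximal_trajectory ::
  "'a measure \<Rightarrow> nat \<Rightarrow> (nat set set \<Rightarrow> nat set set \<Rightarrow> real) \<Rightarrow> ('a \<times> 'a \<Rightarrow> real) \<Rightarrow>
     real set \<Rightarrow> (real \<Rightarrow> 'a \<times> 'a \<Rightarrow> real) \<Rightarrow> bool" where
  "maximal_trajectory M k R W I \<Phi> \<longleftrightarrow>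
     trajectory M k R W I \<Phi> \<and>
     (\<forall>J \<Psi>. trajectory M k R W J \<Psi> \<longrightarrow> J \<subseteq> I \<and> (\<forall>t\<in>J. kernel_eq M (\<Psi> t) (\<Phi> t)))"

lemma maximal_trajectory_unique:
  assumes "maximal_trajectory M k R W I \<Phi>" and "maximal_trajectory M k R W J \<Psi>"
  shows "I = J" and "\<forall>t\<in>I. kernel_eq M (\<Phi> t) (\<Psi> t)"
  using assms unfolding maximal_trajectory_def by blast+

text \<open>The domain is unique by the preceding lemma, and the maximal trajectory is unique up to the
  choice of representatives of the kernels, which \<open>SOME\<close> makes arbitrarily.\<close>

definition traj_domain ::
  "'a measure \<Rightarrow> nat \<Rightarrow> (nat set set \<Rightarrow> nat set set \<Rightarrow> real) \<Rightarrow> ('a \<times> 'a \<Rightarrow> real) \<Rightarrow> real set" where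
  "traj_domain M k R W = (THE I. \<exists>\<Phi>. maximal_trajectory M k R W I \<Phi>)"

definition traj ::
  "'a measure \<Rightarrow> nat \<Rightarrow> (nat set set \<Rightarrow> nat set set \<Rightarrow> real) \<Rightarrow> ('a \<times> 'a \<Rightarrow> real) \<Rightarrow>
     real \<Rightarrow> 'a \<times> 'a \<Rightarrow> real" where
  "traj M k R W = (SOME \<Phi>. maximal_trajectory M k R W (traj_domain M k R W) \<Phi>)"

definition same_trajectories ::
  "'a measure \<Rightarrow> nat \<Rightarrow> (nat set set \<Rightarrow> nat set set \<Rightarrow> real) \<Rightarrow>
     nat \<Rightarrow> (nat set set \<Rightarrow> nat set set \<Rightarrow> real) \<Rightarrow> bool" where
  "same_trajectories M k\<^sub>1 R\<^sub>1 k\<^sub>2 R\<^sub>2 \<longleftrightarrow>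
     (\<forall>W\<in>kernels M.
        traj_domain M k\<^sub>1 R\<^sub>1 W = traj_domain M k\<^sub>2 R\<^sub>2 W \<and>
        (\<forall>t\<in>traj_domain M k\<^sub>1 R\<^sub>1 W. kernel_eq M (traj M k\<^sub>1 R\<^sub>1 W t) (traj M k\<^sub>2 R\<^sub>2 W t)))"

definition unique_rule ::
  "'a measure \<Rightarrow> nat \<Rightarrow> (nat set set \<Rightarrow> nat set set \<Rightarrow> real) \<Rightarrow> bool" where
  "unique_rule M k R \<longleftrightarrow>
     \<not> (\<exists>R'. is_rule k R' \<and> \<not> rule_eq k R' R \<and> same_trajectories M k R' k R)"

end

theory Submission
  imports Defs
begin

text \<open>The velocity of a rule depends on it only through the sums, over the symmetric group, of the
  probabilities that a given pair becomes an edge (the orbit sums). Indeed, relabelling a rooted graph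
  does not change its operator \<open>T\<close>; conversely, for step kernels with a \<open>0/1\<close>-valued matrix the velocity is
  a polynomial in the part sizes whose coefficient at the product of all part sizes is an orbit sum.
  Velocities and trajectories determine each other by the Picard-Lindeloef theorem.

  If the rule is symmetric and deterministic, its edge probabilities are constant on orbits and equal to
  0 or 1, hence they are determined by their orbit sums, and so is the rule; at order 2 a rule has only
  one free parameter per graph, which is an orbit sum. In all other cases a different rule has the same orbit
  sums: the symmetrization of a non-symmetric rule, or, for a symmetric rule with two possible outcomes
  at the same graph, a perturbation moving mass between these outcomes and back at a relabelled graph.
  If all relabellings fix the graph and both outcomes, these outcomes are the empty and the complete graph,
  and the mass is moved to a single edge and its complement.\<close>

section \<open>Differential equations and atomless measures\<close>

text \<open>Kernels enter as representatives of classes, so two trajectories of one rule agree only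
  almost everywhere, with a null set that may change with time; this is why derivatives, Lipschitz
  bounds and uniqueness are phrased through almost everywhere bounds. Local existence is proved
  where the equation closes up in a Banach space: on step kernels over a fixed partition the
  velocity is again a step kernel, and the matrix of its values evolves in a space of bounded
  functions. Atomlessness provides partitions with all positive part sizes of sum 1, so equal
  velocities yield an identity of polynomials on an open simplex, whose coefficients can be
  compared. The squarefree monomial is the right one because there the map from vertices to parts is
  a bijection, that is, a relabelling. The perturbation for invariant outcomes works because a
  single edge and its complement together contain every pair once, exactly as the empty and the
  complete graph do; from three vertices on these are different pairs of graphs, at two vertices the
  same pair.\<close>

lemma norm_diff_le_of_vector_derivative:
  fixes h :: "real \<Rightarrow> 'b::real_normed_vector"
  assumes "convex S"
    and der: "\<And>t. t \<in> S \<Longrightarrow> (h has_vector_derivative h' t) (at t within S)"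
    and bound: "\<And>t. t \<in> S \<Longrightarrow> norm (h' t) \<le> B"
    and "x \<in> S" "y \<in> S"
  shows "norm (h x - h y) \<le> B * \<bar>x - y\<bar>"
proof -
  have "norm (h x - h y) \<le> B * norm (x - y)"
  proof (rule differentiable_bound[OF \<open>convex S\<close>])
    show "(h has_derivative (\<lambda>s. s *\<^sub>R h' t)) (at t within S)" if "t \<in> S" for t
      using der[OF that] by (simp add: has_vector_derivative_def)
    show "onorm (\<lambda>s. s *\<^sub>R h' t) \<le> B" if "t \<in> S" for t
    proof (rule onorm_le)
      fix s show "norm (s *\<^sub>R h' t) \<le> B * norm s"
        using mult_right_mono[OF bound[OF that], of "\<bar>s\<bar>"] by (simp add: mult.commute)
    qed
  qed (use assms in auto)
  then show ?thesis by simp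
qed

text \<open>Contraction principle for the integral operator. Candidates are bounded continuous
  functions on the whole line with values in the ball, so that they form a complete subset of a
  type; the time argument is clamped to \<open>{- \<delta>..\<delta>}\<close>, and the equation is
  obtained on the open interval.\<close>

lemma picard_local:
  fixes f :: "'b::banach \<Rightarrow> 'b"
  assumes "0 < r" and "0 \<le> L"
    and lip: "\<And>x y. x \<in> cball x0 r \<Longrightarrow> y \<in> cball x0 r \<Longrightarrow> norm (f x - f y) \<le> L * norm (x - y)"
  obtains \<delta> u where "0 < \<delta>" and "u 0 = x0"
    and "\<And>t. t \<in> {- \<delta><..<\<delta>} \<Longrightarrow> (u has_vector_derivative f (u t)) (at t)"
proof -
  \<comment> \<open>\<open>B\<close> bounds \<open>norm (f x)\<close> on the ball, the summand 1
    making it positive. In \<open>\<delta>\<close>, the bound \<open>r / B\<close> keeps the image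
    curves in the ball, and the other one makes \<open>L * \<delta>\<close> at most 1/2, the
    contraction factor; \<open>L + 1\<close> covers the case \<open>L = 0\<close>.\<close>
  define B where "B = norm (f x0) + L * r + 1"
  define \<delta> where "\<delta> = min (r / B) (1 / (2 * (L + 1)))"
  define K where "K t = max (- \<delta>) (min \<delta> t)" for t :: real
  \<comment> \<open>Integration starts at \<open>- \<delta>\<close>, so that
    \<open>G u (K t) - G u 0\<close> is the integral from 0 to the clamped time for both signs of
    \<open>t\<close>.\<close>
  define G where "G u s = integral {- \<delta>..s} (\<lambda>x. f (u x))" for u :: "real \<Rightarrow> 'b" and s
  define P where "P u t = x0 + (G u (K t) - G u 0)" for u :: "real \<Rightarrow> 'b" and t
  define Q where "Q u = Bcontfun (P u)" for u :: "real \<Rightarrow>\<^sub>C 'b"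
  define S where "S = PiC UNIV (\<lambda>_::real. cball x0 r)"
  have B: "0 < B" using assms by (auto simp: B_def add_nonneg_pos)
  have d: "0 < \<delta>" using B assms by (auto simp: \<delta>_def)
  have dB: "B * \<delta> \<le> r" using B by (auto simp: \<delta>_def min_def field_simps)
  have dL: "L * \<delta> \<le> 1 / 2"
  proof -
    have "L * \<delta> \<le> (L + 1) * (1 / (2 * (L + 1)))"
      using assms d by (intro mult_mono) (auto simp: \<delta>_def)
    also have "\<dots> = 1 / 2" using assms by simp
    finally show ?thesis .
  qed
  have K: "K t \<in> {- \<delta>..\<delta>}" and K': "\<bar>K t\<bar> \<le> \<delta>" for t using d by (auto simp: K_def)
  have contK: "continuous_on UNIV K" unfolding K_def by (intro continuous_intros)
  have fB: "norm (f x) \<le> B" if "x \<in> cball x0 r" for x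
  proof -
    have "norm (f x - f x0) \<le> L * norm (x - x0)" using that assms by (intro lip) auto
    also have "\<dots> \<le> L * r" using that assms by (intro mult_left_mono) (auto simp: dist_norm norm_minus_commute)
    finally show ?thesis unfolding B_def using norm_triangle_sub[of "f x" "f x0"] by simp
  qed
  have contf: "continuous_on (cball x0 r) f"
  proof (rule continuous_on_iff[THEN iffD2], intro ballI allI impI)
    fix x e :: 'b and \<epsilon> :: real assume x: "x \<in> cball x0 r" and e: "0 < \<epsilon>"
    show "\<exists>d>0. \<forall>x'\<in>cball x0 r. dist x' x < d \<longrightarrow> dist (f x') (f x) < \<epsilon>"
    proof (intro exI[of _ "\<epsilon> / (L + 1)"] conjI ballI impI)
      fix y assume y: "y \<in> cball x0 r" and "dist y x < \<epsilon> / (L + 1)"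
      then have "(L + 1) * norm (y - x) < \<epsilon>" using assms by (simp add: field_simps dist_norm)
      moreover have "L * norm (y - x) \<le> (L + 1) * norm (y - x)" by (intro mult_right_mono) auto
      ultimately show "dist (f y) (f x) < \<epsilon>" using lip[OF y x] by (simp add: dist_norm)
    qed (use assms e in auto)
  qed
  have inS: "u t \<in> cball x0 r" if "u \<in> S" for u :: "real \<Rightarrow>\<^sub>C 'b" and t
    using that by (auto simp: S_def mem_PiC_iff)
  have cu: "continuous_on T (\<lambda>x. f (u x))" if "u \<in> S" for u :: "real \<Rightarrow>\<^sub>C 'b" and T
    using that by (intro continuous_on_compose2[OF contf]) (auto simp: S_def mem_PiC_iff)
  have derG: "(G u has_vector_derivative f (u t)) (at t within {- \<delta>..\<delta>})"
    if "u \<in> S" "t \<in> {- \<delta>..\<delta>}" for u :: "real \<Rightarrow>\<^sub>C 'b" and t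
    unfolding G_def using integral_has_vector_derivative[OF cu[OF that(1)] that(2)] .
  have Gb: "norm (G u (K t) - G u 0) \<le> r" if "u \<in> S" for u :: "real \<Rightarrow>\<^sub>C 'b" and t
  proof -
    have "norm (G u (K t) - G u 0) \<le> B * \<bar>K t - 0\<bar>"
      by (rule norm_diff_le_of_vector_derivative[OF _ derG[OF that]])
         (use K d fB[OF inS[OF that]] in auto)
    also have "\<dots> \<le> B * \<delta>" using B K' by (intro mult_left_mono) auto
    finally show ?thesis using dB by simp
  qed
  have contG: "continuous_on {- \<delta>..\<delta>} (G u)" if "u \<in> S" for u :: "real \<Rightarrow>\<^sub>C 'b"
    using derG[OF that] by (meson continuous_on_eq_continuous_within has_vector_derivative_continuous)
  have PB: "P u \<in> bcontfun" if "u \<in> S" for u :: "real \<Rightarrow>\<^sub>C 'b"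
  proof (rule bcontfun_normI)
    show "continuous_on UNIV (P u)" unfolding P_def
      by (intro continuous_intros continuous_on_compose2[OF contG[OF that] contK]) (use K in auto)
    show "norm (P u t) \<le> norm x0 + r" for t
      unfolding P_def using Gb[OF that, of t] by (intro order.trans[OF norm_triangle_ineq]) auto
  qed
  have "\<exists>!u\<in>S. Q u = u"
  proof (rule Banach_fix)
    show "uniform_space_class.complete S" unfolding S_def by (simp add: complete_eq_closed closed_PiC)
    show "S \<noteq> {}" using assms
      by (auto simp: S_def mem_PiC_iff set_eq_iff intro!: exI[of _ "const_bcontfun x0"])
    show "(0::real) \<le> 1 / 2" "1 / 2 < (1::real)" by auto
    show "Q ` S \<subseteq> S"
    proof safe
      fix u assume u: "u \<in> S"
      show "Q u \<in> S" unfolding S_def mem_PiC_iff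
        using Gb[OF u] by (auto simp: Q_def Bcontfun_inverse[OF PB[OF u]] P_def dist_norm norm_minus_commute)
    qed
    show "dist (Q u) (Q v) \<le> 1 / 2 * dist u v" if u: "u \<in> S" and v: "v \<in> S" for u v
    proof (rule dist_bound)
      fix t
      have 1: "((\<lambda>t. G u t - G v t) has_vector_derivative f (u s) - f (v s)) (at s within {- \<delta>..\<delta>})"
        if "s \<in> {- \<delta>..\<delta>}" for s using that u v by (intro derivative_intros derG)
      have "norm ((G u (K t) - G v (K t)) - (G u 0 - G v 0)) \<le> (L * dist u v) * \<bar>K t - 0\<bar>"
      proof (rule norm_diff_le_of_vector_derivative[OF _ 1])
        fix s
        have "norm (f (u s) - f (v s)) \<le> L * norm (u s - v s)"
          using u v by (intro lip inS)
        also have "\<dots> \<le> L * dist u v" using dist_bounded[of u s v] assms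
          by (intro mult_left_mono) (auto simp: dist_norm)
        finally show "norm (f (u s) - f (v s)) \<le> L * dist u v" .
      qed (use K d in auto)
      also have "\<dots> \<le> (L * dist u v) * \<delta>" using K' assms by (intro mult_left_mono) auto
      also have "\<dots> = (L * \<delta>) * dist u v" by simp
      also have "\<dots> \<le> 1 / 2 * dist u v" using dL by (intro mult_right_mono) auto
      finally show "dist (Q u t) (Q v t) \<le> 1 / 2 * dist u v"
        by (simp add: Q_def Bcontfun_inverse PB u v P_def dist_norm algebra_simps)
    qed
  qed
  then obtain u where u: "u \<in> S" and fp: "Q u = u" by blast
  have uP: "u t = P u t" for t using arg_cong[OF fp, of "\<lambda>w. apply_bcontfun w t"] by (simp add: Q_def Bcontfun_inverse[OF PB[OF u]])
  show ?thesis
  proof (rule that[OF d])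
    show "u 0 = x0" using uP[of 0] d by (simp add: P_def K_def)
    fix t assume t: "t \<in> {- \<delta><..<\<delta>}"
    have "(G u has_vector_derivative f (u t)) (at t)"
      using derG[OF u, of t] t at_within_interior[of t "{- \<delta>..\<delta>}"] by auto
    then have "((\<lambda>s. x0 + (G u s - G u 0)) has_vector_derivative f (u t)) (at t)"
      by (auto intro!: derivative_eq_intros)
    then show "(apply_bcontfun u has_vector_derivative f (u t)) (at t)"
    proof (rule has_vector_derivative_transform_within_open[where S="{- \<delta><..<\<delta>}"])
      show "x0 + (G u s - G u 0) = u s" if "s \<in> {- \<delta><..<\<delta>}" for s
        using that uP[of s] by (simp add: P_def K_def)
    qed (use t in auto)
  qed
qed

text \<open>Barrier argument: \<open>g\<close> cannot cross the exponential \<open>v\<close>, whose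
  rate \<open>L + 1\<close> exceeds \<open>L\<close>. The growth hypothesis is local and one-sided
  because it serves for the essential norm along a curve, which need not be differentiable.\<close>

lemma gronwall_zero:
  fixes g :: "real \<Rightarrow> real"
  assumes cont: "continuous_on {0..T} g" and g0: "g 0 \<le> 0" and L: "0 \<le> L"
    and growth: "\<And>t e. t \<in> {0..<T} \<Longrightarrow> 0 < e \<Longrightarrow>
      eventually (\<lambda>s. g s \<le> g t + (L * g t + e) * (s - t)) (at_right t)"
    and t1: "t1 \<in> {0..T}"
  shows "g t1 \<le> 0"
proof (rule ccontr)
  assume "\<not> g t1 \<le> 0"
  \<comment> \<open>The factor 1/2 puts the barrier at time \<open>t1\<close> at half of
    \<open>g t1\<close>, hence strictly below it.\<close>
  define \<epsilon> where "\<epsilon> = g t1 / (2 * exp ((L + 1) * t1))"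
  define v where "v t = \<epsilon> * exp ((L + 1) * t)" for t
  have e: "0 < \<epsilon>" using \<open>\<not> g t1 \<le> 0\<close> by (simp add: \<epsilon>_def)
  have v1: "v t1 < g t1" using \<open>\<not> g t1 \<le> 0\<close> by (simp add: v_def \<epsilon>_def)
  define S where "S = {t \<in> {0..t1}. g t \<le> v t}"
  have cg: "continuous_on {0..t1} g" using cont by (rule continuous_on_subset) (use t1 in auto)
  have "closed S" unfolding S_def
    by (intro continuous_on_closed_Collect_le) (auto simp: v_def intro!: cg continuous_intros)
  moreover have "bounded S" by (rule bounded_subset[of "{0..t1}"]) (auto simp: S_def)
  ultimately have "compact S" by (simp add: compact_eq_bounded_closed)
  moreover have "0 \<in> S" using t1 g0 e by (auto simp: S_def v_def)
  ultimately obtain t0 where t0: "t0 \<in> S" and max: "\<And>t. t \<in> S \<Longrightarrow> t \<le> t0"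
    using compact_attains_sup[of S] by blast
  have lt: "t0 < t1" using t0 v1 by (cases "t0 = t1") (auto simp: S_def)
  have v0: "0 < v t0" using e by (simp add: v_def)
  \<comment> \<open>At the last time \<open>t0\<close> at which \<open>g\<close> does not exceed the
    barrier, the error \<open>e\<close> is taken to be \<open>v t0\<close>: this is the slack
    between the rates \<open>L\<close> and \<open>L + 1\<close>.\<close>
  have "eventually (\<lambda>s. g s \<le> g t0 + (L * g t0 + v t0) * (s - t0)) (at_right t0)"
    using t0 lt t1 v0 by (intro growth) (auto simp: S_def)
  moreover have "eventually (\<lambda>s. s \<in> {t0<..<t1}) (at_right t0)"
    using lt by (rule eventually_at_right_real)
  ultimately have "eventually (\<lambda>s. g s \<le> g t0 + (L * g t0 + v t0) * (s - t0) \<and> s \<in> {t0<..<t1}) (at_right t0)"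
    by eventually_elim auto
  then obtain s where s: "g s \<le> g t0 + (L * g t0 + v t0) * (s - t0)" "t0 < s" "s < t1"
    using eventually_happens'[OF trivial_limit_at_right_real] by fastforce
  note s(1)
  also have "g t0 + (L * g t0 + v t0) * (s - t0) \<le> v t0 + (L * v t0 + v t0) * (s - t0)"
    using t0 L s by (intro add_mono mult_right_mono mult_left_mono) (auto simp: S_def)
  also have "\<dots> = v t0 * (1 + (L + 1) * (s - t0))" by (simp add: algebra_simps)
  also have "\<dots> \<le> v t0 * exp ((L + 1) * (s - t0))" using v0 by (intro mult_left_mono) (auto simp: add.commute)
  also have "\<dots> = v s" by (simp add: v_def algebra_simps flip: exp_add)
  finally have "s \<in> S" using s t0 by (auto simp: S_def)
  from max[OF this] s show False by simp
qed

section \<open>Splitting an atomless measure into prescribed proportions\<close>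

text \<open>Of a subset of intermediate measure and its complement in the set, one has positive
  measure at most half; iterated halving gets below every \<open>e\<close>.\<close>

lemma (in finite_measure) atomless_small_subset:
  assumes "atomless M" and A: "A \<in> sets M" "0 < measure M A" and "0 < e"
  obtains B where "B \<in> sets M" "B \<subseteq> A" "0 < measure M B" "measure M B < e"
proof -
  have half: "\<exists>B\<in>sets M. B \<subseteq> A \<and> 0 < measure M B \<and> measure M B \<le> measure M A / 2"
    if A: "A \<in> sets M" "0 < measure M A" for A
  proof -
    obtain B where B: "B \<in> sets M" "B \<subseteq> A" "0 < measure M B" "measure M B < measure M A"
      using \<open>atomless M\<close> A unfolding atomless_def by (auto simp: emeasure_eq_measure ennreal_less_iff)
    have "measure M (A - B) = measure M A - measure M B"
      using A B by (intro finite_measure_Diff) auto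
    then show ?thesis using A B
      by (cases "measure M B \<le> measure M A / 2") (auto intro: bexI[of _ B] bexI[of _ "A - B"])
  qed
  have "\<exists>B\<in>sets M. B \<subseteq> A \<and> 0 < measure M B \<and> measure M B \<le> measure M A / 2 ^ n" for n
  proof (induction n)
    case (Suc n)
    then obtain B where B: "B \<in> sets M" "B \<subseteq> A" "0 < measure M B" "measure M B \<le> measure M A / 2 ^ n" by auto
    obtain C where "C \<in> sets M" "C \<subseteq> B" "0 < measure M C" "measure M C \<le> measure M B / 2"
      using half[OF B(1,3)] by auto
    then show ?case using B by (auto intro!: bexI[of _ C])
  qed (use A in auto)
  moreover obtain n where "measure M A / e < 2 ^ n" using real_arch_pow[of 2 "measure M A / e"] by auto
  then have "measure M A / 2 ^ n < e" using \<open>0 < e\<close> by (simp add: field_simps)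
  ultimately show ?thesis using that by (meson le_less_trans)
qed

text \<open>Sierpinski's theorem. The set is exhausted greedily: each step adds a subset of at least half of
  the largest admissible measure.\<close>

lemma (in finite_measure) atomless_subset_of_measure:
  assumes "atomless M" and A: "A \<in> sets M" and t: "0 \<le> t" "t \<le> measure M A"
  obtains B where "B \<in> sets M" "B \<subseteq> A" "measure M B = t"
proof -
  let ?P = "\<lambda>B. B \<in> sets M \<and> B \<subseteq> A \<and> measure M B \<le> t"
  let ?adm = "\<lambda>B C. C \<in> sets M \<and> C \<subseteq> A - B \<and> measure M B + measure M C \<le> t"
  let ?Q = "\<lambda>B B'. B \<subseteq> B' \<and> (\<forall>C. ?adm B C \<longrightarrow> measure M C \<le> 2 * (measure M B' - measure M B))"
  have step: "\<exists>B'. ?P B' \<and> ?Q B B'" if B: "?P B" for B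
  proof -
    define s where "s = (SUP C\<in>{C. ?adm B C}. measure M C)"
    have bdd: "bdd_above (measure M ` {C. ?adm B C})" 
    proof (rule bdd_aboveI)
      fix x assume "x \<in> measure M ` {C. ?adm B C}"
      then obtain C where "?adm B C" "x = measure M C" by blast
      then show "x \<le> t" using measure_nonneg[of M B] by linarith
    qed
    have ne: "{C. ?adm B C} \<noteq> {}" using B by (auto intro: exI[of _ "{}"])
    have up: "measure M C \<le> s" if "?adm B C" for C unfolding s_def by (rule cSUP_upper[OF _ bdd]) (use that in auto)
    have "\<exists>C. ?adm B C \<and> s \<le> 2 * measure M C"
    proof (cases "s \<le> 0")
      case True then show ?thesis using B by (intro exI[of _ "{}"]) auto
    next
      case False
      then have "s / 2 < s" by simp
      then obtain C where "?adm B C" "s / 2 < measure M C"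
        unfolding s_def less_cSUP_iff[OF ne bdd] by auto
      then show ?thesis by (auto intro!: exI[of _ C])
    qed
    then obtain C where C: "?adm B C" "s \<le> 2 * measure M C" by auto
    have "measure M (B \<union> C) = measure M B + measure M C" using B C by (intro finite_measure_Union) auto
    moreover have "measure M C' \<le> 2 * measure M C" if "?adm B C'" for C'
      using up[OF that] C(2) by linarith
    ultimately show ?thesis using B C by (intro exI[of _ "B \<union> C"]) auto
  qed
  obtain B where B: "\<And>n. ?P (B n)" "\<And>n. ?Q (B n) (B (Suc n))"
    using dependent_nat_choice[of "\<lambda>_. ?P" "\<lambda>_. ?Q", OF _ step] t by (metis (lifting) empty_subsetI measure_empty sets.empty_sets)
  have inc: "incseq B" using B(2) by (intro incseq_SucI) auto
  have lim: "(\<lambda>n. measure M (B n)) \<longlonglongrightarrow> measure M (\<Union>n. B n)"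
    using B(1) inc by (intro finite_Lim_measure_incseq) auto
  have le: "measure M (\<Union>n. B n) \<le> t" by (rule LIMSEQ_le_const2[OF lim]) (use B(1) in auto)
  have mono: "measure M (B n) \<le> measure M (\<Union>n. B n)" for n
    using B(1) by (intro finite_measure_mono) auto
  have "measure M (\<Union>n. B n) = t"
  proof (rule ccontr)
    assume "measure M (\<Union>n. B n) \<noteq> t"
    with le have lt: "measure M (\<Union>n. B n) < t" by simp
    have "measure M (A - (\<Union>n. B n)) = measure M A - measure M (\<Union>n. B n)"
      using A B(1) by (intro finite_measure_Diff) auto
    then have pos: "0 < measure M (A - (\<Union>n. B n))" using lt t by simp
    have meas: "A - (\<Union>n. B n) \<in> sets M" using A B(1) by auto
    \<comment> \<open>A set \<open>C\<close> this small is admissible at every stage, so each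
      increment is at least half of its measure; but the increments tend to 0.\<close>
    obtain C where C: "C \<in> sets M" "C \<subseteq> A - (\<Union>n. B n)" "0 < measure M C" "measure M C < t - measure M (\<Union>n. B n)"
      using atomless_small_subset[OF assms(1) meas pos] lt by (metis diff_gt_0_iff_gt)
    have "measure M C \<le> 2 * (measure M (B (Suc n)) - measure M (B n))" for n
    proof -
      have "?adm (B n) C" using C mono[of n] by auto
      then show ?thesis using B(2)[of n] by blast
    qed
    moreover have "(\<lambda>n. 2 * (measure M (B (Suc n)) - measure M (B n))) \<longlonglongrightarrow>
        2 * (measure M (\<Union>n. B n) - measure M (\<Union>n. B n))"
      by (intro tendsto_intros lim LIMSEQ_Suc)
    ultimately have "measure M C \<le> 0" by (intro LIMSEQ_le_const) auto
    with C show False by simp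
  qed
  then show ?thesis using B(1) by (intro that[of "\<Union>n. B n"]) auto
qed

text \<open>Induction on the labels, splitting off one part by Sierpinski's theorem. The partition
  is a measurable labelling \<open>c\<close> of the whole space, constrained on \<open>A\<close>
  only: this form passes to \<open>A - B\<close> in the induction, and it lets step kernels be
  written as functions of \<open>(c x, c y)\<close>.\<close>

lemma (in finite_measure) atomless_partition:
  assumes "atomless M" and "finite K" "K \<noteq> {}" and "A \<in> sets M"
    and "\<And>i. i \<in> K \<Longrightarrow> 0 \<le> \<alpha> i" and "measure M A = sum \<alpha> K"
  shows "\<exists>c\<in>measurable M (count_space UNIV). (\<forall>x\<in>A. c x \<in> K) \<and> (\<forall>i\<in>K. measure M {x \<in> A. c x = i} = \<alpha> i)"
  using assms(2-)
proof (induction arbitrary: A rule: finite_ne_induct)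
  case (singleton i)
  then show ?case by (intro bexI[of _ "\<lambda>_. i"]) auto
next
  case (insert i K)
  have s: "0 \<le> sum \<alpha> K" using insert by (intro sum_nonneg) auto
  obtain B where B: "B \<in> sets M" "B \<subseteq> A" "measure M B = \<alpha> i"
    using atomless_subset_of_measure[OF assms(1) insert.prems(1), of "\<alpha> i"] insert s by auto
  have "measure M (A - B) = sum \<alpha> K"
    using finite_measure_Diff[OF insert.prems(1) B(1,2)] B insert by simp
  then obtain c where c: "c \<in> measurable M (count_space UNIV)" "\<forall>x\<in>A - B. c x \<in> K"
      "\<forall>j\<in>K. measure M {x \<in> A - B. c x = j} = \<alpha> j"
    using insert.IH[of "A - B"] insert.prems B by blast
  let ?c = "\<lambda>x. if x \<in> B then i else c x"
  have "{x \<in> A. ?c x = i} = B" using c(2) B insert(3) by auto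
  moreover have "{x \<in> A. ?c x = j} = {x \<in> A - B. c x = j}" if "j \<in> K" for j using that insert(3) by auto
  moreover have "?c \<in> measurable M (count_space UNIV)" using B c(1) by (intro measurable_If_set) auto
  ultimately show ?case using c B by (intro bexI[of _ ?c]) auto
qed

section \<open>Comparing coefficients, and a product estimate\<close>

text \<open>Coefficient extraction from a polynomial that vanishes on the open simplex. The terms
  are grouped by the image of \<open>\<phi>\<close>; for \<open>V = K = T\<close> the group consists
  of the bijections, that is, of the terms with the squarefree monomial.\<close>

lemma sum_image_eq_zero:
  fixes c :: "('v \<Rightarrow> 'k) \<Rightarrow> real"
  assumes fin: "finite V" "finite K" and "K \<noteq> {}"
    and zero: "\<And>\<alpha>. (\<And>i. i \<in> K \<Longrightarrow> 0 < \<alpha> i) \<Longrightarrow> sum \<alpha> K = 1 \<Longrightarrow>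
      (\<Sum>\<phi>\<in>V \<rightarrow>\<^sub>E K. c \<phi> * (\<Prod>v\<in>V. \<alpha> (\<phi> v))) = 0"
    and "T \<subseteq> K"
  shows "(\<Sum>\<phi> | \<phi> \<in> V \<rightarrow>\<^sub>E K \<and> \<phi> ` V = T. c \<phi>) = 0"
proof -
  let ?F = "V \<rightarrow>\<^sub>E K"
  have finF: "finite ?F" using fin by (intro finite_PiE) auto
  \<comment> \<open>The polynomial is homogeneous, so division by the total mass extends the
    vanishing to all positive arguments.\<close>
  have zero': "(\<Sum>\<phi>\<in>?F. c \<phi> * (\<Prod>v\<in>V. \<alpha> (\<phi> v))) = 0" if pos: "\<And>i. i \<in> K \<Longrightarrow> 0 < \<alpha> i" for \<alpha>
  proof -
    have s: "0 < sum \<alpha> K" using pos fin \<open>K \<noteq> {}\<close> by (intro sum_pos) auto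
    have "(\<Sum>\<phi>\<in>?F. c \<phi> * (\<Prod>v\<in>V. \<alpha> (\<phi> v) / sum \<alpha> K)) = 0"
      using pos s by (intro zero) (auto simp flip: sum_divide_distrib)
    then show ?thesis using s by (simp add: prod_dividef flip: sum_divide_distrib)
  qed
  \<comment> \<open>With the variables in \<open>T\<close> equal to 1 and the others tending to 0,
    exactly the maps into \<open>T\<close> survive.\<close>
  have sub: "(\<Sum>\<phi> | \<phi> \<in> ?F \<and> \<phi> ` V \<subseteq> T. c \<phi>) = 0" for T
  proof -
    have "((\<lambda>e. \<Sum>\<phi>\<in>?F. c \<phi> * (\<Prod>v\<in>V. if \<phi> v \<in> T then 1 else e)) \<longlongrightarrow>
        (\<Sum>\<phi>\<in>?F. c \<phi> * (\<Prod>v\<in>V. if \<phi> v \<in> T then 1 else 0))) (at_right (0::real))"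
      by (intro tendsto_sum tendsto_mult tendsto_prod tendsto_const) (simp add: tendsto_ident_at)
    moreover have "eventually (\<lambda>e. (\<Sum>\<phi>\<in>?F. c \<phi> * (\<Prod>v\<in>V. if \<phi> v \<in> T then 1 else e)) = 0) (at_right (0::real))"
      unfolding eventually_at_right_field
    proof (intro exI[of _ 1] conjI allI impI)
      fix e :: real assume "0 < e"
      then show "(\<Sum>\<phi>\<in>?F. c \<phi> * (\<Prod>v\<in>V. if \<phi> v \<in> T then 1 else e)) = 0"
        by (intro zero'[of "\<lambda>i. if i \<in> T then 1 else e"]) auto
    qed simp
    ultimately have "(\<Sum>\<phi>\<in>?F. c \<phi> * (\<Prod>v\<in>V. if \<phi> v \<in> T then 1 else 0)) = 0"
      by (rule tendsto_unique[OF trivial_limit_at_right_real _ tendsto_eventually])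
    moreover have "c \<phi> * (\<Prod>v\<in>V. if \<phi> v \<in> T then 1 else 0) = (if \<phi> ` V \<subseteq> T then c \<phi> else 0)" for \<phi>
    proof (cases "\<phi> ` V \<subseteq> T")
      case True
      then have "(\<Prod>v\<in>V. if \<phi> v \<in> T then 1 else 0) = (1::real)" by (intro prod.neutral) auto
      with True show ?thesis by simp
    next
      case False
      then have "(\<Prod>v\<in>V. if \<phi> v \<in> T then 1 else 0) = (0::real)" using fin by (intro prod_zero) auto
      with False show ?thesis by simp
    qed
    ultimately have "(\<Sum>\<phi>\<in>?F. if \<phi> ` V \<subseteq> T then c \<phi> else 0) = 0" by simp
    then show ?thesis using finF by (subst (asm) sum.inter_filter[symmetric]) auto
  qed
  have "finite T" using \<open>T \<subseteq> K\<close> fin finite_subset by blast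
  then show ?thesis using \<open>T \<subseteq> K\<close>
  proof (induction rule: finite_psubset_induct)
    case (psubset T)
    \<comment> \<open>The maps with smaller image are subtracted; their sums vanish by
      induction.\<close>
    have "0 = (\<Sum>\<phi> | \<phi> \<in> ?F \<and> \<phi> ` V \<subseteq> T. c \<phi>)" using sub by simp
    also have "\<dots> = (\<Sum>U\<in>Pow T. \<Sum>\<phi> | \<phi> \<in> {\<phi>. \<phi> \<in> ?F \<and> \<phi> ` V \<subseteq> T} \<and> \<phi> ` V = U. c \<phi>)"
      using finF psubset by (intro sum.group[symmetric]) auto
    also have "\<dots> = (\<Sum>U\<in>Pow T. \<Sum>\<phi> | \<phi> \<in> ?F \<and> \<phi> ` V = U. c \<phi>)"
      by (intro sum.cong refl) auto
    also have "\<dots> = (\<Sum>\<phi> | \<phi> \<in> ?F \<and> \<phi> ` V = T. c \<phi>) + (\<Sum>U\<in>Pow T - {T}. \<Sum>\<phi> | \<phi> \<in> ?F \<and> \<phi> ` V = U. c \<phi>)"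
      using psubset by (intro sum.remove) auto
    also have "(\<Sum>U\<in>Pow T - {T}. \<Sum>\<phi> | \<phi> \<in> ?F \<and> \<phi> ` V = U. c \<phi>) = 0"
      using psubset by (intro sum.neutral) auto
    finally show ?case by simp
  qed
qed

text \<open>One factor is exchanged at a time. The exponent \<open>card I\<close> exceeds the
  optimal one by 1, which keeps the induction free of subtraction.\<close>

lemma abs_prod_diff_le:
  fixes x y :: "'i \<Rightarrow> real" and C c :: real
  assumes "finite I" and "1 \<le> C"
    and "\<And>i. i \<in> I \<Longrightarrow> \<bar>x i\<bar> \<le> C" "\<And>i. i \<in> I \<Longrightarrow> \<bar>y i\<bar> \<le> C" "\<And>i. i \<in> I \<Longrightarrow> \<bar>x i - y i\<bar> \<le> c"
  shows "\<bar>prod x I - prod y I\<bar> \<le> card I * C ^ card I * c"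
  using assms(1,3-)
proof (induction rule: finite_induct)
  case (insert i I)
  have c: "0 \<le> c" using insert.prems(3)[of i] by fastforce
  have px: "\<bar>prod x I\<bar> \<le> C ^ card I"
  proof -
    have "(\<Prod>i\<in>I. \<bar>x i\<bar>) \<le> (\<Prod>i\<in>I. C)" by (rule prod_mono) (use insert.prems in auto)
    then show ?thesis by (simp add: abs_prod)
  qed
  define D where "D = C ^ card I"
  have D: "0 \<le> D" "D \<le> C * D"
    using \<open>1 \<le> C\<close> mult_right_mono[OF \<open>1 \<le> C\<close>, of D] by (simp_all add: D_def)
  have IH: "\<bar>prod x I - prod y I\<bar> \<le> card I * D * c"
    unfolding D_def by (rule insert.IH) (use insert.prems in auto)
  have eq: "x i * prod x I - y i * prod y I = (x i - y i) * prod x I + y i * (prod x I - prod y I)"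
    by (simp add: algebra_simps)
  have "\<bar>(x i - y i) * prod x I\<bar> \<le> c * D"
    unfolding abs_mult D_def by (rule mult_mono) (use insert.prems px c in auto)
  moreover have "c * D \<le> c * (C * D)" using D c by (intro mult_left_mono) auto
  moreover have "\<bar>y i * (prod x I - prod y I)\<bar> \<le> C * (card I * D * c)"
    unfolding abs_mult by (rule mult_mono) (use insert.prems IH \<open>1 \<le> C\<close> in auto)
  ultimately have "\<bar>x i * prod x I - y i * prod y I\<bar> \<le> c * (C * D) + C * (card I * D * c)"
    unfolding eq by linarith
  then show ?case using insert.hyps by (simp add: D_def algebra_simps)
qed simp

section \<open>Curves in \<open>L\<^sup>\<infinity>\<close>\<close>

text \<open>Boundedness is asked at every point of the space and not only almost everywhere, so that
  the integrals in \<open>T_op\<close> exist for every pair of roots.\<close>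

definition bounded_measurable :: "'a measure \<Rightarrow> ('a \<times> 'a \<Rightarrow> real) set" where
  "bounded_measurable M = {U \<in> borel_measurable (M \<Otimes>\<^sub>M M). \<exists>B. \<forall>x\<in>space M. \<forall>y\<in>space M. \<bar>U (x, y)\<bar> \<le> B}"

text \<open>A real number, for use in Gronwall's inequality. As \<open>real_of_ereal\<close> sends
  infinite values to 0, its properties are stated on \<open>bounded_measurable\<close>, where the
  norm is finite.\<close>

definition ess_norm :: "'a measure \<Rightarrow> ('a \<times> 'a \<Rightarrow> real) \<Rightarrow> real" where
  "ess_norm M U = real_of_ereal (Linf_norm M U)"

lemma kernels_bounded_measurable: "U \<in> kernels M \<Longrightarrow> U \<in> bounded_measurable M"
  by (auto simp: kernels_def bounded_measurable_def)

lemma bounded_measurable_diff: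
  assumes "U \<in> bounded_measurable M" "W \<in> bounded_measurable M"
  shows "(\<lambda>p. U p - W p) \<in> bounded_measurable M"
proof -
  obtain B C where "\<forall>x\<in>space M. \<forall>y\<in>space M. \<bar>U (x, y)\<bar> \<le> B" "\<forall>x\<in>space M. \<forall>y\<in>space M. \<bar>W (x, y)\<bar> \<le> C"
    using assms by (auto simp: bounded_measurable_def)
  then have "\<forall>x\<in>space M. \<forall>y\<in>space M. \<bar>U (x, y) - W (x, y)\<bar> \<le> B + C"
    by (meson abs_triangle_ineq4 add_mono order.trans)
  then show ?thesis using assms by (auto simp: bounded_measurable_def)
qed

lemma bounded_measurable_AE_bound:
  assumes "U \<in> bounded_measurable M"
  obtains B where "0 \<le> B" "AE p in M \<Otimes>\<^sub>M M. \<bar>U p\<bar> \<le> B"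
proof -
  obtain B where B: "\<forall>x\<in>space M. \<forall>y\<in>space M. \<bar>U (x, y)\<bar> \<le> B"
    using assms by (auto simp: bounded_measurable_def)
  have "AE p in M \<Otimes>\<^sub>M M. \<bar>U p\<bar> \<le> max 0 B"
    using B by (intro AE_I2) (auto simp: space_pair_measure le_max_iff_disj)
  then show ?thesis using that[of "max 0 B"] by simp
qed

lemma Linf_norm_less_AE:
  assumes "Linf_norm M U < ereal e"
  shows "AE p in M \<Otimes>\<^sub>M M. \<bar>U p\<bar> \<le> e"
  using esssup_AE[of "\<lambda>p. ereal \<bar>U p\<bar>" "M \<Otimes>\<^sub>M M"]
proof (rule AE_mp, intro AE_I2 impI)
  fix p assume "ereal \<bar>U p\<bar> \<le> esssup (M \<Otimes>\<^sub>M M) (\<lambda>p. ereal \<bar>U p\<bar>)"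
  then have "ereal \<bar>U p\<bar> < ereal e" using assms unfolding Linf_norm_def by (rule le_less_trans)
  then show "\<bar>U p\<bar> \<le> e" by simp
qed

lemma Linf_norm_le:
  assumes "U \<in> borel_measurable (M \<Otimes>\<^sub>M M)" and "AE p in M \<Otimes>\<^sub>M M. \<bar>U p\<bar> \<le> e"
  shows "Linf_norm M U \<le> ereal e"
  unfolding Linf_norm_def using assms by (intro esssup_I) auto

text \<open>\<open>esssup\<close> distinguishes whether the function is measurable; this distinction
  as well as the limit superior depend only on the values on the space. Velocities that agree at
  points of the space can thus be exchanged inside the norm.\<close>

lemma Linf_norm_cong_space:
  assumes "\<And>x y. x \<in> space M \<Longrightarrow> y \<in> space M \<Longrightarrow> U (x, y) = W (x, y)"
  shows "Linf_norm M U = Linf_norm M W"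
proof -
  have eq: "U p = W p" if "p \<in> space (M \<Otimes>\<^sub>M M)" for p
    using assms that by (cases p) (auto simp: space_pair_measure)
  have "(\<lambda>p. ereal \<bar>U p\<bar>) \<in> borel_measurable (M \<Otimes>\<^sub>M M) \<longleftrightarrow> (\<lambda>p. ereal \<bar>W p\<bar>) \<in> borel_measurable (M \<Otimes>\<^sub>M M)"
    by (rule measurable_cong) (simp add: eq)
  moreover have "Limsup (ae_filter (M \<Otimes>\<^sub>M M)) (\<lambda>p. ereal \<bar>U p\<bar>) = Limsup (ae_filter (M \<Otimes>\<^sub>M M)) (\<lambda>p. ereal \<bar>W p\<bar>)"
    by (rule Limsup_eq, rule AE_I2) (simp add: eq)
  ultimately show ?thesis by (simp add: Linf_norm_def esssup_def)
qed

lemma (in prob_space) prob_space_square: "prob_space (M \<Otimes>\<^sub>M M)"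
proof -
  interpret pair_prob_space M M ..
  show ?thesis by unfold_locales
qed

lemma (in prob_space) AE_bound_nonneg:
  assumes "AE p in M \<Otimes>\<^sub>M M. \<bar>U p\<bar> \<le> (c::real)"
  shows "0 \<le> c"
proof (rule ccontr)
  assume "\<not> 0 \<le> c"
  interpret P: prob_space "M \<Otimes>\<^sub>M M" by (rule prob_space_square)
  have "AE p in M \<Otimes>\<^sub>M M. False" using assms by eventually_elim (use \<open>\<not> 0 \<le> c\<close> in auto)
  then show False by simp
qed

lemma (in prob_space) Linf_norm_nonneg: "0 \<le> Linf_norm M U"
proof (rule ccontr)
  assume "\<not> 0 \<le> Linf_norm M U"
  then obtain e where "Linf_norm M U < ereal e" "ereal e < 0" using ereal_dense2[of "Linf_norm M U" 0] by (auto simp: not_le)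
  then show False using AE_bound_nonneg[OF Linf_norm_less_AE[of M U e]] by simp
qed

lemma (in prob_space) ess_norm_properties:
  assumes "U \<in> bounded_measurable M"
  shows AE_le_ess_norm: "AE p in M \<Otimes>\<^sub>M M. \<bar>U p\<bar> \<le> ess_norm M U"
    and ess_norm_le: "AE p in M \<Otimes>\<^sub>M M. \<bar>U p\<bar> \<le> c \<Longrightarrow> ess_norm M U \<le> c"
proof -
  have m: "U \<in> borel_measurable (M \<Otimes>\<^sub>M M)" using assms by (auto simp: bounded_measurable_def)
  obtain B where "AE p in M \<Otimes>\<^sub>M M. \<bar>U p\<bar> \<le> B" using assms bounded_measurable_AE_bound by blast
  then have "Linf_norm M U \<le> ereal B" by (rule Linf_norm_le[OF m])
  then obtain n where n: "Linf_norm M U = ereal n" using Linf_norm_nonneg[of U] by (cases "Linf_norm M U") auto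
  show "AE p in M \<Otimes>\<^sub>M M. \<bar>U p\<bar> \<le> ess_norm M U"
    using esssup_AE[of "\<lambda>p. ereal \<bar>U p\<bar>" "M \<Otimes>\<^sub>M M"] n by (simp add: ess_norm_def Linf_norm_def)
  show "ess_norm M U \<le> c" if "AE p in M \<Otimes>\<^sub>M M. \<bar>U p\<bar> \<le> c"
    using Linf_norm_le[OF m that] n by (simp add: ess_norm_def)
qed

section \<open>Differentiation of curves in essential supremum norm\<close>

text \<open>Differentiability in essential supremum norm, written without quotients and without the
  norm; the null set may depend on \<open>s\<close>.\<close>

definition has_AE_derivative ::
  "'a measure \<Rightarrow> (real \<Rightarrow> 'a \<times> 'a \<Rightarrow> real) \<Rightarrow> ('a \<times> 'a \<Rightarrow> real) \<Rightarrow> real \<Rightarrow> bool" where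
  "has_AE_derivative M X D t \<longleftrightarrow>
     (\<forall>e>0. eventually (\<lambda>s. AE p in M \<Otimes>\<^sub>M M. \<bar>X s p - X t p - (s - t) * D p\<bar> \<le> e * \<bar>s - t\<bar>) (at t))"

lemma difference_quotient_le_iff:
  assumes "s \<noteq> (t::real)"
  shows "\<bar>(u - w) / (s - t) - d\<bar> \<le> e \<longleftrightarrow> \<bar>u - w - (s - t) * d\<bar> \<le> e * \<bar>s - t\<bar>"
proof -
  have "(u - w) / (s - t) - d = (u - w - (s - t) * d) / (s - t)"
    using assms by (simp add: field_simps)
  then show ?thesis using assms by (simp add: abs_divide pos_divide_le_eq)
qed

text \<open>The essential supremum of a non-measurable function is infinite, so the implication needs no
  measurability hypothesis.\<close>

lemma has_AE_derivative_of_Linf: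
  assumes "has_Linf_derivative M X D t"
  shows "has_AE_derivative M X D t"
  unfolding has_AE_derivative_def
proof (intro allI impI)
  fix e :: real assume "0 < e"
  then have "eventually (\<lambda>s. Linf_norm M (\<lambda>p. (X s p - X t p) / (s - t) - D p) < ereal e) (at t)"
    using assms by (intro order_tendstoD(2)[of _ 0]) (simp_all add: has_Linf_derivative_def)
  then show "eventually (\<lambda>s. AE p in M \<Otimes>\<^sub>M M. \<bar>X s p - X t p - (s - t) * D p\<bar> \<le> e * \<bar>s - t\<bar>) (at t)"
    using eventually_neq_at_within[of t t UNIV]
  proof eventually_elim
    case (elim s)
    show ?case using Linf_norm_less_AE[OF elim(1)] elim(2) by (simp add: difference_quotient_le_iff)
  qed
qed

lemma (in prob_space) has_Linf_derivativeI:
  assumes der: "has_AE_derivative M X D t"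
    and "eventually (\<lambda>s. X s \<in> borel_measurable (M \<Otimes>\<^sub>M M)) (at t)"
    and "X t \<in> borel_measurable (M \<Otimes>\<^sub>M M)" "D \<in> borel_measurable (M \<Otimes>\<^sub>M M)"
  shows "has_Linf_derivative M X D t"
  unfolding has_Linf_derivative_def
proof (rule order_tendstoI)
  fix a :: ereal assume "a < 0"
  then show "eventually (\<lambda>s. a < Linf_norm M (\<lambda>p. (X s p - X t p) / (s - t) - D p)) (at t)"
    using Linf_norm_nonneg less_le_trans by (intro always_eventually) blast
next
  fix a :: ereal assume "0 < a"
  then obtain e where e: "0 < ereal e" "ereal e < a" using ereal_dense2 by blast
  then have "eventually (\<lambda>s. AE p in M \<Otimes>\<^sub>M M. \<bar>X s p - X t p - (s - t) * D p\<bar> \<le> e * \<bar>s - t\<bar>) (at t)"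
    using der by (simp add: has_AE_derivative_def)
  with assms(2) show "eventually (\<lambda>s. Linf_norm M (\<lambda>p. (X s p - X t p) / (s - t) - D p) < a) (at t)"
    using eventually_neq_at_within[of t t UNIV]
  proof eventually_elim
    case (elim s)
    have "Linf_norm M (\<lambda>p. (X s p - X t p) / (s - t) - D p) \<le> ereal e"
      using elim assms(3,4) by (intro Linf_norm_le) (simp_all add: difference_quotient_le_iff)
    then show ?case using e by simp
  qed
qed

lemma has_AE_derivative_diff:
  assumes X: "has_AE_derivative M X D t" and Y: "has_AE_derivative M Y E t"
  shows "has_AE_derivative M (\<lambda>s p. X s p - Y s p) (\<lambda>p. D p - E p) t"
  unfolding has_AE_derivative_def
proof (intro allI impI)
  fix e :: real assume "0 < e"
  then have "0 < e / 2" by simp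
  have "eventually (\<lambda>s. AE p in M \<Otimes>\<^sub>M M. \<bar>X s p - X t p - (s - t) * D p\<bar> \<le> e / 2 * \<bar>s - t\<bar>) (at t)"
       "eventually (\<lambda>s. AE p in M \<Otimes>\<^sub>M M. \<bar>Y s p - Y t p - (s - t) * E p\<bar> \<le> e / 2 * \<bar>s - t\<bar>) (at t)"
    using X Y \<open>0 < e / 2\<close> unfolding has_AE_derivative_def by blast+
  then show "eventually (\<lambda>s. AE p in M \<Otimes>\<^sub>M M.
      \<bar>X s p - Y s p - (X t p - Y t p) - (s - t) * (D p - E p)\<bar> \<le> e * \<bar>s - t\<bar>) (at t)"
  proof eventually_elim
    case (elim s)
    then show ?case
    proof eventually_elim
      case (elim p)
      have "X s p - Y s p - (X t p - Y t p) - (s - t) * (D p - E p)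
          = (X s p - X t p - (s - t) * D p) - (Y s p - Y t p - (s - t) * E p)"
        by (simp add: algebra_simps)
      then have "\<bar>X s p - Y s p - (X t p - Y t p) - (s - t) * (D p - E p)\<bar> \<le>
          \<bar>X s p - X t p - (s - t) * D p\<bar> + \<bar>Y s p - Y t p - (s - t) * E p\<bar>"
        by (simp only: abs_triangle_ineq4)
      then show ?case using elim by linarith
    qed
  qed
qed

lemma has_AE_derivative_cong:
  assumes X: "has_AE_derivative M X D t"
    and "eventually (\<lambda>s. AE p in M \<Otimes>\<^sub>M M. X s p = Y s p) (at t)"
    and "AE p in M \<Otimes>\<^sub>M M. X t p = Y t p" "AE p in M \<Otimes>\<^sub>M M. D p = E p"
  shows "has_AE_derivative M Y E t"
  unfolding has_AE_derivative_def
proof (intro allI impI)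
  fix e :: real assume "0 < e"
  then have "eventually (\<lambda>s. AE p in M \<Otimes>\<^sub>M M. \<bar>X s p - X t p - (s - t) * D p\<bar> \<le> e * \<bar>s - t\<bar>) (at t)"
    using X by (simp add: has_AE_derivative_def)
  with assms(2) show "eventually (\<lambda>s. AE p in M \<Otimes>\<^sub>M M. \<bar>Y s p - Y t p - (s - t) * E p\<bar> \<le> e * \<bar>s - t\<bar>) (at t)"
  proof eventually_elim
    case (elim s)
    with assms(3,4) show ?case by eventually_elim auto
  qed
qed

text \<open>At one suitable \<open>s\<close> near \<open>t\<close> the derivative differs by at most
  1 from a difference quotient of bounded functions.\<close>

lemma (in prob_space) AE_bound_of_derivative:
  assumes der: "has_AE_derivative M X D t"
    and X: "eventually (\<lambda>s. X s \<in> bounded_measurable M) (at t)" "X t \<in> bounded_measurable M"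
  obtains C where "0 \<le> C" "AE p in M \<Otimes>\<^sub>M M. \<bar>D p\<bar> \<le> C"
proof -
  have "eventually (\<lambda>s. s \<noteq> t \<and> X s \<in> bounded_measurable M \<and>
      (AE p in M \<Otimes>\<^sub>M M. \<bar>X s p - X t p - (s - t) * D p\<bar> \<le> 1 * \<bar>s - t\<bar>)) (at t)"
    using X(1) der[unfolded has_AE_derivative_def, rule_format, OF zero_less_one] eventually_neq_at_within[of t t UNIV]
    by eventually_elim auto
  from eventually_happens'[OF at_neq_bot this]
  obtain s where s: "s \<noteq> t" "X s \<in> bounded_measurable M"
      "AE p in M \<Otimes>\<^sub>M M. \<bar>X s p - X t p - (s - t) * D p\<bar> \<le> 1 * \<bar>s - t\<bar>"
    by blast
  obtain B where B: "0 \<le> B" "AE p in M \<Otimes>\<^sub>M M. \<bar>X s p - X t p\<bar> \<le> B"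
    using bounded_measurable_AE_bound[OF bounded_measurable_diff[OF s(2) X(2)]] by blast
  show ?thesis
  proof (rule that[of "(B + \<bar>s - t\<bar>) / \<bar>s - t\<bar>"])
    show "AE p in M \<Otimes>\<^sub>M M. \<bar>D p\<bar> \<le> (B + \<bar>s - t\<bar>) / \<bar>s - t\<bar>"
      using B(2) s(3)
    proof eventually_elim
      case (elim p)
      then have "\<bar>(s - t) * D p\<bar> \<le> B + \<bar>s - t\<bar>" by (simp only: mult_1)
      then show ?case using s(1) by (simp add: abs_mult pos_le_divide_eq mult.commute)
    qed
  qed (use B in simp)
qed

lemma (in prob_space) isCont_ess_norm:
  assumes der: "has_AE_derivative M X D t"
    and X: "eventually (\<lambda>s. X s \<in> bounded_measurable M) (at t)" "X t \<in> bounded_measurable M"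
  shows "isCont (\<lambda>s. ess_norm M (X s)) t"
proof -
  obtain C where C: "0 \<le> C" "AE p in M \<Otimes>\<^sub>M M. \<bar>D p\<bar> \<le> C" using AE_bound_of_derivative[OF assms] .
  have "eventually (\<lambda>s. \<bar>ess_norm M (X s) - ess_norm M (X t)\<bar> \<le> (C + 1) * \<bar>s - t\<bar>) (at t)"
    using X(1) der[unfolded has_AE_derivative_def, rule_format, OF zero_less_one]
  proof eventually_elim
    case (elim s)
    have d: "AE p in M \<Otimes>\<^sub>M M. \<bar>X s p - X t p\<bar> \<le> (C + 1) * \<bar>s - t\<bar>"
      using elim(2) C(2)
    proof eventually_elim
      case (elim p)
      have "\<bar>(s - t) * D p\<bar> \<le> \<bar>s - t\<bar> * C" unfolding abs_mult using elim by (intro mult_left_mono) auto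
      then show ?case using elim by (simp add: algebra_simps)
    qed
    have "AE p in M \<Otimes>\<^sub>M M. \<bar>X s p\<bar> \<le> ess_norm M (X t) + (C + 1) * \<bar>s - t\<bar>"
      using d AE_le_ess_norm[OF X(2)] by eventually_elim linarith
    then have "ess_norm M (X s) \<le> ess_norm M (X t) + (C + 1) * \<bar>s - t\<bar>"
      by (rule ess_norm_le[OF elim(1)])
    moreover have "AE p in M \<Otimes>\<^sub>M M. \<bar>X t p\<bar> \<le> ess_norm M (X s) + (C + 1) * \<bar>s - t\<bar>"
      using d AE_le_ess_norm[OF elim(1)] by eventually_elim linarith
    then have "ess_norm M (X t) \<le> ess_norm M (X s) + (C + 1) * \<bar>s - t\<bar>"
      by (rule ess_norm_le[OF X(2)])
    ultimately show ?case by linarith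
  qed
  moreover have "((\<lambda>s. (C + 1) * \<bar>s - t\<bar>) \<longlongrightarrow> 0) (at t)"
    by (auto intro!: tendsto_eq_intros)
  ultimately have "((\<lambda>s. ess_norm M (X s) - ess_norm M (X t)) \<longlongrightarrow> 0) (at t)"
    unfolding real_norm_def[symmetric] by (rule Lim_null_comparison)
  then show ?thesis unfolding isCont_def by (rule LIM_zero_cancel)
qed


text \<open>The constant curve \<open>X - X\<close> has derivative \<open>D - E\<close>; a single
  \<open>s\<close> near \<open>t\<close> bounds it by \<open>e\<close> almost everywhere, and
  countably many values of \<open>e\<close> suffice.\<close>

lemma has_AE_derivative_unique:
  assumes X: "has_AE_derivative M X D t" and Y: "has_AE_derivative M X E t"
  shows "AE p in M \<Otimes>\<^sub>M M. D p = E p"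
proof -
  have "AE p in M \<Otimes>\<^sub>M M. \<bar>D p - E p\<bar> \<le> e" if "0 < e" for e
  proof -
    have "eventually (\<lambda>s. AE p in M \<Otimes>\<^sub>M M. \<bar>0 - (s - t) * (D p - E p)\<bar> \<le> e * \<bar>s - t\<bar>) (at t)"
      using has_AE_derivative_diff[OF X Y] that unfolding has_AE_derivative_def by simp
    then obtain s where "s \<noteq> t" "AE p in M \<Otimes>\<^sub>M M. \<bar>0 - (s - t) * (D p - E p)\<bar> \<le> e * \<bar>s - t\<bar>"
      using eventually_happens'[OF at_neq_bot eventually_conj[OF _ eventually_neq_at_within[of t t UNIV]]] by blast
    then show ?thesis by (simp add: abs_mult mult.commute)
  qed
  then have "AE p in M \<Otimes>\<^sub>M M. \<forall>n. \<bar>D p - E p\<bar> \<le> inverse (Suc n)"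
    by (subst AE_all_countable) simp
  then show ?thesis
  proof eventually_elim
    case (elim p)
    have "\<bar>D p - E p\<bar> \<le> 0"
      by (rule LIMSEQ_le_const[OF LIMSEQ_inverse_real_of_nat]) (use elim in auto)
    then show ?case by simp
  qed
qed

text \<open>Uniqueness of Lipschitz differential equations in \<open>L\<^sup>\<infinity>\<close>, applied to the difference of two
  solutions; the sign \<open>\<sigma>\<close> selects the direction of time.\<close>

lemma (in prob_space) AE_zero_of_derivative_bound:
  fixes \<sigma> T L :: real
  assumes \<sigma>: "\<bar>\<sigma>\<bar> = 1" and "0 \<le> T" and "0 \<le> L" and J: "open J" "\<And>s. s \<in> {0..T} \<Longrightarrow> \<sigma> * s \<in> J"
    and X: "\<And>s. s \<in> J \<Longrightarrow> X s \<in> bounded_measurable M"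
    and der: "\<And>s. s \<in> J \<Longrightarrow> has_AE_derivative M X (D s) s"
    and bound: "\<And>s. s \<in> {0..T} \<Longrightarrow> AE p in M \<Otimes>\<^sub>M M. \<bar>D (\<sigma> * s) p\<bar> \<le> L * ess_norm M (X (\<sigma> * s))"
    and X0: "AE p in M \<Otimes>\<^sub>M M. X 0 p = 0"
  shows "AE p in M \<Otimes>\<^sub>M M. X (\<sigma> * T) p = 0"
proof -
  let ?g = "\<lambda>s. ess_norm M (X (\<sigma> * s))"
  have \<sigma>0: "\<sigma> \<noteq> 0" using \<sigma> by auto
  have ev: "eventually (\<lambda>s. X s \<in> bounded_measurable M) (at t)" if "t \<in> J" for t
    using eventually_at_in_open'[OF J(1) that] by eventually_elim (rule X)
  have icont: "isCont (\<lambda>s. ess_norm M (X s)) t" if "t \<in> J" for t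
    by (rule isCont_ess_norm[OF der[OF that] ev[OF that] X[OF that]])
  have "isCont ?g s" if "s \<in> {0..T}" for s
    by (rule isCont_o2[where f="\<lambda>s. \<sigma> * s" and g="\<lambda>s. ess_norm M (X s)", OF _ icont[OF J(2)[OF that]]]) simp
  then have cont: "continuous_on {0..T} ?g" by (simp add: continuous_at_imp_continuous_on)
  have "?g T \<le> 0"
  proof (rule gronwall_zero[OF cont _ \<open>0 \<le> L\<close>])
    have "0 \<in> J" using J(2)[of 0] \<open>0 \<le> T\<close> by simp
    from X0 have "AE p in M \<Otimes>\<^sub>M M. \<bar>X 0 p\<bar> \<le> 0" by eventually_elim simp
    from ess_norm_le[OF X[OF \<open>0 \<in> J\<close>] this] show "?g 0 \<le> 0" by simp
    show "T \<in> {0..T}" using \<open>0 \<le> T\<close> by simp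
    fix t e :: real assume t: "t \<in> {0..<T}" and "0 < e"
    let ?P = "\<lambda>s. X s \<in> bounded_measurable M \<and>
      (AE p in M \<Otimes>\<^sub>M M. \<bar>X s p - X (\<sigma> * t) p - (s - \<sigma> * t) * D (\<sigma> * t) p\<bar> \<le> e * \<bar>s - \<sigma> * t\<bar>)"
    have tT: "t \<in> {0..T}" using t by simp
    have tJ: "\<sigma> * t \<in> J" using J(2) t by simp
    have "eventually ?P (at (\<sigma> * t))"
      using ev[OF tJ] der[OF tJ] \<open>0 < e\<close> unfolding has_AE_derivative_def by (intro eventually_conj) auto
    \<comment> \<open>Multiplication by \<open>\<sigma>\<close> carries right neighbourhoods of
      \<open>t\<close> into punctured neighbourhoods of \<open>\<sigma> * t\<close>; for
      \<open>\<sigma> = - 1\<close> this is the passage to backward time.\<close>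
    moreover have "filterlim (\<lambda>s. \<sigma> * s) (at (\<sigma> * t)) (at_right t)"
      using \<sigma>0 by (intro filterlim_atI) (auto intro!: tendsto_eq_intros simp: eventually_at_filter)
    ultimately have "eventually (\<lambda>s. ?P (\<sigma> * s)) (at_right t)"
      by (rule eventually_compose_filterlim)
    then show "eventually (\<lambda>s. ?g s \<le> ?g t + (L * ?g t + e) * (s - t)) (at_right t)"
      using eventually_at_right_less[of t]
    proof eventually_elim
      case (elim s)
      have abs: "\<bar>\<sigma> * s - \<sigma> * t\<bar> = s - t"
        using \<sigma> elim by (simp add: abs_mult flip: right_diff_distrib)
      have "AE p in M \<Otimes>\<^sub>M M. \<bar>X (\<sigma> * s) p\<bar> \<le> ?g t + (L * ?g t + e) * (s - t)"
        using conjunct2[OF elim(1)] bound[OF tT] AE_le_ess_norm[OF X[OF tJ]]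
      proof eventually_elim
        case (elim p)
        note 1 = elim(1)[unfolded abs] and 2 = elim(2) and 3 = elim(3)
        have "\<bar>(\<sigma> * s - \<sigma> * t) * D (\<sigma> * t) p\<bar> \<le> (s - t) * (L * ?g t)"
          unfolding abs_mult[of "\<sigma> * s - \<sigma> * t"] abs using 2 \<open>t < s\<close> by (intro mult_left_mono) auto
        moreover have "?g t + (L * ?g t + e) * (s - t) = ?g t + (s - t) * (L * ?g t) + e * (s - t)"
          by (simp add: algebra_simps)
        ultimately show ?case using 1 3 by linarith
      qed
      with elim(1) show ?case by (blast intro: ess_norm_le)
    qed
  qed
  moreover have "AE p in M \<Otimes>\<^sub>M M. \<bar>X (\<sigma> * T) p\<bar> \<le> ?g T"
    using \<open>0 \<le> T\<close> by (intro AE_le_ess_norm X J(2)) simp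
  ultimately show ?thesis by (auto elim!: eventually_mono)
qed

section \<open>The velocity operator\<close>

text \<open>The integrand of \<open>T_op\<close> as a single product. The type of points is left
  open so that it serves both for kernels and for matrices indexed by labels.\<close>

definition graph_weight :: "nat \<Rightarrow> nat set set \<Rightarrow> ('b \<times> 'b \<Rightarrow> real) \<Rightarrow> (nat \<Rightarrow> 'b) \<Rightarrow> real" where
  "graph_weight k F W u =
     (\<Prod>(i, j)\<in>vertex_pairs k. if {i, j} \<in> F then W (u i, u j) else 1 - W (u i, u j))"

lemma finite_vertex_pairs [simp]: "finite (vertex_pairs k)"
  by (rule finite_subset[of _ "{1..k} \<times> {1..k}"]) (auto simp: vertex_pairs_def)

lemma finite_graphs [simp]: "finite (graphs k)"
proof -
  have "finite {{i, j} | i j. i \<in> {1..k} \<and> j \<in> {1..k} \<and> i \<noteq> j}"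
    by (rule finite_subset[of _ "Pow {1..k}"]) auto
  then show ?thesis by (simp add: graphs_def)
qed

lemma T_op_eq_graph_weight:
  "T_op M k F a b W (x, y) =
     (LINT z | PiM ({1..k} - {a, b}) (\<lambda>_. M). graph_weight k F W (z(a := x, b := y)))"
proof -
  have "(\<Prod>(i, j)\<in>{(i, j) \<in> vertex_pairs k. {i, j} \<in> F}. W (u i, u j)) *
      (\<Prod>(i, j)\<in>{(i, j) \<in> vertex_pairs k. {i, j} \<notin> F}. 1 - W (u i, u j)) = graph_weight k F W u"
    for u :: "nat \<Rightarrow> 'a"
  proof -
    have "graph_weight k F W u = (\<Prod>p\<in>vertex_pairs k. if {fst p, snd p} \<in> F
        then (case p of (i, j) \<Rightarrow> W (u i, u j)) else (case p of (i, j) \<Rightarrow> 1 - W (u i, u j)))"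
      unfolding graph_weight_def by (intro prod.cong) auto
    also have "\<dots> = (\<Prod>(i, j)\<in>vertex_pairs k \<inter> {p. {fst p, snd p} \<in> F}. W (u i, u j)) *
        (\<Prod>(i, j)\<in>vertex_pairs k \<inter> - {p. {fst p, snd p} \<in> F}. 1 - W (u i, u j))"
      by (rule prod.If_cases) simp
    also have "vertex_pairs k \<inter> {p. {fst p, snd p} \<in> F} = {(i, j) \<in> vertex_pairs k. {i, j} \<in> F}" by auto
    also have "vertex_pairs k \<inter> - {p. {fst p, snd p} \<in> F} = {(i, j) \<in> vertex_pairs k. {i, j} \<notin> F}" by auto
    finally show ?thesis by simp
  qed
  then show ?thesis by (simp add: T_op_def Let_def)
qed

lemma graph_weight_measurable:
  assumes W: "W \<in> borel_measurable (M \<Otimes>\<^sub>M M)"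
    and u: "\<And>i. i \<in> {1..k} \<Longrightarrow> (\<lambda>\<omega>. u \<omega> i) \<in> measurable N M"
  shows "(\<lambda>\<omega>. graph_weight k F W (u \<omega>)) \<in> borel_measurable N"
proof -
  have 1: "(\<lambda>\<omega>. W (u \<omega> i, u \<omega> j)) \<in> borel_measurable N" if "(i, j) \<in> vertex_pairs k" for i j
    using that u by (intro measurable_compose[OF _ W] measurable_Pair) (auto simp: vertex_pairs_def)
  show ?thesis unfolding graph_weight_def
  proof (rule borel_measurable_prod)
    fix p assume p: "p \<in> vertex_pairs k"
    show "(\<lambda>\<omega>. case p of (i, j) \<Rightarrow> if {i, j} \<in> F then W (u \<omega> i, u \<omega> j) else 1 - W (u \<omega> i, u \<omega> j)) \<in> borel_measurable N"
      using 1[of "fst p" "snd p"] p by (cases p; cases "{fst p, snd p} \<in> F") auto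
  qed
qed

lemma abs_graph_weight_le:
  assumes "\<And>i j. (i, j) \<in> vertex_pairs k \<Longrightarrow> \<bar>W (u i, u j)\<bar> \<le> B"
  shows "\<bar>graph_weight k F W u\<bar> \<le> (1 + B) ^ card (vertex_pairs k)"
proof -
  have "\<bar>graph_weight k F W u\<bar> \<le> (\<Prod>p\<in>vertex_pairs k. 1 + B)"
    unfolding graph_weight_def abs_prod
  proof (rule prod_mono, clarsimp)
    fix i j assume "(i, j) \<in> vertex_pairs k"
    from assms[OF this] show "({i, j} \<in> F \<longrightarrow> \<bar>W (u i, u j)\<bar> \<le> 1 + B) \<and> ({i, j} \<notin> F \<longrightarrow> \<bar>1 - W (u i, u j)\<bar> \<le> 1 + B)"
      by auto
  qed
  then show ?thesis by simp
qed

lemma abs_graph_weight_diff_le: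
  fixes B c :: real
  assumes "0 \<le> B"
    and "\<And>i j. (i, j) \<in> vertex_pairs k \<Longrightarrow> \<bar>U (u i, u j)\<bar> \<le> B"
    and "\<And>i j. (i, j) \<in> vertex_pairs k \<Longrightarrow> \<bar>W (u i, u j)\<bar> \<le> B"
    and "\<And>i j. (i, j) \<in> vertex_pairs k \<Longrightarrow> \<bar>U (u i, u j) - W (u i, u j)\<bar> \<le> c"
  shows "\<bar>graph_weight k F U u - graph_weight k F W u\<bar>
    \<le> card (vertex_pairs k) * (1 + B) ^ card (vertex_pairs k) * c"
  unfolding graph_weight_def
proof (rule abs_prod_diff_le)
  fix p assume "p \<in> vertex_pairs k"
  then obtain i j where p: "p = (i, j)" "(i, j) \<in> vertex_pairs k" by (cases p) auto
  note b = assms(2-4)[OF p(2)]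
  show "\<bar>case p of (i, j) \<Rightarrow> if {i, j} \<in> F then U (u i, u j) else 1 - U (u i, u j)\<bar> \<le> 1 + B"
    using b \<open>0 \<le> B\<close> by (auto simp: p(1))
  show "\<bar>case p of (i, j) \<Rightarrow> if {i, j} \<in> F then W (u i, u j) else 1 - W (u i, u j)\<bar> \<le> 1 + B"
    using b \<open>0 \<le> B\<close> by (auto simp: p(1))
  show "\<bar>(case p of (i, j) \<Rightarrow> if {i, j} \<in> F then U (u i, u j) else 1 - U (u i, u j)) -
      (case p of (i, j) \<Rightarrow> if {i, j} \<in> F then W (u i, u j) else 1 - W (u i, u j))\<bar> \<le> c"
    using b by (auto simp: p(1) abs_minus_commute)
qed (use \<open>0 \<le> B\<close> in auto)

section \<open>Root coordinates in the product measure\<close>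

lemma (in prob_space) prob_space_PiM_same: "prob_space (PiM J (\<lambda>_. M))"
  by (rule prob_space_PiM) (rule prob_space_axioms)

lemma root_update_measurable:
  assumes "i \<in> {1..k}"
  shows "(\<lambda>\<omega>. ((snd \<omega>)(a := fst (fst \<omega>), b := snd (fst \<omega>))) i)
    \<in> measurable ((M \<Otimes>\<^sub>M M) \<Otimes>\<^sub>M PiM ({1..k} - {a, b}) (\<lambda>_. M)) M"
  using assms by (cases "i = b"; cases "i = a") auto

lemma (in prob_space) T_op_measurable:
  assumes "W \<in> borel_measurable (M \<Otimes>\<^sub>M M)"
  shows "T_op M k F a b W \<in> borel_measurable (M \<Otimes>\<^sub>M M)"
proof -
  let ?P = "PiM ({1..k} - {a, b}) (\<lambda>_. M)"
  interpret P: prob_space ?P by (rule prob_space_PiM_same)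
  have "(\<lambda>\<omega>. graph_weight k F W ((snd \<omega>)(a := fst (fst \<omega>), b := snd (fst \<omega>))))
      \<in> borel_measurable ((M \<Otimes>\<^sub>M M) \<Otimes>\<^sub>M ?P)"
    by (rule graph_weight_measurable[OF assms root_update_measurable])
  then have "(\<lambda>p. LINT z|?P. graph_weight k F W (z(a := fst p, b := snd p))) \<in> borel_measurable (M \<Otimes>\<^sub>M M)"
    by (intro P.borel_measurable_lebesgue_integral) (simp add: case_prod_unfold)
  moreover have "T_op M k F a b W = (\<lambda>p. LINT z|?P. graph_weight k F W (z(a := fst p, b := snd p)))"
    by (auto simp: fun_eq_iff T_op_eq_graph_weight)
  ultimately show ?thesis by simp
qed

lemma (in prob_space) velocity_measurable:
  assumes "W \<in> borel_measurable (M \<Otimes>\<^sub>M M)"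
  shows "velocity M k R W \<in> borel_measurable (M \<Otimes>\<^sub>M M)"
  unfolding velocity_def
  by (rule borel_measurable_sum) (auto intro!: borel_measurable_times T_op_measurable[OF assms])

text \<open>Two independent root coordinates and the remaining ones reassemble to the full product
  measure; this is the measure preserving map behind Fubini's theorem for fixed roots.\<close>

lemma (in prob_space) distr_root_update:
  assumes "a \<in> K" "b \<in> K" "a \<noteq> b" "finite K"
  shows "distr ((M \<Otimes>\<^sub>M M) \<Otimes>\<^sub>M PiM (K - {a, b}) (\<lambda>_. M)) (PiM K (\<lambda>_. M))
    (\<lambda>\<omega>. (snd \<omega>)(a := fst (fst \<omega>), b := snd (fst \<omega>))) = PiM K (\<lambda>_. M)"
    (is "distr ?D _ ?h = _")
proof (rule product_sigma_finite.PiM_eqI)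
  show "product_sigma_finite (\<lambda>_. M)" by (simp add: product_sigma_finite_def sigma_finite_measure_axioms)
  interpret product_sigma_finite "\<lambda>_. M" by (simp add: product_sigma_finite_def sigma_finite_measure_axioms)
  interpret P: prob_space "PiM (K - {a, b}) (\<lambda>_. M)" by (rule prob_space_PiM_same)
  interpret MM: prob_space "M \<Otimes>\<^sub>M M" by (rule prob_space_square)
  have meas: "?h \<in> measurable ?D (PiM K (\<lambda>_. M))"
  proof (rule measurable_PiM_single')
    fix i assume "i \<in> K"
    then show "(\<lambda>\<omega>. ?h \<omega> i) \<in> measurable ?D M"
      by (cases "i = b"; cases "i = a") (auto simp: case_prod_unfold)
  qed (use assms in \<open>auto simp: space_pair_measure space_PiM PiE_def Pi_def extensional_def\<close>)
  fix A assume A: "\<And>i. i \<in> K \<Longrightarrow> A i \<in> sets M"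
  have "emeasure (distr ?D (PiM K (\<lambda>_. M)) ?h) (Pi\<^sub>E K A) = emeasure ?D (?h -` Pi\<^sub>E K A \<inter> space ?D)"
    using A assms by (intro emeasure_distr meas sets_PiM_I_finite) auto
  also have "?h -` Pi\<^sub>E K A \<inter> space ?D = (A a \<times> A b) \<times> Pi\<^sub>E (K - {a, b}) A"
    using A[THEN sets.sets_into_space] assms
    by (auto simp: space_pair_measure space_PiM PiE_def Pi_def extensional_def split: if_splits)
  also have "emeasure ?D \<dots> = emeasure M (A a) * emeasure M (A b) *
      emeasure (PiM (K - {a, b}) (\<lambda>_. M)) (Pi\<^sub>E (K - {a, b}) A)"
    using A assms by (subst P.emeasure_pair_measure_Times)
      (auto intro!: sets_PiM_I_finite simp: emeasure_pair_measure_Times)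
  also have "emeasure (PiM (K - {a, b}) (\<lambda>_. M)) (Pi\<^sub>E (K - {a, b}) A) = (\<Prod>i\<in>K - {a, b}. emeasure M (A i))"
    using A assms by (intro emeasure_PiM) auto
  also have "emeasure M (A a) * emeasure M (A b) * (\<Prod>i\<in>K - {a, b}. emeasure M (A i)) = (\<Prod>i\<in>K. emeasure M (A i))"
  proof -
    have "(\<Prod>i\<in>insert a (insert b (K - {a, b})). emeasure M (A i)) =
        emeasure M (A a) * emeasure M (A b) * (\<Prod>i\<in>K - {a, b}. emeasure M (A i))"
      using assms by (simp add: mult.assoc)
    moreover have "insert a (insert b (K - {a, b})) = K" using assms by auto
    ultimately show ?thesis by simp
  qed
  finally show "emeasure (distr ?D (PiM K (\<lambda>_. M)) ?h) (Pi\<^sub>E K A) = (\<Prod>i\<in>K. emeasure M (A i))" .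
qed (use assms in auto)

lemma (in prob_space) distr_PiM_two_coordinates:
  assumes "i \<in> K" "j \<in> K" "i \<noteq> j"
  shows "distr (PiM K (\<lambda>_. M)) (M \<Otimes>\<^sub>M M) (\<lambda>u. (u i, u j)) = M \<Otimes>\<^sub>M M"
proof (rule pair_measure_eqI[symmetric])
  show "sigma_finite_measure M" "sigma_finite_measure M" by unfold_locales
  fix A B assume A: "A \<in> sets M" "B \<in> sets M"
  let ?C = "\<lambda>l. if l = i then A else B"
  have "emeasure (distr (PiM K (\<lambda>_. M)) (M \<Otimes>\<^sub>M M) (\<lambda>u. (u i, u j))) (A \<times> B) =
      emeasure (PiM K (\<lambda>_. M)) ((\<lambda>u. (u i, u j)) -` (A \<times> B) \<inter> space (PiM K (\<lambda>_. M)))"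
    using A assms by (intro emeasure_distr) auto
  also have "(\<lambda>u. (u i, u j)) -` (A \<times> B) \<inter> space (PiM K (\<lambda>_. M)) = prod_emb K (\<lambda>_. M) {i, j} (\<Pi>\<^sub>E l\<in>{i, j}. ?C l)"
    using assms by (auto simp: prod_emb_def space_PiM PiE_iff restrict_def extensional_def split: if_splits)
  also have "emeasure (PiM K (\<lambda>_. M)) \<dots> = (\<Prod>l\<in>{i, j}. emeasure M (?C l))"
    using assms A by (intro emeasure_PiM_emb) (auto intro: prob_space_axioms)
  also have "\<dots> = emeasure M A * emeasure M B" using assms by simp
  finally show "emeasure M A * emeasure M B =
      emeasure (distr (PiM K (\<lambda>_. M)) (M \<Otimes>\<^sub>M M) (\<lambda>u. (u i, u j))) (A \<times> B)" by simp
qed simp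

text \<open>A null set of pairs may contain a whole section through a given root, so almost
  everywhere properties of a kernel cannot be inserted at arbitrary fixed roots. They are pulled
  back along each pair of coordinates to the full product, where finitely many null sets are united,
  and then disintegrated over the roots.\<close>

lemma (in prob_space) AE_root_update:
  assumes P: "AE p in M \<Otimes>\<^sub>M M. P p" and ab: "a \<in> {1..k}" "b \<in> {1..k}" "a \<noteq> b"
  shows "AE p in M \<Otimes>\<^sub>M M. AE z in PiM ({1..k} - {a, b}) (\<lambda>_. M).
    \<forall>(i, j)\<in>vertex_pairs k. P ((z(a := fst p, b := snd p)) i, (z(a := fst p, b := snd p)) j)"
proof -
  let ?K = "{1..k}" let ?J = "PiM (?K - {a, b}) (\<lambda>_. M)"
  let ?h = "\<lambda>\<omega>. (snd \<omega>)(a := fst (fst \<omega>), b := snd (fst \<omega>))"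
  interpret Q: prob_space ?J by (rule prob_space_PiM_same)
  interpret MM: prob_space "M \<Otimes>\<^sub>M M" by (rule prob_space_square)
  interpret MJ: pair_sigma_finite "M \<Otimes>\<^sub>M M" ?J
    by (intro pair_sigma_finite.intro Q.sigma_finite_measure_axioms MM.sigma_finite_measure_axioms)
  have "AE u in PiM ?K (\<lambda>_. M). P (u i, u j)" if "(i, j) \<in> vertex_pairs k" for i j
  proof -
    have "AE p in distr (PiM ?K (\<lambda>_. M)) (M \<Otimes>\<^sub>M M) (\<lambda>u. (u i, u j)). P p"
      using P that by (subst distr_PiM_two_coordinates) (auto simp: vertex_pairs_def)
    then show ?thesis by (rule AE_distrD[rotated]) (use that in \<open>auto simp: vertex_pairs_def\<close>)
  qed
  then have "AE u in PiM ?K (\<lambda>_. M). \<forall>(i, j)\<in>vertex_pairs k. P (u i, u j)"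
    by (intro AE_finite_allI) auto
  then have "AE u in distr ((M \<Otimes>\<^sub>M M) \<Otimes>\<^sub>M ?J) (PiM ?K (\<lambda>_. M)) ?h. \<forall>(i, j)\<in>vertex_pairs k. P (u i, u j)"
    using ab by (subst distr_root_update) auto
  then have "AE \<omega> in (M \<Otimes>\<^sub>M M) \<Otimes>\<^sub>M ?J. \<forall>(i, j)\<in>vertex_pairs k. P (?h \<omega> i, ?h \<omega> j)"
  proof (rule AE_distrD[rotated])
    show "?h \<in> measurable ((M \<Otimes>\<^sub>M M) \<Otimes>\<^sub>M ?J) (PiM ?K (\<lambda>_. M))"
    proof (rule measurable_PiM_single')
      fix i assume "i \<in> ?K"
      then show "(\<lambda>\<omega>. ?h \<omega> i) \<in> measurable ((M \<Otimes>\<^sub>M M) \<Otimes>\<^sub>M ?J) M"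
        by (rule root_update_measurable)
    qed (use ab in \<open>auto simp: space_pair_measure space_PiM PiE_def Pi_def extensional_def\<close>)
  qed
  from MJ.AE_pair[OF this] show ?thesis by (simp only: fst_conv snd_conv)
qed

lemma (in prob_space) abs_integral_diff_le:
  fixes f g :: "'a \<Rightarrow> real"
  assumes "integrable M f" "integrable M g" and "AE x in M. \<bar>f x - g x\<bar> \<le> c"
  shows "\<bar>integral\<^sup>L M f - integral\<^sup>L M g\<bar> \<le> c"
proof -
  have "\<bar>integral\<^sup>L M f - integral\<^sup>L M g\<bar> = \<bar>LINT x|M. f x - g x\<bar>" using assms by simp
  also have "\<dots> \<le> (LINT x|M. \<bar>f x - g x\<bar>)" by (rule integral_abs_bound)
  also have "\<dots> \<le> (LINT x|M. c)" using assms by (intro integral_mono_AE) auto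
  finally show ?thesis by (simp add: prob_space)
qed

lemma (in prob_space) graph_weight_integrable:
  assumes W: "W \<in> bounded_measurable M" and "x \<in> space M" "y \<in> space M"
  shows "integrable (PiM ({1..k} - {a, b}) (\<lambda>_. M)) (\<lambda>z. graph_weight k F W (z(a := x, b := y)))"
proof -
  let ?P = "PiM ({1..k} - {a, b}) (\<lambda>_. M)"
  interpret P: prob_space ?P by (rule prob_space_PiM_same)
  obtain B where B: "\<forall>x\<in>space M. \<forall>y\<in>space M. \<bar>W (x, y)\<bar> \<le> B" using W by (auto simp: bounded_measurable_def)
  show ?thesis
  proof (rule P.integrable_const_bound[of _ "(1 + B) ^ card (vertex_pairs k)"])
    show "AE z in ?P. norm (graph_weight k F W (z(a := x, b := y))) \<le> (1 + B) ^ card (vertex_pairs k)"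
    proof (rule AE_I2)
      fix z assume z: "z \<in> space ?P"
      define u where "u = z(a := x, b := y)"
      have u: "u i \<in> space M" if "i \<in> {1..k}" for i
        using that z assms(2,3) by (cases "i = b"; cases "i = a") (auto simp: space_PiM u_def PiE_iff)
      have "\<bar>graph_weight k F W u\<bar> \<le> (1 + B) ^ card (vertex_pairs k)"
      proof (rule abs_graph_weight_le)
        fix i j assume "(i, j) \<in> vertex_pairs k"
        then show "\<bar>W (u i, u j)\<bar> \<le> B" using B u[of i] u[of j] by (simp add: vertex_pairs_def)
      qed
      then show "norm (graph_weight k F W (z(a := x, b := y))) \<le> (1 + B) ^ card (vertex_pairs k)"
        by (simp add: u_def)
    qed
    show "(\<lambda>z. graph_weight k F W (z(a := x, b := y))) \<in> borel_measurable ?P"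
    proof (rule graph_weight_measurable)
      fix i assume "i \<in> {1..k}"
      then show "(\<lambda>z. (z(a := x, b := y)) i) \<in> measurable ?P M"
        using assms by (cases "i = b"; cases "i = a") auto
    qed (use W in \<open>auto simp: bounded_measurable_def\<close>)
  qed
qed

lemma (in prob_space) T_op_lipschitz:
  fixes B c :: real
  assumes UW: "U \<in> bounded_measurable M" "W \<in> bounded_measurable M" and "0 \<le> B"
    and bd: "AE p in M \<Otimes>\<^sub>M M. \<bar>U p\<bar> \<le> B" "AE p in M \<Otimes>\<^sub>M M. \<bar>W p\<bar> \<le> B" "AE p in M \<Otimes>\<^sub>M M. \<bar>U p - W p\<bar> \<le> c"
    and ab: "a \<in> {1..k}" "b \<in> {1..k}" "a \<noteq> b"
  shows "AE p in M \<Otimes>\<^sub>M M. \<bar>T_op M k F a b U p - T_op M k F a b W p\<bar>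
    \<le> card (vertex_pairs k) * (1 + B) ^ card (vertex_pairs k) * c"
proof -
  let ?J = "PiM ({1..k} - {a, b}) (\<lambda>_. M)"
  interpret Q: prob_space ?J by (rule prob_space_PiM_same)
  have "AE p in M \<Otimes>\<^sub>M M. \<bar>U p\<bar> \<le> B \<and> \<bar>W p\<bar> \<le> B \<and> \<bar>U p - W p\<bar> \<le> c"
    using bd by eventually_elim auto
  from AE_root_update[OF this ab] AE_space show ?thesis
  proof eventually_elim
    case (elim p)
    then obtain x y where p: "p = (x, y)" "x \<in> space M" "y \<in> space M" by (auto simp: space_pair_measure)
    from elim(1) have "AE z in ?J. \<bar>graph_weight k F U (z(a := x, b := y)) - graph_weight k F W (z(a := x, b := y))\<bar>
        \<le> card (vertex_pairs k) * (1 + B) ^ card (vertex_pairs k) * c"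
    proof eventually_elim
      case (elim z)
      then show ?case using \<open>0 \<le> B\<close> by (intro abs_graph_weight_diff_le) (fastforce simp: p(1))+
    qed
    then show ?case unfolding p(1) T_op_eq_graph_weight
      by (intro Q.abs_integral_diff_le graph_weight_integrable UW p(2,3))
  qed
qed

text \<open>\<open>L\<close> is uniform in \<open>U\<close>, \<open>W\<close> and \<open>c\<close>.
  The distance is a free bound \<open>c\<close> in place of a norm: \<open>c = 0\<close> shows that
  the velocity respects almost everywhere equality, and the essential norm of a difference yields
  uniqueness of trajectories.\<close>

lemma (in prob_space) velocity_lipschitz:
  assumes "0 \<le> B"
  obtains L where "0 \<le> L" and
    "\<And>U W c. U \<in> bounded_measurable M \<Longrightarrow> W \<in> bounded_measurable M \<Longrightarrow>
      AE p in M \<Otimes>\<^sub>M M. \<bar>U p\<bar> \<le> B \<Longrightarrow> AE p in M \<Otimes>\<^sub>M M. \<bar>W p\<bar> \<le> B \<Longrightarrow>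
      AE p in M \<Otimes>\<^sub>M M. \<bar>U p - W p\<bar> \<le> c \<Longrightarrow>
      AE p in M \<Otimes>\<^sub>M M. \<bar>velocity M k R U p - velocity M k R W p\<bar> \<le> L * c"
proof -
  let ?I = "graphs k \<times> {(a, b). a \<in> {1..k} \<and> b \<in> {1..k} \<and> a \<noteq> b}"
  define co where "co = (\<lambda>(F, (a, b)). (\<Sum>H\<in>graphs k. R F H * of_bool ({a, b} \<in> H)) - of_bool ({a, b} \<in> F) :: real)"
  define C where "C = card (vertex_pairs k) * (1 + B) ^ card (vertex_pairs k)"
  have fin: "finite ?I"
    by (intro finite_cartesian_product finite_graphs finite_subset[of _ "{1..k} \<times> {1..k}"]) auto
  have vel: "velocity M k R W p = (\<Sum>f\<in>?I. co f * T_op M k (fst f) (fst (snd f)) (snd (snd f)) W p)" for W p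
    unfolding velocity_def co_def by (intro sum.cong) auto
  show ?thesis
  proof (rule that[of "\<Sum>f\<in>?I. \<bar>co f\<bar> * C"])
    show "0 \<le> (\<Sum>f\<in>?I. \<bar>co f\<bar> * C)" using assms by (intro sum_nonneg) (auto simp: C_def)
    fix U W c
    assume UW: "U \<in> bounded_measurable M" "W \<in> bounded_measurable M"
      "AE p in M \<Otimes>\<^sub>M M. \<bar>U p\<bar> \<le> B" "AE p in M \<Otimes>\<^sub>M M. \<bar>W p\<bar> \<le> B" "AE p in M \<Otimes>\<^sub>M M. \<bar>U p - W p\<bar> \<le> c"
    have "AE p in M \<Otimes>\<^sub>M M. \<forall>f\<in>?I. \<bar>T_op M k (fst f) (fst (snd f)) (snd (snd f)) U p
        - T_op M k (fst f) (fst (snd f)) (snd (snd f)) W p\<bar> \<le> C * c"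
    proof (rule AE_finite_allI[OF fin])
      fix f assume "f \<in> ?I"
      then show "AE p in M \<Otimes>\<^sub>M M. \<bar>T_op M k (fst f) (fst (snd f)) (snd (snd f)) U p
          - T_op M k (fst f) (fst (snd f)) (snd (snd f)) W p\<bar> \<le> C * c"
        unfolding C_def by (intro T_op_lipschitz[OF UW(1,2) assms UW(3-5)]) auto
    qed
    then show "AE p in M \<Otimes>\<^sub>M M. \<bar>velocity M k R U p - velocity M k R W p\<bar> \<le> (\<Sum>f\<in>?I. \<bar>co f\<bar> * C) * c"
    proof eventually_elim
      case (elim p)
      have "velocity M k R U p - velocity M k R W p = (\<Sum>f\<in>?I. co f *
          (T_op M k (fst f) (fst (snd f)) (snd (snd f)) U p - T_op M k (fst f) (fst (snd f)) (snd (snd f)) W p))"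
        by (simp only: vel right_diff_distrib sum_subtractf)
      also have "\<bar>\<dots>\<bar> \<le> (\<Sum>f\<in>?I. \<bar>co f\<bar> * (C * c))"
      proof (rule order.trans[OF sum_abs], rule sum_mono)
        fix f assume "f \<in> ?I"
        with elim show "\<bar>co f * (T_op M k (fst f) (fst (snd f)) (snd (snd f)) U p
            - T_op M k (fst f) (fst (snd f)) (snd (snd f)) W p)\<bar> \<le> \<bar>co f\<bar> * (C * c)"
          unfolding abs_mult by (intro mult_left_mono) auto
      qed
      also have "\<dots> = (\<Sum>f\<in>?I. \<bar>co f\<bar> * C) * c" by (simp add: sum_distrib_right mult.assoc)
      finally show ?case .
    qed
  qed
qed

lemma (in prob_space) velocity_AE_cong:
  assumes UW: "U \<in> bounded_measurable M" "W \<in> bounded_measurable M" and eq: "AE p in M \<Otimes>\<^sub>M M. U p = W p"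
  shows "AE p in M \<Otimes>\<^sub>M M. velocity M k R U p = velocity M k R W p"
proof -
  obtain B where B: "0 \<le> B" "AE p in M \<Otimes>\<^sub>M M. \<bar>U p\<bar> \<le> B" using bounded_measurable_AE_bound[OF UW(1)] .
  have B': "AE p in M \<Otimes>\<^sub>M M. \<bar>W p\<bar> \<le> B" using B(2) eq by eventually_elim simp
  have 0: "AE p in M \<Otimes>\<^sub>M M. \<bar>U p - W p\<bar> \<le> 0" using eq by eventually_elim simp
  show ?thesis
  proof (rule velocity_lipschitz[OF B(1), of k R])
    fix L
    assume "\<And>U W c. U \<in> bounded_measurable M \<Longrightarrow> W \<in> bounded_measurable M \<Longrightarrow>
      AE p in M \<Otimes>\<^sub>M M. \<bar>U p\<bar> \<le> B \<Longrightarrow> AE p in M \<Otimes>\<^sub>M M. \<bar>W p\<bar> \<le> B \<Longrightarrow>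
      AE p in M \<Otimes>\<^sub>M M. \<bar>U p - W p\<bar> \<le> c \<Longrightarrow>
      AE p in M \<Otimes>\<^sub>M M. \<bar>velocity M k R U p - velocity M k R W p\<bar> \<le> L * c"
    from this[OF UW B(2) B' 0] show ?thesis by eventually_elim simp
  qed
qed

section \<open>Maximal trajectories\<close>

lemma trajectoryD:
  assumes "trajectory M k R W I \<Phi>"
  shows "open I" "is_interval I" "0 \<in> I" "kernel_eq M (\<Phi> 0) W"
    and "t \<in> I \<Longrightarrow> \<Phi> t \<in> kernels M" "t \<in> I \<Longrightarrow> \<Phi> t \<in> bounded_measurable M"
    and "t \<in> I \<Longrightarrow> has_AE_derivative M \<Phi> (velocity M k R (\<Phi> t)) t"
  using assms by (auto simp: trajectory_def intro: kernels_bounded_measurable has_AE_derivative_of_Linf)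

lemma eventually_in_open_at:
  assumes "open I" and "t \<in> I" and "\<And>s. s \<in> I \<Longrightarrow> P s"
  shows "eventually P (at t)"
  using eventually_at_in_open'[OF assms(1,2)] by (rule eventually_mono) (rule assms(3))

lemma (in prob_space) trajectory_ess_norm_bounded:
  assumes tr: "trajectory M k R W I \<Phi>" and S: "compact S" "S \<subseteq> I"
  obtains B where "\<And>s. s \<in> S \<Longrightarrow> ess_norm M (\<Phi> s) \<le> B"
proof -
  note T = trajectoryD[OF tr]
  have "isCont (\<lambda>s. ess_norm M (\<Phi> s)) s" if "s \<in> I" for s
    by (rule isCont_ess_norm[OF T(7)[OF that] eventually_in_open_at[OF T(1) that T(6)] T(6)[OF that]])
  then have "continuous_on S (\<lambda>s. ess_norm M (\<Phi> s))"
    using S(2) by (intro continuous_at_imp_continuous_on) auto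
  then have "bounded ((\<lambda>s. ess_norm M (\<Phi> s)) ` S)"
    using S(1) by (intro compact_imp_bounded compact_continuous_image)
  then obtain B where "\<forall>x\<in>(\<lambda>s. ess_norm M (\<Phi> s)) ` S. norm x \<le> B" by (auto simp: bounded_iff)
  then show ?thesis by (intro that[of B]) auto
qed

text \<open>The velocity is Lipschitz on bounded sets, and both curves stay in one ball over the
  compact interval between 0 and \<open>t\<close>; there the derivative of their difference is
  bounded by a multiple of its norm, and the difference vanishes at time 0.\<close>

lemma (in prob_space) trajectory_unique:
  assumes \<Phi>: "trajectory M k R W I \<Phi>" and \<Psi>: "trajectory M k R W J \<Psi>" and t: "t \<in> I" "t \<in> J"
  shows "kernel_eq M (\<Phi> t) (\<Psi> t)"
proof -
  note P = trajectoryD[OF \<Phi>] and Q = trajectoryD[OF \<Psi>]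
  define \<sigma> :: real where "\<sigma> = (if 0 \<le> t then 1 else - 1)"
  define S where "S = {min 0 t..max 0 t}"
  have \<sigma>: "\<bar>\<sigma>\<bar> = 1" "\<sigma> * \<bar>t\<bar> = t" by (auto simp: \<sigma>_def)
  have sub: "S \<subseteq> I" "S \<subseteq> J"
    using mem_is_interval_1_I[OF P(2), of "min 0 t" "max 0 t"] mem_is_interval_1_I[OF Q(2), of "min 0 t" "max 0 t"] P(3) Q(3) t
    by (auto simp: S_def min_def max_def split: if_splits)
  have \<sigma>S: "\<sigma> * s \<in> S" if "s \<in> {0..\<bar>t\<bar>}" for s
    using that by (auto simp: S_def \<sigma>_def)
  have "compact S" by (simp add: S_def)
  obtain B1 where B1: "\<And>s. s \<in> S \<Longrightarrow> ess_norm M (\<Phi> s) \<le> B1"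
    using trajectory_ess_norm_bounded[OF \<Phi> \<open>compact S\<close> sub(1)] by blast
  obtain B2 where B2: "\<And>s. s \<in> S \<Longrightarrow> ess_norm M (\<Psi> s) \<le> B2"
    using trajectory_ess_norm_bounded[OF \<Psi> \<open>compact S\<close> sub(2)] by blast
  define B where "B = max 0 (max B1 B2)"
  have "0 \<le> B" by (simp add: B_def)
  have bd: "AE p in M \<Otimes>\<^sub>M M. \<bar>\<Phi> s p\<bar> \<le> B" "AE p in M \<Otimes>\<^sub>M M. \<bar>\<Psi> s p\<bar> \<le> B" if "s \<in> S" for s
  proof -
    have "s \<in> I" "s \<in> J" using that sub by auto
    show "AE p in M \<Otimes>\<^sub>M M. \<bar>\<Phi> s p\<bar> \<le> B"
      using AE_le_ess_norm[OF P(6)[OF \<open>s \<in> I\<close>]] by eventually_elim (use B1[OF that] in \<open>simp add: B_def\<close>)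
    show "AE p in M \<Otimes>\<^sub>M M. \<bar>\<Psi> s p\<bar> \<le> B"
      using AE_le_ess_norm[OF Q(6)[OF \<open>s \<in> J\<close>]] by eventually_elim (use B2[OF that] in \<open>simp add: B_def\<close>)
  qed
  let ?X = "\<lambda>s p. \<Phi> s p - \<Psi> s p"
  have "AE p in M \<Otimes>\<^sub>M M. ?X (\<sigma> * \<bar>t\<bar>) p = 0"
  proof (rule velocity_lipschitz[OF \<open>0 \<le> B\<close>, of k R])
    fix L assume L: "0 \<le> L" and lip: "\<And>U W c. U \<in> bounded_measurable M \<Longrightarrow> W \<in> bounded_measurable M \<Longrightarrow>
      AE p in M \<Otimes>\<^sub>M M. \<bar>U p\<bar> \<le> B \<Longrightarrow> AE p in M \<Otimes>\<^sub>M M. \<bar>W p\<bar> \<le> B \<Longrightarrow>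
      AE p in M \<Otimes>\<^sub>M M. \<bar>U p - W p\<bar> \<le> c \<Longrightarrow>
      AE p in M \<Otimes>\<^sub>M M. \<bar>velocity M k R U p - velocity M k R W p\<bar> \<le> L * c"
    have X: "?X s \<in> bounded_measurable M" if "s \<in> I \<inter> J" for s
      using that P(6) Q(6) by (intro bounded_measurable_diff) auto
    show ?thesis
    proof (rule AE_zero_of_derivative_bound[OF \<sigma>(1) abs_ge_zero L, where J="I \<inter> J" and X="?X"
          and D="\<lambda>s p. velocity M k R (\<Phi> s) p - velocity M k R (\<Psi> s) p"])
      show "open (I \<inter> J)" using P(1) Q(1) by auto
      show "\<sigma> * s \<in> I \<inter> J" if "s \<in> {0..\<bar>t\<bar>}" for s using \<sigma>S[OF that] sub by auto
      show "has_AE_derivative M ?X (\<lambda>p. velocity M k R (\<Phi> s) p - velocity M k R (\<Psi> s) p) s" if "s \<in> I \<inter> J" for s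
        using that P(7) Q(7) by (intro has_AE_derivative_diff) auto
      show "AE p in M \<Otimes>\<^sub>M M. \<bar>velocity M k R (\<Phi> (\<sigma> * s)) p - velocity M k R (\<Psi> (\<sigma> * s)) p\<bar> \<le> L * ess_norm M (?X (\<sigma> * s))"
        if "s \<in> {0..\<bar>t\<bar>}" for s
      proof -
        have s: "\<sigma> * s \<in> I" "\<sigma> * s \<in> J" using \<sigma>S[OF that] sub by auto
        show ?thesis
          by (rule lip[OF P(6)[OF s(1)] Q(6)[OF s(2)] bd[OF \<sigma>S[OF that]]], rule AE_le_ess_norm, rule X) (use s in auto)
      qed
      show "AE p in M \<Otimes>\<^sub>M M. ?X 0 p = 0"
        using P(4) Q(4) unfolding kernel_eq_def by eventually_elim simp
    qed (rule X)
  qed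
  then show ?thesis unfolding \<sigma>(2) kernel_eq_def by eventually_elim simp
qed

text \<open>The union of all domains carries a curve whose value is chosen separately at each time.
  The choices may come from different trajectories, but by uniqueness every trajectory agrees with
  the curve almost everywhere at each time, and derivatives survive such changes of
  representatives.\<close>

lemma (in prob_space) maximal_trajectory_exists:
  assumes "\<exists>I \<Phi>. trajectory M k R W I \<Phi>"
  obtains I \<Phi> where "maximal_trajectory M k R W I \<Phi>"
proof -
  define I where "I = \<Union>{J. \<exists>\<Psi>. trajectory M k R W J \<Psi>}"
  have "\<forall>t\<in>I. \<exists>\<Psi>. \<exists>J. trajectory M k R W J \<Psi> \<and> t \<in> J" by (auto simp: I_def)
  then obtain sel where sel: "\<And>t. t \<in> I \<Longrightarrow> \<exists>J. trajectory M k R W J (sel t) \<and> t \<in> J" by metis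
  define \<Phi> where "\<Phi> t = sel t t" for t
  have sub: "J \<subseteq> I" if "trajectory M k R W J \<Psi>" for J \<Psi> using that by (auto simp: I_def)
  have eq: "AE p in M \<Otimes>\<^sub>M M. \<Psi> t p = \<Phi> t p" if tr: "trajectory M k R W J \<Psi>" and t: "t \<in> J" for J \<Psi> t
  proof -
    obtain J' where "trajectory M k R W J' (sel t)" "t \<in> J'" using sel sub[OF tr] t by blast
    then show ?thesis using trajectory_unique[OF tr _ t] by (auto simp: \<Phi>_def kernel_eq_def)
  qed
  have ker: "\<Phi> t \<in> kernels M" if "t \<in> I" for t
    using sel[OF that] trajectoryD(5) by (auto simp: \<Phi>_def)
  have "open I" unfolding I_def by (rule open_Union) (auto dest: trajectoryD)
  moreover have "is_interval I" unfolding is_interval_connected_1 I_def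
    by (rule connected_Union) (auto dest: trajectoryD simp flip: is_interval_connected_1)
  moreover have "0 \<in> I" using assms trajectoryD(3) sub by blast
  moreover have "has_Linf_derivative M \<Phi> (velocity M k R (\<Phi> t)) t" if tI: "t \<in> I" for t
  proof (rule has_Linf_derivativeI)
    obtain J \<Psi> where tr: "trajectory M k R W J \<Psi>" and t: "t \<in> J" using tI by (auto simp: I_def)
    note T = trajectoryD[OF tr]
    show "has_AE_derivative M \<Phi> (velocity M k R (\<Phi> t)) t"
    proof (rule has_AE_derivative_cong[OF T(7)[OF t]])
      show "eventually (\<lambda>s. AE p in M \<Otimes>\<^sub>M M. \<Psi> s p = \<Phi> s p) (at t)"
        by (rule eventually_in_open_at[OF T(1) t]) (rule eq[OF tr])
      show "AE p in M \<Otimes>\<^sub>M M. \<Psi> t p = \<Phi> t p" by (rule eq[OF tr t])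
      then show "AE p in M \<Otimes>\<^sub>M M. velocity M k R (\<Psi> t) p = velocity M k R (\<Phi> t) p"
        by (intro velocity_AE_cong T(6)[OF t] kernels_bounded_measurable ker[OF tI])
    qed
    show "eventually (\<lambda>s. \<Phi> s \<in> borel_measurable (M \<Otimes>\<^sub>M M)) (at t)"
      by (rule eventually_in_open_at[OF \<open>open I\<close> tI]) (use ker in \<open>auto simp: kernels_def\<close>)
    show "\<Phi> t \<in> borel_measurable (M \<Otimes>\<^sub>M M)" using ker[OF tI] by (auto simp: kernels_def)
    then show "velocity M k R (\<Phi> t) \<in> borel_measurable (M \<Otimes>\<^sub>M M)" by (rule velocity_measurable)
  qed
  moreover have "kernel_eq M (\<Phi> 0) W"
  proof -
    obtain J \<Psi> where tr: "trajectory M k R W J \<Psi>" using assms by auto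
    show ?thesis using eq[OF tr trajectoryD(3)[OF tr]] trajectoryD(4)[OF tr]
      unfolding kernel_eq_def by eventually_elim simp
  qed
  ultimately have "trajectory M k R W I \<Phi>" using ker by (simp add: trajectory_def)
  then have "maximal_trajectory M k R W I \<Phi>"
    unfolding maximal_trajectory_def using sub eq by (auto simp: kernel_eq_def)
  then show ?thesis by (rule that)
qed

lemma (in prob_space) traj_is_maximal:
  assumes "\<exists>I \<Phi>. trajectory M k R W I \<Phi>"
  shows "maximal_trajectory M k R W (traj_domain M k R W) (traj M k R W)"
proof -
  obtain I \<Phi> where max: "maximal_trajectory M k R W I \<Phi>" using maximal_trajectory_exists[OF assms] .
  have "traj_domain M k R W = I"
    unfolding traj_domain_def
  proof (rule the_equality)
    show "\<exists>\<Phi>. maximal_trajectory M k R W I \<Phi>" using max by blast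
    show "J = I" if "\<exists>\<Phi>. maximal_trajectory M k R W J \<Phi>" for J
      using that max maximal_trajectory_unique(1) by blast
  qed
  then show ?thesis unfolding traj_def using max by (metis someI)
qed

text \<open>The derivatives at time 0 are compared. Existence of a trajectory for each rule ties
  \<open>traj\<close> and \<open>traj_domain\<close> to the equation; otherwise \<open>SOME\<close>
  and \<open>THE\<close> would return unspecified values.\<close>

lemma (in prob_space) velocity_eq_of_same_trajectories:
  assumes same: "same_trajectories M k R k' R'" and W: "W \<in> kernels M"
    and ex: "\<exists>I \<Phi>. trajectory M k R W I \<Phi>" "\<exists>I \<Phi>. trajectory M k' R' W I \<Phi>"
  shows "AE p in M \<Otimes>\<^sub>M M. velocity M k R W p = velocity M k' R' W p"
proof -
  define I where "I = traj_domain M k R W"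
  define \<Phi> where "\<Phi> = traj M k R W"
  define \<Psi> where "\<Psi> = traj M k' R' W"
  have dom: "traj_domain M k' R' W = I" and eq: "\<And>t. t \<in> I \<Longrightarrow> AE p in M \<Otimes>\<^sub>M M. \<Phi> t p = \<Psi> t p"
    using same W by (auto simp: same_trajectories_def I_def \<Phi>_def \<Psi>_def kernel_eq_def)
  have P: "trajectory M k R W I \<Phi>" and Q: "trajectory M k' R' W I \<Psi>"
    using traj_is_maximal[OF ex(1)] traj_is_maximal[OF ex(2)] dom
    by (auto simp: maximal_trajectory_def I_def \<Phi>_def \<Psi>_def)
  note P = trajectoryD[OF P] and Q = trajectoryD[OF Q]
  have "has_AE_derivative M \<Psi> (velocity M k R (\<Phi> 0)) 0"
    by (rule has_AE_derivative_cong[OF P(7)[OF P(3)] eventually_in_open_at[OF P(1,3) eq] eq[OF P(3)]]) auto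
  then have "AE p in M \<Otimes>\<^sub>M M. velocity M k R (\<Phi> 0) p = velocity M k' R' (\<Psi> 0) p"
    by (rule has_AE_derivative_unique) (rule Q(7)[OF Q(3)])
  moreover have "AE p in M \<Otimes>\<^sub>M M. velocity M k R (\<Phi> 0) p = velocity M k R W p"
    using P(4) unfolding kernel_eq_def by (intro velocity_AE_cong P(6) P(3) kernels_bounded_measurable W)
  moreover have "AE p in M \<Otimes>\<^sub>M M. velocity M k' R' (\<Psi> 0) p = velocity M k' R' W p"
    using Q(4) unfolding kernel_eq_def by (intro velocity_AE_cong Q(6) Q(3) kernels_bounded_measurable W)
  ultimately show ?thesis by eventually_elim simp
qed

text \<open>The derivative condition sees the velocity only on the space, so both rules have
  literally the same predicate \<open>trajectory\<close>; hence \<open>THE\<close> and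
  \<open>SOME\<close> return the same objects for both.\<close>

lemma same_trajectories_of_velocity_eq:
  assumes eq: "\<And>W x y. W \<in> kernels M \<Longrightarrow> x \<in> space M \<Longrightarrow> y \<in> space M \<Longrightarrow>
    velocity M k R W (x, y) = velocity M k' R' W (x, y)"
  shows "same_trajectories M k R k' R'"
proof -
  have "has_Linf_derivative M \<Phi> (velocity M k R (\<Phi> t)) t = has_Linf_derivative M \<Phi> (velocity M k' R' (\<Phi> t)) t"
    if "\<Phi> t \<in> kernels M" for \<Phi> t
  proof -
    have "Linf_norm M (\<lambda>p. (\<Phi> s p - \<Phi> t p) / (s - t) - velocity M k R (\<Phi> t) p)
        = Linf_norm M (\<lambda>p. (\<Phi> s p - \<Phi> t p) / (s - t) - velocity M k' R' (\<Phi> t) p)" for s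
      by (rule Linf_norm_cong_space) (simp add: eq[OF that])
    then show ?thesis by (simp add: has_Linf_derivative_def)
  qed
  then have "trajectory M k R W I \<Phi> = trajectory M k' R' W I \<Phi>" for W I \<Phi>
    unfolding trajectory_def by blast
  then have "maximal_trajectory M k R W I \<Phi> = maximal_trajectory M k' R' W I \<Phi>" for W I \<Phi>
    by (simp add: maximal_trajectory_def)
  then have "traj_domain M k R W = traj_domain M k' R' W \<and> traj M k R W = traj M k' R' W" for W
    by (simp add: traj_domain_def traj_def)
  then show ?thesis by (simp add: same_trajectories_def kernel_eq_def)
qed

section \<open>Step kernels\<close>

definition edge_prob :: "nat \<Rightarrow> (nat set set \<Rightarrow> nat set set \<Rightarrow> real) \<Rightarrow> nat set set \<Rightarrow> nat \<Rightarrow> nat \<Rightarrow> real" where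
  "edge_prob k R F a b = (\<Sum>H\<in>graphs k. R F H * of_bool ({a, b} \<in> H))"

definition rooted_graphs :: "nat \<Rightarrow> (nat set set \<times> nat \<times> nat) set" where
  "rooted_graphs k = graphs k \<times> {(a, b). a \<in> {1..k} \<and> b \<in> {1..k} \<and> a \<noteq> b}"

lemma finite_rooted_graphs [simp]: "finite (rooted_graphs k)"
  unfolding rooted_graphs_def
  by (intro finite_cartesian_product finite_graphs finite_subset[of _ "{1..k} \<times> {1..k}"]) auto

lemma velocity_eq_rooted_sum:
  "velocity M k R W p =
     (\<Sum>(F, (a, b))\<in>rooted_graphs k. (edge_prob k R F a b - of_bool ({a, b} \<in> F)) * T_op M k F a b W p)"
  by (simp add: velocity_def rooted_graphs_def edge_prob_def)

text \<open>The graph weights are replaced by arbitrary weights \<open>g\<close>, in which the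
  expression is linear; differences of velocities are then of the same form.\<close>

definition root_sum ::
  "nat \<Rightarrow> (nat set set \<Rightarrow> nat set set \<Rightarrow> real) \<Rightarrow> (nat \<Rightarrow> real) \<Rightarrow> (nat set set \<Rightarrow> (nat \<Rightarrow> nat) \<Rightarrow> real) \<Rightarrow>
     nat \<times> nat \<Rightarrow> real" where
  "root_sum k R \<alpha> g = (\<lambda>(i, j). \<Sum>(F, (a, b))\<in>rooted_graphs k. (edge_prob k R F a b - of_bool ({a, b} \<in> F)) *
     (\<Sum>\<phi>\<in>({1..k} - {a, b}) \<rightarrow>\<^sub>E {1..k}. (\<Prod>v\<in>{1..k} - {a, b}. \<alpha> (\<phi> v)) * g F (\<phi>(a := i, b := j))))"

definition step_velocity ::
  "nat \<Rightarrow> (nat set set \<Rightarrow> nat set set \<Rightarrow> real) \<Rightarrow> (nat \<Rightarrow> real) \<Rightarrow> (nat \<times> nat \<Rightarrow> real) \<Rightarrow> nat \<times> nat \<Rightarrow> real" where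
  "step_velocity k R \<alpha> w = root_sum k R \<alpha> (\<lambda>F. graph_weight k F w)"

lemma graph_weight_cong:
  assumes "\<And>i. i \<in> {1..k} \<Longrightarrow> u i = v i"
  shows "graph_weight k F W u = graph_weight k F W v"
  unfolding graph_weight_def by (intro prod.cong) (auto simp: vertex_pairs_def assms)

lemma level_set_measurable:
  assumes "c \<in> measurable M (count_space UNIV)"
  shows "{x \<in> space M. c x = i} \<in> sets M"
  using measurable_sets[OF assms, of "{i}"] by (simp add: vimage_def Int_def conj_commute)

text \<open>The integrand depends on \<open>z\<close> only through the labels of its coordinates.
  Decomposed over the label maps \<open>\<phi>\<close>, it is a finite sum of products of
  indicators, which the product measure integrates factor by factor.\<close>

lemma (in prob_space) T_op_step:
  assumes c: "c \<in> measurable M (count_space UNIV)" "\<And>x. x \<in> space M \<Longrightarrow> c x \<in> {1..k}"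
    and xy: "x \<in> space M" "y \<in> space M"
  shows "T_op M k F a b (\<lambda>(x, y). w (c x, c y)) (x, y) =
    (\<Sum>\<phi>\<in>({1..k} - {a, b}) \<rightarrow>\<^sub>E {1..k}. (\<Prod>v\<in>{1..k} - {a, b}. measure M {x \<in> space M. c x = \<phi> v}) *
       graph_weight k F w (\<phi>(a := c x, b := c y)))"
proof -
  let ?J = "{1..k} - {a, b}" let ?K = "{1..k}"
  let ?P = "PiM ?J (\<lambda>_. M)"
  let ?A = "\<lambda>i. {x \<in> space M. c x = i}"
  interpret P: prob_space ?P by (rule prob_space_PiM_same)
  interpret product_sigma_finite "\<lambda>_. M" by (simp add: product_sigma_finite_def sigma_finite_measure_axioms)
  have A: "?A i \<in> sets M" for i using c(1) by (rule level_set_measurable)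
  have eq: "graph_weight k F (\<lambda>(x, y). w (c x, c y)) (z(a := x, b := y)) =
      (\<Sum>\<phi>\<in>?J \<rightarrow>\<^sub>E ?K. (\<Prod>v\<in>?J. indicator (?A (\<phi> v)) (z v)) * graph_weight k F w (\<phi>(a := c x, b := c y)))"
    if z: "z \<in> space ?P" for z
  proof -
    \<comment> \<open>\<open>\<psi>\<close> is the label map of \<open>z\<close>, the only
      \<open>\<phi>\<close> whose product of indicators does not vanish at \<open>z\<close>.\<close>
    define \<psi> where "\<psi> = (\<lambda>v\<in>?J. c (z v))"
    have zM: "z v \<in> space M" if "v \<in> ?J" for v using z that unfolding space_PiM by (rule PiE_mem)
    have \<psi>: "\<psi> \<in> ?J \<rightarrow>\<^sub>E ?K" using c(2) zM by (auto simp: \<psi>_def)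
    have ind: "(\<Prod>v\<in>?J. indicator (?A (\<phi> v)) (z v)) = (if \<phi> = \<psi> then 1 else 0 :: real)" if phi: "\<phi> \<in> ?J \<rightarrow>\<^sub>E ?K" for \<phi>
    proof (cases "\<phi> = \<psi>")
      case True
      then show ?thesis using zM by (auto intro!: prod.neutral simp: \<psi>_def)
    next
      case False
      then obtain v where "v \<in> ?J" "\<phi> v \<noteq> \<psi> v" using PiE_ext[OF phi \<psi>] by blast
      then have "\<exists>v\<in>?J. indicator (?A (\<phi> v)) (z v) = (0::real)" by (intro bexI[of _ v]) (auto simp: \<psi>_def)
      with False show ?thesis by (simp add: prod_zero)
    qed
    have "(\<Sum>\<phi>\<in>?J \<rightarrow>\<^sub>E ?K. (\<Prod>v\<in>?J. indicator (?A (\<phi> v)) (z v)) * graph_weight k F w (\<phi>(a := c x, b := c y)))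
        = (\<Sum>\<phi>\<in>?J \<rightarrow>\<^sub>E ?K. if \<phi> = \<psi> then graph_weight k F w (\<phi>(a := c x, b := c y)) else 0)"
      by (intro sum.cong refl) (simp only: ind if_distrib[of "\<lambda>t. t * _"] mult_1 mult_zero_left)
    also have "\<dots> = graph_weight k F w (\<psi>(a := c x, b := c y))"
      using \<psi> by (simp add: finite_PiE)
    also have "\<dots> = graph_weight k F w (\<lambda>i. c ((z(a := x, b := y)) i))"
      by (rule graph_weight_cong) (auto simp: \<psi>_def)
    also have "\<dots> = graph_weight k F (\<lambda>(x, y). w (c x, c y)) (z(a := x, b := y))"
      unfolding graph_weight_def by (intro prod.cong refl) (auto simp only: prod.case split: prod.splits)
    finally show ?thesis by simp
  qed
  have int: "integrable ?P (\<lambda>z. \<Prod>v\<in>?J. indicator (?A (\<phi> v)) (z v) :: real)" for \<phi>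
    using A by (intro product_integrable_prod) (auto intro: integrable_real_indicator simp: emeasure_eq_measure)
  have "T_op M k F a b (\<lambda>(x, y). w (c x, c y)) (x, y) =
      (LINT z|?P. (\<Sum>\<phi>\<in>?J \<rightarrow>\<^sub>E ?K. (\<Prod>v\<in>?J. indicator (?A (\<phi> v)) (z v)) * graph_weight k F w (\<phi>(a := c x, b := c y))))"
    unfolding T_op_eq_graph_weight by (rule Bochner_Integration.integral_cong) (simp_all add: eq)
  also have "\<dots> = (\<Sum>\<phi>\<in>?J \<rightarrow>\<^sub>E ?K. (LINT z|?P. (\<Prod>v\<in>?J. indicator (?A (\<phi> v)) (z v))) * graph_weight k F w (\<phi>(a := c x, b := c y)))"
    using int by (subst Bochner_Integration.integral_sum) auto
  also have "\<dots> = (\<Sum>\<phi>\<in>?J \<rightarrow>\<^sub>E ?K. (\<Prod>v\<in>?J. measure M (?A (\<phi> v))) * graph_weight k F w (\<phi>(a := c x, b := c y)))"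
    using A by (subst product_integral_prod) (auto intro: integrable_real_indicator simp: emeasure_eq_measure)
  finally show ?thesis .
qed

lemma (in prob_space) velocity_step:
  assumes c: "c \<in> measurable M (count_space UNIV)" "\<And>x. x \<in> space M \<Longrightarrow> c x \<in> {1..k}"
    and xy: "x \<in> space M" "y \<in> space M"
  shows "velocity M k R (\<lambda>(x, y). w (c x, c y)) (x, y) =
    step_velocity k R (\<lambda>i. measure M {x \<in> space M. c x = i}) w (c x, c y)"
  unfolding velocity_eq_rooted_sum step_velocity_def root_sum_def prod.case
  by (rule sum.cong[OF refl]) (auto simp only: T_op_step[OF assms, where w=w] split: prod.splits)

lemma edge_prob_commute: "edge_prob k R F a b = edge_prob k R F b a"
  by (simp add: edge_prob_def insert_commute)

text \<open>Interchanging the roots is a bijection of \<open>rooted_graphs\<close> that preserves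
  the coefficients. Thus the velocity of a step kernel has a symmetric matrix.\<close>

lemma root_sum_commute: "root_sum k R \<alpha> g (i, j) = root_sum k R \<alpha> g (j, i)"
proof -
  let ?t = "\<lambda>i j (F, (a, b)). (edge_prob k R F a b - of_bool ({a, b} \<in> F)) *
     (\<Sum>\<phi>\<in>({1..k} - {a, b}) \<rightarrow>\<^sub>E {1..k}. (\<Prod>v\<in>{1..k} - {a, b}. \<alpha> (\<phi> v)) * g F (\<phi>(a := i, b := j)))"
  have "(\<Sum>f\<in>rooted_graphs k. ?t i j f) = (\<Sum>f\<in>rooted_graphs k. ?t j i f)"
  proof (rule sum.reindex_bij_witness[where i="\<lambda>(F, (a, b)). (F, (b, a))" and j="\<lambda>(F, (a, b)). (F, (b, a))"])
    fix f assume "f \<in> rooted_graphs k"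
    then obtain F a b where f: "f = (F, (a, b))" "a \<noteq> b" by (auto simp: rooted_graphs_def)
    have "{1..k} - {b, a} = {1..k} - {a, b}" by auto
    then show "?t j i (case f of (F, (a, b)) \<Rightarrow> (F, (b, a))) = ?t i j f"
      using f by (simp add: edge_prob_commute[of k R F b a] insert_commute fun_upd_twist)
  qed (auto simp: rooted_graphs_def)
  then show ?thesis by (simp add: root_sum_def)
qed

lemma root_sum_cong:
  assumes "\<And>i. i \<in> {1..k} \<Longrightarrow> \<alpha> i = \<beta> i"
  shows "root_sum k R \<alpha> g p = root_sum k R \<beta> g p"
proof -
  have eq: "(\<Prod>v\<in>{1..k} - {a, b}. \<alpha> (\<phi> v)) = (\<Prod>v\<in>{1..k} - {a, b}. \<beta> (\<phi> v))"
    if "\<phi> \<in> ({1..k} - {a, b}) \<rightarrow>\<^sub>E {1..k}" for \<phi> a b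
    by (rule prod.cong[OF refl], rule assms, rule PiE_mem[OF that])
  have eq': "(\<Sum>\<phi>\<in>({1..k} - {a, b}) \<rightarrow>\<^sub>E {1..k}. (\<Prod>v\<in>{1..k} - {a, b}. \<alpha> (\<phi> v)) * h \<phi>) =
      (\<Sum>\<phi>\<in>({1..k} - {a, b}) \<rightarrow>\<^sub>E {1..k}. (\<Prod>v\<in>{1..k} - {a, b}. \<beta> (\<phi> v)) * h \<phi>)" for h :: "_ \<Rightarrow> real" and a b
  proof (rule sum.cong[OF refl])
    fix \<phi> assume "\<phi> \<in> ({1..k} - {a, b}) \<rightarrow>\<^sub>E {1..k}"
    then show "(\<Prod>v\<in>{1..k} - {a, b}. \<alpha> (\<phi> v)) * h \<phi> = (\<Prod>v\<in>{1..k} - {a, b}. \<beta> (\<phi> v)) * h \<phi>"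
      by (simp only: eq)
  qed
  obtain i j where p: "p = (i, j)" by (cases p)
  show ?thesis unfolding root_sum_def p prod.case
  proof (rule sum.cong[OF refl])
    fix f :: "nat set set \<times> nat \<times> nat"
    obtain F a b where f: "f = (F, (a, b))" by (cases f)
    show "(case f of (F, a, b) \<Rightarrow> (edge_prob k R F a b - of_bool ({a, b} \<in> F)) *
        (\<Sum>\<phi>\<in>({1..k} - {a, b}) \<rightarrow>\<^sub>E {1..k}. (\<Prod>v\<in>{1..k} - {a, b}. \<alpha> (\<phi> v)) * g F (\<phi>(a := i, b := j)))) =
      (case f of (F, a, b) \<Rightarrow> (edge_prob k R F a b - of_bool ({a, b} \<in> F)) *
        (\<Sum>\<phi>\<in>({1..k} - {a, b}) \<rightarrow>\<^sub>E {1..k}. (\<Prod>v\<in>{1..k} - {a, b}. \<beta> (\<phi> v)) * g F (\<phi>(a := i, b := j))))"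
      by (simp only: f prod.case eq'[of a b "\<lambda>\<phi>. g F (\<phi>(a := i, b := j))"])
  qed
qed

text \<open>One constant for all weights: applied to a graph weight it bounds the step velocity,
  applied to a difference of graph weights it gives a Lipschitz estimate.\<close>

lemma root_sum_bound:
  obtains A where "0 \<le> A"
    and "\<And>g d p. (\<And>F u. \<bar>g F u\<bar> \<le> d) \<Longrightarrow> \<bar>root_sum k R \<alpha> g p\<bar> \<le> A * d"
proof -
  let ?co = "\<lambda>F a b. \<bar>edge_prob k R F a b - of_bool ({a, b} \<in> F)\<bar>"
  let ?s = "\<lambda>a b. \<Sum>\<phi>\<in>({1..k} - {a, b}) \<rightarrow>\<^sub>E {1..k}. \<bar>\<Prod>v\<in>{1..k} - {a, b}. \<alpha> (\<phi> v)\<bar>"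
  define A where "A = (\<Sum>(F, (a, b))\<in>rooted_graphs k. ?co F a b * ?s a b)"
  show ?thesis
  proof (rule that[of A])
    show "0 \<le> A" unfolding A_def by (intro sum_nonneg) (auto intro!: mult_nonneg_nonneg sum_nonneg)
    fix g :: "nat set set \<Rightarrow> (nat \<Rightarrow> nat) \<Rightarrow> real" and d :: real and p :: "nat \<times> nat"
    assume g: "\<And>F u. \<bar>g F u\<bar> \<le> d"
    obtain i j where p: "p = (i, j)" by (cases p)
    have 1: "\<bar>\<Sum>\<phi>\<in>({1..k} - {a, b}) \<rightarrow>\<^sub>E {1..k}. (\<Prod>v\<in>{1..k} - {a, b}. \<alpha> (\<phi> v)) * g F (\<phi>(a := i, b := j))\<bar> \<le> ?s a b * d"
      for F a b
      unfolding sum_distrib_right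
      by (rule order.trans[OF sum_abs], rule sum_mono, unfold abs_mult, rule mult_left_mono[OF g]) simp
    have "\<bar>root_sum k R \<alpha> g p\<bar> \<le> (\<Sum>(F, (a, b))\<in>rooted_graphs k. ?co F a b * (?s a b * d))"
      unfolding root_sum_def p prod.case
    proof (rule order.trans[OF sum_abs], rule sum_mono)
      fix f assume "f \<in> rooted_graphs k"
      obtain F a b where f: "f = (F, (a, b))" by (cases f) auto
      show "\<bar>case f of (F, a, b) \<Rightarrow> (edge_prob k R F a b - of_bool ({a, b} \<in> F)) *
           (\<Sum>\<phi>\<in>({1..k} - {a, b}) \<rightarrow>\<^sub>E {1..k}. (\<Prod>v\<in>{1..k} - {a, b}. \<alpha> (\<phi> v)) * g F (\<phi>(a := i, b := j)))\<bar>
        \<le> (case f of (F, a, b) \<Rightarrow> ?co F a b * (?s a b * d))"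
        unfolding f prod.case abs_mult by (rule mult_left_mono[OF 1]) simp
    qed
    also have "\<dots> = A * d" unfolding A_def by (subst sum_distrib_right) (rule sum.cong[OF refl], auto)
    finally show "\<bar>root_sum k R \<alpha> g p\<bar> \<le> A * d" .
  qed
qed

lemma root_sum_diff:
  "root_sum k R \<alpha> g p - root_sum k R \<alpha> h p = root_sum k R \<alpha> (\<lambda>F u. g F u - h F u) p"
proof -
  obtain i j where p: "p = (i, j)" by (cases p)
  show ?thesis unfolding p root_sum_def prod.case
    by (simp add: sum_subtractf right_diff_distrib case_prod_unfold)
qed

lemma step_velocity_bounded:
  "\<exists>C. \<forall>w p. (\<forall>q. \<bar>w q\<bar> \<le> B) \<longrightarrow> \<bar>step_velocity k R \<alpha> w p\<bar> \<le> C"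
proof (rule root_sum_bound[of k R \<alpha>])
  fix A assume A: "\<And>g d p. (\<And>F u. \<bar>g F u\<bar> \<le> d) \<Longrightarrow> \<bar>root_sum k R \<alpha> g p\<bar> \<le> A * d"
  have "\<bar>step_velocity k R \<alpha> w p\<bar> \<le> A * (1 + B) ^ card (vertex_pairs k)" if "\<forall>q. \<bar>w q\<bar> \<le> B" for w p
    unfolding step_velocity_def using that by (intro A abs_graph_weight_le) blast
  then show ?thesis by blast
qed

lemma step_velocity_lipschitz:
  assumes "0 \<le> (B::real)"
  shows "\<exists>L\<ge>0. \<forall>w w' d p. (\<forall>q. \<bar>w q\<bar> \<le> B) \<longrightarrow> (\<forall>q. \<bar>w' q\<bar> \<le> B) \<longrightarrow> (\<forall>q. \<bar>w q - w' q\<bar> \<le> d) \<longrightarrow>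
    \<bar>step_velocity k R \<alpha> w p - step_velocity k R \<alpha> w' p\<bar> \<le> L * d"
proof (rule root_sum_bound[of k R \<alpha>])
  let ?N = "card (vertex_pairs k)"
  fix A assume A0: "0 \<le> A"
    and A: "\<And>g d p. (\<And>F u. \<bar>g F u\<bar> \<le> d) \<Longrightarrow> \<bar>root_sum k R \<alpha> g p\<bar> \<le> A * d"
  have "\<bar>step_velocity k R \<alpha> w p - step_velocity k R \<alpha> w' p\<bar> \<le> A * (?N * (1 + B) ^ ?N) * d"
    if w: "\<forall>q. \<bar>w q\<bar> \<le> B" "\<forall>q. \<bar>w' q\<bar> \<le> B" "\<forall>q. \<bar>w q - w' q\<bar> \<le> d" for w w' d p
  proof -
    have "\<bar>step_velocity k R \<alpha> w p - step_velocity k R \<alpha> w' p\<bar> \<le> A * (?N * (1 + B) ^ ?N * d)"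
      unfolding step_velocity_def root_sum_diff
      by (rule A, rule abs_graph_weight_diff_le[OF assms]) (use w in blast)+
    then show ?thesis by (simp add: mult.assoc)
  qed
  moreover have "0 \<le> A * (?N * (1 + B) ^ ?N)" using A0 assms by simp
  ultimately show ?thesis by blast
qed

section \<open>The flow on step kernels\<close>

lemma step_function_measurable:
  fixes g :: "nat \<times> nat \<Rightarrow> real"
  assumes "c \<in> measurable M (count_space UNIV)"
  shows "(\<lambda>(x, y). g (c x, c y)) \<in> borel_measurable (M \<Otimes>\<^sub>M M)"
proof -
  have 1: "(\<lambda>p. c (fst p)) \<in> measurable (M \<Otimes>\<^sub>M M) (count_space UNIV)"
    and 2: "(\<lambda>p. c (snd p)) \<in> measurable (M \<Otimes>\<^sub>M M) (count_space UNIV)"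
    using assms by measurable
  have "(\<lambda>p. g (c (fst p), c (snd p))) \<in> borel_measurable (M \<Otimes>\<^sub>M M)"
    by (rule measurable_compose_countable[where f="\<lambda>i p. g (i, c (snd p))", OF _ 1],
        rule measurable_compose_countable[where f="\<lambda>j p. g (i, j)" for i, OF _ 2]) simp
  then show ?thesis by (simp add: case_prod_unfold)
qed

text \<open>On a discrete index type every bounded function is continuous, so bounded continuous
  functions there are exactly the bounded matrices, which form a Banach space.\<close>

instance discrete :: (type) discrete_topology
  by standard (rule open_discrete)

text \<open>A symmetric matrix is stored as a bounded function of the pair (smaller index, larger index),
  so that symmetry need not be propagated along the flow.\<close>

definition symmetric_matrix :: "((nat \<times> nat) discrete \<Rightarrow>\<^sub>C real) \<Rightarrow> nat \<times> nat \<Rightarrow> real" where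
  "symmetric_matrix w = (\<lambda>(i, j). w (discrete (min i j, max i j)))"

lemma symmetric_matrix_commute: "symmetric_matrix w (i, j) = symmetric_matrix w (j, i)"
  by (simp add: symmetric_matrix_def min.commute max.commute)

lemma abs_symmetric_matrix_le: "\<bar>symmetric_matrix w q\<bar> \<le> norm w"
  using norm_bounded[of w] by (cases q) (simp add: symmetric_matrix_def)

lemma bounded_function_bcontfun:
  fixes f :: "'b::discrete_topology \<Rightarrow> real"
  assumes "\<And>n. \<bar>f n\<bar> \<le> C"
  shows "f \<in> bcontfun"
  using assms by (intro bcontfun_normI) auto

instance bcontfun :: (metric_space, banach) banach ..

text \<open>Step kernels over the fixed labelling \<open>c\<close> are invariant: the velocity at
  such a kernel has the matrix \<open>step_velocity\<close>. The equation is solved among bounded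
  matrices, and a bound on matrices holds at every point of the space, hence in essential supremum
  norm.\<close>

lemma (in prob_space) step_trajectory_exists:
  assumes c: "c \<in> measurable M (count_space UNIV)" "\<And>x. x \<in> space M \<Longrightarrow> c x \<in> {1..k}"
    and w: "\<And>i j. w (i, j) = w (j, i)" "\<And>q. \<bar>w q\<bar> \<le> B"
  shows "\<exists>I \<Phi>. trajectory M k R (\<lambda>(x, y). w (c x, c y)) I \<Phi>"
proof -
  define \<alpha> where "\<alpha> i = measure M {x \<in> space M. c x = i}" for i
  define f where "f w = Bcontfun (\<lambda>n. step_velocity k R \<alpha> (symmetric_matrix w) (of_discrete n))" for w
  define w0 where "w0 = Bcontfun (\<lambda>n. w (of_discrete n))"
  have w0: "symmetric_matrix w0 (i, j) = w (i, j)" for i j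
    using w(1)[of i j] bounded_function_bcontfun[of "\<lambda>n. w (of_discrete n)" B] w(2)
    by (auto simp: symmetric_matrix_def w0_def Bcontfun_inverse discrete_inverse min_def max_def)
  have f: "f w n = step_velocity k R \<alpha> (symmetric_matrix w) (of_discrete n)" for w n
  proof -
    obtain C where "\<forall>v p. (\<forall>q. \<bar>v q\<bar> \<le> norm w) \<longrightarrow> \<bar>step_velocity k R \<alpha> v p\<bar> \<le> C"
      using step_velocity_bounded by blast
    then have "\<bar>step_velocity k R \<alpha> (symmetric_matrix w) p\<bar> \<le> C" for p
      using abs_symmetric_matrix_le by blast
    then have "(\<lambda>n. step_velocity k R \<alpha> (symmetric_matrix w) (of_discrete n)) \<in> bcontfun"
      by (rule bounded_function_bcontfun)
    then show ?thesis by (simp add: f_def Bcontfun_inverse)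
  qed
  \<comment> \<open>All matrices in the unit ball around \<open>w0\<close> have entries bounded by
    \<open>norm w0 + 1\<close>, where one Lipschitz constant serves.\<close>
  have "0 \<le> norm w0 + 1" by simp
  from step_velocity_lipschitz[OF this, of k R \<alpha>]
  obtain L where L: "0 \<le> L" and lip: "\<forall>v v' d p. (\<forall>q. \<bar>v q\<bar> \<le> norm w0 + 1) \<longrightarrow> (\<forall>q. \<bar>v' q\<bar> \<le> norm w0 + 1) \<longrightarrow>
      (\<forall>q. \<bar>v q - v' q\<bar> \<le> d) \<longrightarrow> \<bar>step_velocity k R \<alpha> v p - step_velocity k R \<alpha> v' p\<bar> \<le> L * d"
    by blast
  have lipf: "norm (f u - f v) \<le> L * norm (u - v)" if "u \<in> cball w0 1" "v \<in> cball w0 1" for u v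
  proof (rule norm_bound)
    have b: "\<bar>symmetric_matrix u q\<bar> \<le> norm w0 + 1" if "u \<in> cball w0 1" for u q
      using abs_symmetric_matrix_le[of u q] that norm_triangle_sub[of u w0] by (simp add: dist_norm norm_minus_commute)
    have "\<bar>symmetric_matrix u q - symmetric_matrix v q\<bar> \<le> norm (u - v)" for q
      using abs_symmetric_matrix_le[of "u - v" q] by (simp add: symmetric_matrix_def case_prod_unfold)
    then have "\<bar>step_velocity k R \<alpha> (symmetric_matrix u) p - step_velocity k R \<alpha> (symmetric_matrix v) p\<bar> \<le> L * norm (u - v)" for p
      using lip b[OF that(1)] b[OF that(2)] by blast
    then show "norm ((f u - f v) n) \<le> L * norm (u - v)" for n
      by (simp add: f)
  qed
  have "\<exists>\<delta> u. 0 < \<delta> \<and> u 0 = w0 \<and> (\<forall>t\<in>{- \<delta><..<\<delta>}. (u has_vector_derivative f (u t)) (at t))"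
  proof (rule picard_local[where r=1 and L=L and ?x0.0=w0 and f=f])
    show "0 \<le> L" by (rule L)
    show "norm (f u - f v) \<le> L * norm (u - v)" if "u \<in> cball w0 1" "v \<in> cball w0 1" for u v
      using that by (rule lipf)
    show "\<exists>\<delta> u. 0 < \<delta> \<and> u 0 = w0 \<and> (\<forall>t\<in>{- \<delta><..<\<delta>}. (u has_vector_derivative f (u t)) (at t))"
      if "0 < \<delta>" "u 0 = w0" "\<And>t. t \<in> {- \<delta><..<\<delta>} \<Longrightarrow> (u has_vector_derivative f (u t)) (at t)" for \<delta> u
      using that by blast
  qed simp
  then obtain \<delta> u where \<delta>: "0 < \<delta>" and u0: "u 0 = w0"
    and u: "\<And>t. t \<in> {- \<delta><..<\<delta>} \<Longrightarrow> (u has_vector_derivative f (u t)) (at t)" by blast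
  define \<Phi> where "\<Phi> t = (\<lambda>(x, y). symmetric_matrix (u t) (c x, c y))" for t
  have ker: "\<Phi> t \<in> kernels M" for t
    using step_function_measurable[OF c(1), of "symmetric_matrix (u t)"] abs_symmetric_matrix_le[of "u t"]
    by (auto simp: kernels_def \<Phi>_def intro: symmetric_matrix_commute intro!: exI[of _ "norm (u t)"])
  have vel: "velocity M k R (\<Phi> t) (x, y) = symmetric_matrix (f (u t)) (c x, c y)"
    if "x \<in> space M" "y \<in> space M" for t x y
  proof -
    have "velocity M k R (\<Phi> t) (x, y) = step_velocity k R \<alpha> (symmetric_matrix (u t)) (c x, c y)"
      using velocity_step[OF c that, of R "symmetric_matrix (u t)"] unfolding \<Phi>_def \<alpha>_def .
    \<comment> \<open>The right side reads the velocity matrix at the ordered pair of labels;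
      symmetry of \<open>root_sum\<close> in its two indices makes this the value at
      \<open>(c x, c y)\<close>.\<close>
    also have "\<dots> = symmetric_matrix (f (u t)) (c x, c y)"
      by (auto simp: symmetric_matrix_def[of "f (u t)"] f discrete_inverse min_def max_def step_velocity_def intro: root_sum_commute)
    finally show ?thesis .
  qed
  have "trajectory M k R (\<lambda>(x, y). w (c x, c y)) {- \<delta><..<\<delta>} \<Phi>"
    unfolding trajectory_def
  proof (intro conjI ballI ker)
    show "kernel_eq M (\<Phi> 0) (\<lambda>(x, y). w (c x, c y))" by (simp add: kernel_eq_def \<Phi>_def u0 w0)
    show "is_interval {- \<delta><..<\<delta>}" by (simp add: is_interval_oo)
    fix t assume t: "t \<in> {- \<delta><..<\<delta>}"
    have m: "\<Phi> s \<in> borel_measurable (M \<Otimes>\<^sub>M M)" for s using ker[of s] by (simp add: kernels_def)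
    show "has_Linf_derivative M \<Phi> (velocity M k R (\<Phi> t)) t"
    proof (rule has_Linf_derivativeI)
      show "has_AE_derivative M \<Phi> (velocity M k R (\<Phi> t)) t" unfolding has_AE_derivative_def
      proof (intro allI impI)
        fix e :: real assume "0 < e"
        then have "eventually (\<lambda>s. norm (u s - u t - (s - t) *\<^sub>R f (u t)) \<le> e * norm (s - t)) (at t)"
          using u[OF t] unfolding has_vector_derivative_def has_derivative_within_alt2 by blast
        then show "eventually (\<lambda>s. AE p in M \<Otimes>\<^sub>M M. \<bar>\<Phi> s p - \<Phi> t p - (s - t) * velocity M k R (\<Phi> t) p\<bar> \<le> e * \<bar>s - t\<bar>) (at t)"
        proof eventually_elim
          case (elim s)
          show ?case
          proof (rule AE_I2)
            fix p assume "p \<in> space (M \<Otimes>\<^sub>M M)"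
            then obtain x y where p: "p = (x, y)" "x \<in> space M" "y \<in> space M" by (auto simp: space_pair_measure)
            have "\<bar>symmetric_matrix (u s - u t - (s - t) *\<^sub>R f (u t)) (c x, c y)\<bar> \<le> e * \<bar>s - t\<bar>"
              using order.trans[OF abs_symmetric_matrix_le elim] by simp
            then show "\<bar>\<Phi> s p - \<Phi> t p - (s - t) * velocity M k R (\<Phi> t) p\<bar> \<le> e * \<bar>s - t\<bar>"
              using vel[OF p(2,3), of t] by (simp add: p(1) \<Phi>_def symmetric_matrix_def)
          qed
        qed
      qed
    qed (use m velocity_measurable[OF m] in auto)
  qed (use \<delta> in auto)
  then show ?thesis by blast
qed

text \<open>The velocities agree almost everywhere, and the block of labels \<open>i\<close> and
  \<open>j\<close> has the positive measure \<open>\<alpha> i * \<alpha> j\<close>; so it contains a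
  point of agreement, and the velocity of a step kernel is constant on blocks.\<close>

lemma (in prob_space) step_velocity_eq_of_same_trajectories:
  assumes "atomless M" and same: "same_trajectories M k R k R'"
    and \<alpha>: "\<And>i. i \<in> {1..k} \<Longrightarrow> 0 < \<alpha> i" "sum \<alpha> {1..k} = 1"
    and w: "\<And>i j. w (i, j) = w (j, i)" "\<And>q. \<bar>w q\<bar> \<le> B"
    and ij: "i \<in> {1..k}" "j \<in> {1..k}"
  shows "step_velocity k R \<alpha> w (i, j) = step_velocity k R' \<alpha> w (i, j)"
proof -
  have "\<exists>c\<in>measurable M (count_space UNIV). (\<forall>x\<in>space M. c x \<in> {1..k}) \<and>
      (\<forall>i\<in>{1..k}. measure M {x \<in> space M. c x = i} = \<alpha> i)"
    using \<alpha> ij by (intro atomless_partition[OF \<open>atomless M\<close>]) (auto intro: less_imp_le simp: prob_space)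
  then obtain c where c: "c \<in> measurable M (count_space UNIV)" "\<And>x. x \<in> space M \<Longrightarrow> c x \<in> {1..k}"
    and meas: "\<And>i. i \<in> {1..k} \<Longrightarrow> measure M {x \<in> space M. c x = i} = \<alpha> i" by blast
  let ?W = "\<lambda>(x, y). w (c x, c y)"
  have "?W \<in> kernels M"
    using step_function_measurable[OF c(1), of w] w unfolding kernels_def by (auto intro!: exI[of _ B])
  then have AE: "AE p in M \<Otimes>\<^sub>M M. velocity M k R ?W p = velocity M k R' ?W p"
    by (intro velocity_eq_of_same_trajectories[OF same] step_trajectory_exists[where B=B] c w)
  let ?A = "\<lambda>i. {x \<in> space M. c x = i}"
  have A: "?A i \<in> sets M" for i using c(1) by (rule level_set_measurable)
  have "emeasure (M \<Otimes>\<^sub>M M) (?A i \<times> ?A j) = emeasure M (?A i) * emeasure M (?A j)"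
    by (rule emeasure_pair_measure_Times[OF A A])
  also have "\<dots> \<noteq> 0" using meas[OF ij(1)] meas[OF ij(2)] \<alpha>(1)[OF ij(1)] \<alpha>(1)[OF ij(2)]
    by (simp add: emeasure_eq_measure ennreal_eq_0_iff)
  finally have pos: "emeasure (M \<Otimes>\<^sub>M M) (?A i \<times> ?A j) \<noteq> 0" .
  have "\<exists>p\<in>?A i \<times> ?A j. velocity M k R ?W p = velocity M k R' ?W p"
  proof (rule ccontr)
    assume "\<not> ?thesis"
    then have "AE p in M \<Otimes>\<^sub>M M. p \<notin> ?A i \<times> ?A j" using AE by (auto elim: eventually_mono)
    then have "?A i \<times> ?A j \<in> null_sets (M \<Otimes>\<^sub>M M)" using A by (subst AE_iff_null_sets) auto
    with pos show False by auto
  qed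
  then obtain x y where xy: "x \<in> space M" "y \<in> space M" "c x = i" "c y = j"
    and eq: "velocity M k R ?W (x, y) = velocity M k R' ?W (x, y)" by auto
  have "velocity M k Q ?W (x, y) = step_velocity k Q (\<lambda>i. measure M (?A i)) w (i, j)" for Q
    using velocity_step[OF c xy(1,2), of Q w] xy(3,4) by simp
  with eq have *: "step_velocity k R (\<lambda>i. measure M (?A i)) w (i, j) = step_velocity k R' (\<lambda>i. measure M (?A i)) w (i, j)"
    by simp
  have "step_velocity k Q (\<lambda>i. measure M (?A i)) w (i, j) = step_velocity k Q \<alpha> w (i, j)" for Q
    unfolding step_velocity_def by (rule root_sum_cong) (rule meas)
  with * show ?thesis by simp
qed

section \<open>Orbit sums determine the velocity\<close>

lemma mem_graphs_iff:
  "F \<in> graphs k \<longleftrightarrow> (\<forall>e\<in>F. \<exists>(i, j)\<in>vertex_pairs k. e = {i, j})"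
proof -
  have "{{i, j} | i j. i \<in> {1..k} \<and> j \<in> {1..k} \<and> i \<noteq> j} = (\<lambda>(i, j). {i, j}) ` vertex_pairs k" (is "?L = ?R")
  proof
    show "?L \<subseteq> ?R"
    proof clarify
      fix i j assume ij: "i \<in> {1..k}" "j \<in> {1..k}" "i \<noteq> j"
      then have "(min i j, max i j) \<in> vertex_pairs k" by (auto simp: vertex_pairs_def)
      then show "{i, j} \<in> ?R"
        by (rule rev_image_eqI) (auto simp: min_def max_def)
    qed
    show "?R \<subseteq> ?L" by (fastforce simp: vertex_pairs_def)
  qed
  then show ?thesis unfolding graphs_def Pow_iff by (simp only: subset_iff image_iff case_prod_unfold Ball_def)
qed

lemma graph_act_graph_act: "graph_act \<sigma> (graph_act \<tau> F) = graph_act (\<sigma> \<circ> \<tau>) F"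
  by (simp add: graph_act_def image_image image_comp)

lemma graph_act_id [simp]: "graph_act id F = F"
  by (simp add: graph_act_def)

lemma graph_act_inv:
  assumes "\<sigma> permutes S"
  shows "graph_act (inv \<sigma>) (graph_act \<sigma> F) = F" "graph_act \<sigma> (graph_act (inv \<sigma>) F) = F"
  using permutes_inv_o[OF assms] by (simp_all add: graph_act_graph_act)

lemma edge_mem_graph_act_iff:
  assumes "inj \<sigma>"
  shows "{\<sigma> a, \<sigma> b} \<in> graph_act \<sigma> F \<longleftrightarrow> {a, b} \<in> F"
proof -
  have "inj (\<lambda>e. \<sigma> ` e)" using assms by (simp add: inj_image_eq_iff inj_on_def)
  from inj_image_mem_iff[OF this, of "{a, b}" F] show ?thesis by (simp add: graph_act_def)
qed

lemma graph_act_in_graphs: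
  assumes \<sigma>: "\<sigma> permutes {1..k}" and "F \<in> graphs k"
  shows "graph_act \<sigma> F \<in> graphs k"
  unfolding graphs_def
proof
  show "graph_act \<sigma> F \<subseteq> {{i, j} | i j. i \<in> {1..k} \<and> j \<in> {1..k} \<and> i \<noteq> j}"
  proof
    fix e assume "e \<in> graph_act \<sigma> F"
    then obtain i j where ij: "e = \<sigma> ` {i, j}" "i \<in> {1..k}" "j \<in> {1..k}" "i \<noteq> j"
      using assms(2) by (auto simp: graph_act_def graphs_def)
    then have "e = {\<sigma> i, \<sigma> j}" "\<sigma> i \<in> {1..k}" "\<sigma> j \<in> {1..k}" "\<sigma> i \<noteq> \<sigma> j"
      using permutes_in_image[OF \<sigma>] permutes_inj[OF \<sigma>] by (auto dest: injD)
    then show "e \<in> {{i, j} | i j. i \<in> {1..k} \<and> j \<in> {1..k} \<and> i \<noteq> j}" by blast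
  qed
qed

lemma bij_betw_graph_act:
  assumes \<sigma>: "\<sigma> permutes {1..k}"
  shows "bij_betw (graph_act \<sigma>) (graphs k) (graphs k)"
  by (rule bij_betw_byWitness[where f'="graph_act (inv \<sigma>)"])
    (auto simp: graph_act_inv[OF \<sigma>] intro: graph_act_in_graphs \<sigma> permutes_inv)

lemma edge_prob_graph_act:
  assumes \<sigma>: "\<sigma> permutes {1..k}"
  shows "edge_prob k (\<lambda>F H. R (graph_act \<sigma> F) (graph_act \<sigma> H)) F a b =
    edge_prob k R (graph_act \<sigma> F) (\<sigma> a) (\<sigma> b)"
proof -
  have "edge_prob k R (graph_act \<sigma> F) (\<sigma> a) (\<sigma> b) =
      (\<Sum>H\<in>graphs k. R (graph_act \<sigma> F) (graph_act \<sigma> H) * of_bool ({\<sigma> a, \<sigma> b} \<in> graph_act \<sigma> H))"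
    unfolding edge_prob_def by (rule sum.reindex_bij_betw[OF bij_betw_graph_act[OF \<sigma>], symmetric])
  then show ?thesis by (simp add: edge_prob_def edge_mem_graph_act_iff[OF permutes_inj[OF \<sigma>]])
qed

lemma permutations_ne: "card {\<sigma>. \<sigma> permutes {1..k::nat}} \<noteq> 0"
  using finite_permutations[of "{1..k}"] permutes_id[of "{1..k}"] by (auto simp: card_eq_0_iff simp del: permutes_id)

text \<open>The sum runs over the group and not over the orbit, so elements are counted with the
  order of the stabilizer; this makes invariance a matter of reindexing the group.\<close>

definition orbit_sum :: "nat \<Rightarrow> (nat set set \<Rightarrow> nat set set \<Rightarrow> real) \<Rightarrow> nat set set \<Rightarrow> nat \<Rightarrow> nat \<Rightarrow> real" where
  "orbit_sum k R F a b = (\<Sum>\<sigma> | \<sigma> permutes {1..k}. edge_prob k R (graph_act \<sigma> F) (\<sigma> a) (\<sigma> b))"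

lemma orbit_sum_graph_act:
  assumes \<tau>: "\<tau> permutes {1..k}"
  shows "orbit_sum k (\<lambda>F H. R (graph_act \<tau> F) (graph_act \<tau> H)) F a b = orbit_sum k R F a b"
  unfolding orbit_sum_def edge_prob_graph_act[OF \<tau>] graph_act_graph_act
  using setum_permutations_compose_left[OF \<tau>, of "\<lambda>\<sigma>. edge_prob k R (graph_act \<sigma> F) (\<sigma> a) (\<sigma> b)"]
  by simp

section \<open>The orbit sum as a coefficient\<close>

text \<open>For a 0/1 matrix each factor is the truth value of agreement between a vertex pair in
  \<open>F\<close> and its image in \<open>F0\<close>, so the product tests whether
  \<open>\<sigma>\<close> is an isomorphism.\<close>

lemma graph_weight_indicator:
  assumes \<sigma>: "\<sigma> permutes {1..k}" and F: "F \<in> graphs k" "F0 \<in> graphs k"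
  shows "graph_weight k F (\<lambda>(i, j). of_bool ({i, j} \<in> F0)) \<sigma> = of_bool (graph_act \<sigma> F = F0)"
proof -
  let ?P = "\<lambda>(i, j). {i, j} \<in> F \<longleftrightarrow> {\<sigma> i, \<sigma> j} \<in> F0"
  have "graph_weight k F (\<lambda>(i, j). of_bool ({i, j} \<in> F0)) \<sigma> = (\<Prod>p\<in>vertex_pairs k. of_bool (?P p))"
    unfolding graph_weight_def by (intro prod.cong refl) (auto split: if_splits)
  also have "\<dots> = of_bool (\<forall>p\<in>vertex_pairs k. ?P p)"
  proof (cases "\<forall>p\<in>vertex_pairs k. ?P p")
    case True
    then have "(\<Prod>p\<in>vertex_pairs k. of_bool (?P p)) = (1::real)" by (intro prod.neutral) simp
    with True show ?thesis by simp
  next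
    case False
    then have "(\<Prod>p\<in>vertex_pairs k. of_bool (?P p)) = (0::real)" by (intro prod_zero) auto
    with False show ?thesis by simp
  qed
  also have "(\<forall>p\<in>vertex_pairs k. ?P p) \<longleftrightarrow> graph_act \<sigma> F = F0"
  proof
    assume P: "\<forall>p\<in>vertex_pairs k. ?P p"
    have "F = graph_act (inv \<sigma>) F0"
    proof (rule set_eqI)
      fix e
      have F': "graph_act (inv \<sigma>) F0 \<in> graphs k" by (rule graph_act_in_graphs[OF permutes_inv[OF \<sigma>] F(2)])
      have "e \<in> F \<longleftrightarrow> e \<in> graph_act (inv \<sigma>) F0" if "(i, j) \<in> vertex_pairs k" "e = {i, j}" for i j
      proof -
        have "{\<sigma> i, \<sigma> j} \<in> F0 \<longleftrightarrow> {inv \<sigma> (\<sigma> i), inv \<sigma> (\<sigma> j)} \<in> graph_act (inv \<sigma>) F0"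
          by (rule edge_mem_graph_act_iff[symmetric]) (rule permutes_inj[OF permutes_inv[OF \<sigma>]])
        then show ?thesis using P that by (auto simp: permutes_inverses[OF \<sigma>])
      qed
      then show "e \<in> F \<longleftrightarrow> e \<in> graph_act (inv \<sigma>) F0"
        using F(1) F' unfolding mem_graphs_iff by blast
    qed
    then show "graph_act \<sigma> F = F0" by (simp add: graph_act_inv[OF \<sigma>])
  next
    assume "graph_act \<sigma> F = F0"
    then show "\<forall>p\<in>vertex_pairs k. ?P p"
      using edge_mem_graph_act_iff[OF permutes_inj[OF \<sigma>]] by blast
  qed
  finally show ?thesis .
qed

text \<open>Fixed roots contribute no factor to \<open>T_op\<close>; supplying
  \<open>\<alpha> i * \<alpha> j\<close> turns a sum over maps on the free vertices into one over
  all maps from \<open>V\<close> to \<open>K\<close>, homogeneous of degree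
  \<open>card V\<close>.\<close>

lemma sum_PiE_fixed_two:
  fixes g :: "(nat \<Rightarrow> 'k) \<Rightarrow> real"
  assumes K: "finite V" "finite K" and ab: "a \<in> V" "b \<in> V" "a \<noteq> b" and ij: "i \<in> K" "j \<in> K"
  shows "(\<Sum>\<phi>\<in>V \<rightarrow>\<^sub>E K. of_bool (\<phi> a = i \<and> \<phi> b = j) * ((\<Prod>v\<in>V. \<alpha> (\<phi> v)) * g \<phi>)) =
    \<alpha> i * \<alpha> j * (\<Sum>\<phi>\<in>(V - {a, b}) \<rightarrow>\<^sub>E K. (\<Prod>v\<in>V - {a, b}. \<alpha> (\<phi> v)) * g (\<phi>(a := i, b := j)))"
proof -
  let ?J = "V - {a, b}"
  have V: "V = insert a (insert b ?J)" using ab by auto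
  have prod: "(\<Prod>v\<in>V. \<alpha> (\<phi> v)) = \<alpha> (\<phi> a) * \<alpha> (\<phi> b) * (\<Prod>v\<in>?J. \<alpha> (\<phi> v))" for \<phi>
  proof -
    have "(\<Prod>v\<in>insert a (insert b ?J). \<alpha> (\<phi> v)) = \<alpha> (\<phi> a) * \<alpha> (\<phi> b) * (\<Prod>v\<in>?J. \<alpha> (\<phi> v))"
      using ab K by (simp add: mult.assoc)
    then show ?thesis using V by simp
  qed
  have "(\<Sum>\<phi>\<in>V \<rightarrow>\<^sub>E K. of_bool (\<phi> a = i \<and> \<phi> b = j) * ((\<Prod>v\<in>V. \<alpha> (\<phi> v)) * g \<phi>)) =
      (\<Sum>\<phi> | \<phi> \<in> V \<rightarrow>\<^sub>E K \<and> \<phi> a = i \<and> \<phi> b = j. (\<Prod>v\<in>V. \<alpha> (\<phi> v)) * g \<phi>)"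
    using K by (intro sum.mono_neutral_cong_right) (auto simp: finite_PiE)
  also have "\<dots> = (\<Sum>\<phi>\<in>?J \<rightarrow>\<^sub>E K. \<alpha> i * \<alpha> j * ((\<Prod>v\<in>?J. \<alpha> (\<phi> v)) * g (\<phi>(a := i, b := j))))"
  proof (rule sum.reindex_bij_witness[where i="\<lambda>\<phi>. \<phi>(a := i, b := j)" and j="\<lambda>\<phi>. restrict \<phi> ?J"])
    fix \<phi> assume "\<phi> \<in> {\<phi>. \<phi> \<in> V \<rightarrow>\<^sub>E K \<and> \<phi> a = i \<and> \<phi> b = j}"
    then have \<phi>: "\<phi> \<in> V \<rightarrow>\<^sub>E K" "\<phi> a = i" "\<phi> b = j" by auto
    show eq: "(restrict \<phi> ?J)(a := i, b := j) = \<phi>"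
      using \<phi> by (auto simp: fun_eq_iff restrict_def PiE_def extensional_def)
    show "restrict \<phi> ?J \<in> ?J \<rightarrow>\<^sub>E K" using \<phi> by auto
    show "\<alpha> i * \<alpha> j * ((\<Prod>v\<in>?J. \<alpha> (restrict \<phi> ?J v)) * g ((restrict \<phi> ?J)(a := i, b := j))) =
        (\<Prod>v\<in>V. \<alpha> (\<phi> v)) * g \<phi>"
      unfolding eq prod by (simp add: \<phi> mult.assoc)
  next
    fix \<phi> assume \<phi>: "\<phi> \<in> ?J \<rightarrow>\<^sub>E K"
    show "restrict (\<phi>(a := i, b := j)) ?J = \<phi>"
      using \<phi> by (auto simp: fun_eq_iff restrict_def PiE_def extensional_def)
    show "\<phi>(a := i, b := j) \<in> {\<phi>. \<phi> \<in> V \<rightarrow>\<^sub>E K \<and> \<phi> a = i \<and> \<phi> b = j}"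
      using \<phi> ab ij by (auto simp: PiE_def extensional_def Pi_def)
  qed
  finally show ?thesis by (simp add: sum_distrib_left)
qed

lemma sum_surjective_eq_sum_permutations:
  fixes h :: "('v \<Rightarrow> 'v) \<Rightarrow> real"
  assumes "finite V"
  shows "(\<Sum>\<phi> | \<phi> \<in> V \<rightarrow>\<^sub>E V \<and> \<phi> ` V = V. h \<phi>) = (\<Sum>\<sigma> | \<sigma> permutes V. h (restrict \<sigma> V))"
proof (rule sum.reindex_bij_witness[where j="\<lambda>\<phi> x. if x \<in> V then \<phi> x else x" and i="\<lambda>\<sigma>. restrict \<sigma> V"])
  fix \<phi> assume "\<phi> \<in> {\<phi>. \<phi> \<in> V \<rightarrow>\<^sub>E V \<and> \<phi> ` V = V}"
  then have \<phi>: "\<phi> \<in> V \<rightarrow>\<^sub>E V" "\<phi> ` V = V" by auto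
  show eq: "restrict (\<lambda>x. if x \<in> V then \<phi> x else x) V = \<phi>"
    using \<phi> by (auto simp: fun_eq_iff restrict_def PiE_def extensional_def)
  have "bij_betw \<phi> V V" using \<phi>(2) assms by (simp add: bij_betw_def eq_card_imp_inj_on)
  then have "bij_betw (\<lambda>x. if x \<in> V then \<phi> x else x) V V" by (rule bij_betw_cong[THEN iffD1, rotated]) simp
  then show "(\<lambda>x. if x \<in> V then \<phi> x else x) \<in> {\<sigma>. \<sigma> permutes V}"
    by (auto intro: bij_imp_permutes)
  show "h (restrict (\<lambda>x. if x \<in> V then \<phi> x else x) V) = h \<phi>" by (simp only: eq)
next
  fix \<sigma> assume "\<sigma> \<in> {\<sigma>. \<sigma> permutes V}"
  then have \<sigma>: "\<sigma> permutes V" by simp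
  show "(\<lambda>x. if x \<in> V then restrict \<sigma> V x else x) = \<sigma>"
    using permutes_not_in[OF \<sigma>] by (auto simp: fun_eq_iff)
  show "restrict \<sigma> V \<in> {\<phi>. \<phi> \<in> V \<rightarrow>\<^sub>E V \<and> \<phi> ` V = V}"
    using permutes_image[OF \<sigma>] permutes_in_image[OF \<sigma>] by (auto simp: image_restrict_eq)
qed

text \<open>The step kernel of the indicator matrix of \<open>F0\<close>: as a polynomial in the part sizes, its velocity
  at \<open>(a0, b0)\<close> has the orbit sum as the coefficient of the squarefree monomial.\<close>

lemma orbit_sum_eq_of_step_velocity:
  assumes eq: "\<And>\<alpha> w i j. (\<And>i. i \<in> {1..k} \<Longrightarrow> 0 < \<alpha> i) \<Longrightarrow> sum \<alpha> {1..k} = 1 \<Longrightarrow>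
      (\<And>i j. w (i, j) = w (j, i)) \<Longrightarrow> (\<And>q. \<bar>w q\<bar> \<le> 1) \<Longrightarrow> i \<in> {1..k} \<Longrightarrow> j \<in> {1..k} \<Longrightarrow>
      step_velocity k R \<alpha> w (i, j) = step_velocity k R' \<alpha> w (i, j)"
    and F0: "F0 \<in> graphs k" and ab: "a0 \<in> {1..k}" "b0 \<in> {1..k}" "a0 \<noteq> b0"
  shows "orbit_sum k R F0 a0 b0 = orbit_sum k R' F0 a0 b0"
proof -
  let ?K = "{1..k}"
  define w :: "nat \<times> nat \<Rightarrow> real" where "w = (\<lambda>(i, j). of_bool ({i, j} \<in> F0))"
  define d where "d F a b = edge_prob k R F a b - edge_prob k R' F a b" for F a b
  \<comment> \<open>\<open>c \<phi>\<close> collects, over all rooted graphs, what the label map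
    \<open>\<phi>\<close> contributes to the difference of the velocities at \<open>(a0, b0)\<close>
    multiplied by \<open>\<alpha> a0 * \<alpha> b0\<close>.\<close>
  define c where "c \<phi> = (\<Sum>(F, (a, b))\<in>rooted_graphs k. d F a b * (of_bool (\<phi> a = a0 \<and> \<phi> b = b0) * graph_weight k F w \<phi>))" for \<phi>
  have "(\<Sum>\<phi> | \<phi> \<in> ?K \<rightarrow>\<^sub>E ?K \<and> \<phi> ` ?K = ?K. c \<phi>) = 0"
  proof (rule sum_image_eq_zero)
    fix \<alpha> :: "nat \<Rightarrow> real" assume \<alpha>: "\<And>i. i \<in> ?K \<Longrightarrow> 0 < \<alpha> i" "sum \<alpha> ?K = 1"
    define S where "S F a b = (\<Sum>\<phi>\<in>(?K - {a, b}) \<rightarrow>\<^sub>E ?K. (\<Prod>v\<in>?K - {a, b}. \<alpha> (\<phi> v)) *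
      graph_weight k F w (\<phi>(a := a0, b := b0)))" for F a b
    have sv: "step_velocity k Q \<alpha> w (a0, b0) =
        (\<Sum>(F, (a, b))\<in>rooted_graphs k. (edge_prob k Q F a b - of_bool ({a, b} \<in> F)) * S F a b)" for Q
      unfolding step_velocity_def root_sum_def prod.case S_def ..
    have "(\<Sum>\<phi>\<in>?K \<rightarrow>\<^sub>E ?K. c \<phi> * (\<Prod>v\<in>?K. \<alpha> (\<phi> v))) =
        (\<Sum>f\<in>rooted_graphs k. \<Sum>\<phi>\<in>?K \<rightarrow>\<^sub>E ?K. case f of (F, (a, b)) \<Rightarrow>
           d F a b * (of_bool (\<phi> a = a0 \<and> \<phi> b = b0) * ((\<Prod>v\<in>?K. \<alpha> (\<phi> v)) * graph_weight k F w \<phi>)))"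
      unfolding c_def sum_distrib_right by (subst sum.swap) (auto intro!: sum.cong)
    also have "\<dots> = (\<Sum>f\<in>rooted_graphs k. case f of (F, (a, b)) \<Rightarrow> d F a b * (\<alpha> a0 * \<alpha> b0 * S F a b))"
    proof (rule sum.cong[OF refl])
      fix f assume "f \<in> rooted_graphs k"
      then obtain F a b where f: "f = (F, (a, b))" "a \<in> ?K" "b \<in> ?K" "a \<noteq> b" by (auto simp: rooted_graphs_def)
      show "(\<Sum>\<phi>\<in>?K \<rightarrow>\<^sub>E ?K. case f of (F, (a, b)) \<Rightarrow>
           d F a b * (of_bool (\<phi> a = a0 \<and> \<phi> b = b0) * ((\<Prod>v\<in>?K. \<alpha> (\<phi> v)) * graph_weight k F w \<phi>))) =
          (case f of (F, (a, b)) \<Rightarrow> d F a b * (\<alpha> a0 * \<alpha> b0 * S F a b))"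
        unfolding f(1) prod.case sum_distrib_left[symmetric]
        by (subst sum_PiE_fixed_two[OF _ _ f(2-4) ab(1,2)]) (auto simp: S_def)
    qed
    \<comment> \<open>The terms \<open>of_bool ({a, b} \<in> F)\<close> are the same for both rules
      and cancel.\<close>
    also have "\<dots> = \<alpha> a0 * \<alpha> b0 * (step_velocity k R \<alpha> w (a0, b0) - step_velocity k R' \<alpha> w (a0, b0))"
      unfolding sv sum_subtractf[symmetric] sum_distrib_left
      by (rule sum.cong[OF refl]) (auto simp: d_def algebra_simps)
    also have "step_velocity k R \<alpha> w (a0, b0) = step_velocity k R' \<alpha> w (a0, b0)"
      using \<alpha> ab by (intro eq) (auto simp: w_def insert_commute)
    finally show "(\<Sum>\<phi>\<in>?K \<rightarrow>\<^sub>E ?K. c \<phi> * (\<Prod>v\<in>?K. \<alpha> (\<phi> v))) = 0" by simp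
  qed (use ab in auto)
  then have "0 = (\<Sum>\<sigma> | \<sigma> permutes ?K. c (restrict \<sigma> ?K))"
    by (simp add: sum_surjective_eq_sum_permutations)
  also have "\<dots> = (\<Sum>\<sigma> | \<sigma> permutes ?K. d (graph_act (inv \<sigma>) F0) (inv \<sigma> a0) (inv \<sigma> b0))"
  proof (rule sum.cong[OF refl])
    fix \<sigma> assume "\<sigma> \<in> {\<sigma>. \<sigma> permutes ?K}"
    then have \<sigma>: "\<sigma> permutes ?K" by simp
    let ?f = "(graph_act (inv \<sigma>) F0, inv \<sigma> a0, inv \<sigma> b0)"
    have mem: "?f \<in> rooted_graphs k"
      using graph_act_in_graphs[OF permutes_inv[OF \<sigma>] F0] permutes_in_image[OF permutes_inv[OF \<sigma>]] ab
        permutes_inj[OF permutes_inv[OF \<sigma>]]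
      by (auto simp: rooted_graphs_def dest: injD)
    \<comment> \<open>For a permutation only one rooted graph contributes, namely the one that
      \<open>\<sigma>\<close> carries to \<open>F0\<close> with roots
      \<open>(a0, b0)\<close>.\<close>
    have "c (restrict \<sigma> ?K) = (\<Sum>f\<in>rooted_graphs k. if f = ?f then d (fst f) (fst (snd f)) (snd (snd f)) else 0)"
      unfolding c_def
    proof (rule sum.cong[OF refl])
      fix f assume "f \<in> rooted_graphs k"
      then obtain F a b where f: "f = (F, (a, b))" "F \<in> graphs k" "a \<in> ?K" "b \<in> ?K" by (auto simp: rooted_graphs_def)
      have "graph_weight k F w (restrict \<sigma> ?K) = graph_weight k F w \<sigma>" by (rule graph_weight_cong) simp
      also have "\<dots> = of_bool (graph_act \<sigma> F = F0)"
        unfolding w_def by (rule graph_weight_indicator[OF \<sigma> f(2) F0])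
      also have "graph_act \<sigma> F = F0 \<longleftrightarrow> F = graph_act (inv \<sigma>) F0"
        using graph_act_inv[OF \<sigma>] by metis
      finally have gw: "graph_weight k F w (restrict \<sigma> ?K) = of_bool (F = graph_act (inv \<sigma>) F0)" .
      have "\<sigma> a = a0 \<longleftrightarrow> a = inv \<sigma> a0" "\<sigma> b = b0 \<longleftrightarrow> b = inv \<sigma> b0"
        using permutes_inverses[OF \<sigma>] by metis+
      with f(3,4) show "(case f of (F, (a, b)) \<Rightarrow> d F a b * (of_bool (restrict \<sigma> ?K a = a0 \<and> restrict \<sigma> ?K b = b0)
            * graph_weight k F w (restrict \<sigma> ?K))) = (if f = ?f then d (fst f) (fst (snd f)) (snd (snd f)) else 0)"
        unfolding f(1) prod.case gw by auto
    qed
    then show "c (restrict \<sigma> ?K) = d (graph_act (inv \<sigma>) F0) (inv \<sigma> a0) (inv \<sigma> b0)"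
      using mem by simp
  qed
  also have "\<dots> = (\<Sum>\<sigma> | \<sigma> permutes ?K. d (graph_act \<sigma> F0) (\<sigma> a0) (\<sigma> b0))"
    by (rule sum_permutations_inverse[symmetric])
  also have "\<dots> = orbit_sum k R F0 a0 b0 - orbit_sum k R' F0 a0 b0"
    by (simp add: d_def orbit_sum_def sum_subtractf)
  finally show ?thesis by simp
qed

section \<open>Invariance under relabelling\<close>

text \<open>A permutation need not respect the orientation \<open>i < j\<close> of the enumerated
  pairs, so a pair is sent to its smaller and its larger image; the symmetry of \<open>W\<close>
  absorbs the reversal.\<close>

lemma graph_weight_graph_act:
  assumes \<sigma>: "\<sigma> permutes {1..k}" and W: "W \<in> kernels M" and u: "\<And>i. i \<in> {1..k} \<Longrightarrow> u i \<in> space M"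
  shows "graph_weight k (graph_act \<sigma> F) W u = graph_weight k F W (u \<circ> \<sigma>)"
proof -
  let ?\<pi> = "\<lambda>(i, j). (min (\<sigma> i) (\<sigma> j), max (\<sigma> i) (\<sigma> j))"
  let ?g = "\<lambda>(i, j). if {i, j} \<in> graph_act \<sigma> F then W (u i, u j) else 1 - W (u i, u j)"
  note inj = permutes_inj[OF \<sigma>]
  have "inj_on ?\<pi> (vertex_pairs k)"
  proof (rule inj_onI, clarify)
    fix i j i' j' assume ij: "(i, j) \<in> vertex_pairs k" "(i', j') \<in> vertex_pairs k"
      and "min (\<sigma> i) (\<sigma> j) = min (\<sigma> i') (\<sigma> j')" "max (\<sigma> i) (\<sigma> j) = max (\<sigma> i') (\<sigma> j')"
    then have "\<sigma> i = \<sigma> i' \<and> \<sigma> j = \<sigma> j' \<or> \<sigma> i = \<sigma> j' \<and> \<sigma> j = \<sigma> i'"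
      by (auto simp: min_def max_def split: if_splits)
    then have "i = i' \<and> j = j' \<or> i = j' \<and> j = i'" by (simp add: inj_eq[OF inj])
    then show "i = i' \<and> j = j'" using ij by (auto simp: vertex_pairs_def)
  qed
  moreover have "?\<pi> ` vertex_pairs k \<subseteq> vertex_pairs k"
  proof clarify
    fix i j assume "(i, j) \<in> vertex_pairs k"
    then have "i \<in> {1..k}" "j \<in> {1..k}" "\<sigma> i \<noteq> \<sigma> j" using injD[OF inj, of i j] by (auto simp: vertex_pairs_def)
    then show "(min (\<sigma> i) (\<sigma> j), max (\<sigma> i) (\<sigma> j)) \<in> vertex_pairs k"
      using permutes_in_image[OF \<sigma>, of i] permutes_in_image[OF \<sigma>, of j]
      by (auto simp: vertex_pairs_def min_def max_def)
  qed
  ultimately have bij: "bij_betw ?\<pi> (vertex_pairs k) (vertex_pairs k)"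
    by (simp add: bij_betw_def endo_inj_surj)
  have "graph_weight k (graph_act \<sigma> F) W u = (\<Prod>p\<in>vertex_pairs k. ?g (?\<pi> p))"
    unfolding graph_weight_def by (rule prod.reindex_bij_betw[OF bij, symmetric])
  also have "\<dots> = graph_weight k F W (u \<circ> \<sigma>)"
    unfolding graph_weight_def
  proof (rule prod.cong[OF refl])
    fix p assume "p \<in> vertex_pairs k"
    then obtain i j where p: "p = (i, j)" "i \<in> {1..k}" "j \<in> {1..k}" by (cases p) (auto simp: vertex_pairs_def)
    have "u (\<sigma> i) \<in> space M" "u (\<sigma> j) \<in> space M"
      using u p permutes_in_image[OF \<sigma>] by blast+
    then have sym: "W (u (\<sigma> j), u (\<sigma> i)) = W (u (\<sigma> i), u (\<sigma> j))" using W by (simp add: kernels_def)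
    show "?g (?\<pi> p) = (case p of (i, j) \<Rightarrow> if {i, j} \<in> F then W ((u \<circ> \<sigma>) i, (u \<circ> \<sigma>) j) else 1 - W ((u \<circ> \<sigma>) i, (u \<circ> \<sigma>) j))"
      using sym edge_mem_graph_act_iff[OF inj, of i j F] edge_mem_graph_act_iff[OF inj, of j i F]
      by (auto simp: p(1) min_def max_def insert_commute)
  qed
  finally show ?thesis .
qed

text \<open>Change of variables: reindexing the free coordinates along \<open>\<sigma>\<close>
  preserves the product measure.\<close>

lemma (in prob_space) T_op_graph_act:
  assumes \<sigma>: "\<sigma> permutes {1..k}" and W: "W \<in> kernels M" and xy: "x \<in> space M" "y \<in> space M"
    and ab: "a \<in> {1..k}" "b \<in> {1..k}" "a \<noteq> b"
  shows "T_op M k (graph_act \<sigma> F) (\<sigma> a) (\<sigma> b) W (x, y) = T_op M k F a b W (x, y)"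
proof -
  let ?J = "{1..k} - {a, b}" let ?J' = "{1..k} - {\<sigma> a, \<sigma> b}"
  let ?r = "\<lambda>z. \<lambda>n\<in>?J. z (\<sigma> n)"
  note inj = permutes_inj[OF \<sigma>]
  have img: "\<sigma> n \<in> ?J'" if "n \<in> ?J" for n
    using that permutes_in_image[OF \<sigma>] injD[OF inj] by blast
  have distr: "distr (PiM ?J' (\<lambda>_. M)) (PiM ?J (\<lambda>_. M)) ?r = PiM ?J (\<lambda>_. M)"
    using distr_PiM_reindex[of ?J' "\<lambda>_. M" \<sigma> ?J] prob_space_axioms img inj by (auto intro: inj_on_subset)
  have r: "?r \<in> measurable (PiM ?J' (\<lambda>_. M)) (PiM ?J (\<lambda>_. M))"
    using img by (intro measurable_restrict measurable_component_singleton) auto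
  have m: "(\<lambda>z. graph_weight k F W (z(a := x, b := y))) \<in> borel_measurable (PiM ?J (\<lambda>_. M))"
    using graph_weight_integrable[OF kernels_bounded_measurable[OF W] xy] by (rule borel_measurable_integrable)
  have "T_op M k (graph_act \<sigma> F) (\<sigma> a) (\<sigma> b) W (x, y) =
      (LINT z|PiM ?J' (\<lambda>_. M). graph_weight k F W ((?r z)(a := x, b := y)))"
    unfolding T_op_eq_graph_weight
  proof (rule Bochner_Integration.integral_cong[OF refl])
    fix z assume z: "z \<in> space (PiM ?J' (\<lambda>_. M))"
    have "(z(\<sigma> a := x, \<sigma> b := y)) i \<in> space M" if "i \<in> {1..k}" for i
      using that z xy by (cases "i = \<sigma> a"; cases "i = \<sigma> b") (auto simp: space_PiM PiE_iff)
    then have "graph_weight k (graph_act \<sigma> F) W (z(\<sigma> a := x, \<sigma> b := y)) =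
        graph_weight k F W ((z(\<sigma> a := x, \<sigma> b := y)) \<circ> \<sigma>)"
      by (rule graph_weight_graph_act[OF \<sigma> W])
    also have "\<dots> = graph_weight k F W ((?r z)(a := x, b := y))"
      by (rule graph_weight_cong) (use injD[OF inj] in auto)
    finally show "graph_weight k (graph_act \<sigma> F) W (z(\<sigma> a := x, \<sigma> b := y)) = graph_weight k F W ((?r z)(a := x, b := y))" .
  qed
  also have "\<dots> = (LINT z|distr (PiM ?J' (\<lambda>_. M)) (PiM ?J (\<lambda>_. M)) ?r. graph_weight k F W (z(a := x, b := y)))"
    by (rule integral_distr[OF r m, symmetric])
  also have "\<dots> = T_op M k F a b W (x, y)" unfolding distr T_op_eq_graph_weight ..
  finally show ?thesis .
qed

text \<open>As \<open>T\<close> is constant on orbits of rooted graphs, the coefficients in the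
  difference of the velocities may be replaced by their averages over all relabellings, which are
  differences of orbit sums divided by the number of permutations.\<close>

lemma (in prob_space) velocity_eq_of_orbit_sum_eq:
  assumes orb: "\<And>F a b. F \<in> graphs k \<Longrightarrow> a \<in> {1..k} \<Longrightarrow> b \<in> {1..k} \<Longrightarrow> a \<noteq> b \<Longrightarrow>
      orbit_sum k R F a b = orbit_sum k R' F a b"
    and W: "W \<in> kernels M" and xy: "x \<in> space M" "y \<in> space M"
  shows "velocity M k R W (x, y) = velocity M k R' W (x, y)"
proof -
  let ?P = "{\<sigma>. \<sigma> permutes {1..k}}" let ?I = "rooted_graphs k"
  define d where "d = (\<lambda>(F, (a, b)). edge_prob k R F a b - edge_prob k R' F a b)"
  define T where "T = (\<lambda>(F, (a, b)). T_op M k F a b W (x, y))"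
  define act where "act = (\<lambda>\<sigma>. \<lambda>(F, (a, b)). (graph_act \<sigma> F, (\<sigma> a, \<sigma> b)))"
  have diff: "velocity M k R W (x, y) - velocity M k R' W (x, y) = (\<Sum>f\<in>?I. d f * T f)"
    unfolding velocity_eq_rooted_sum sum_subtractf[symmetric]
    by (rule sum.cong[OF refl]) (auto simp: d_def T_def algebra_simps)
  have in_act: "act \<sigma> f \<in> ?I" if \<sigma>: "\<sigma> permutes {1..k}" and f: "f \<in> ?I" for \<sigma> f
  proof -
    obtain F a b where F: "f = (F, (a, b))" "F \<in> graphs k" "a \<in> {1..k}" "b \<in> {1..k}" "a \<noteq> b"
      using f by (auto simp: rooted_graphs_def)
    then have "\<sigma> a \<in> {1..k}" "\<sigma> b \<in> {1..k}" "\<sigma> a \<noteq> \<sigma> b"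
      by (simp_all only: permutes_in_image[OF \<sigma>] inj_eq[OF permutes_inj[OF \<sigma>]] not_False_eq_True)
    then show ?thesis using graph_act_in_graphs[OF \<sigma> F(2)] by (simp add: F(1) act_def rooted_graphs_def)
  qed
  have "(\<Sum>f\<in>?I. d f * T f) = (\<Sum>f\<in>?I. d (act \<sigma> f) * T f)" if \<sigma>: "\<sigma> permutes {1..k}" for \<sigma>
  proof -
    have inv: "act (inv \<sigma>) (act \<sigma> f) = f" "act \<sigma> (act (inv \<sigma>) f) = f" for f
      by (cases f; simp add: act_def graph_act_inv[OF \<sigma>] permutes_inverses[OF \<sigma>])+
    have bij: "bij_betw (act \<sigma>) ?I ?I"
      by (rule bij_betw_byWitness[where f'="act (inv \<sigma>)"])
        (simp_all add: inv image_subset_iff in_act[OF \<sigma>] in_act[OF permutes_inv[OF \<sigma>]])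
    have "(\<Sum>f\<in>?I. d f * T f) = (\<Sum>f\<in>?I. d (act \<sigma> f) * T (act \<sigma> f))"
      by (rule sum.reindex_bij_betw[OF bij, symmetric])
    also have "\<dots> = (\<Sum>f\<in>?I. d (act \<sigma> f) * T f)"
    proof (rule sum.cong[OF refl])
      fix f assume "f \<in> ?I"
      then show "d (act \<sigma> f) * T (act \<sigma> f) = d (act \<sigma> f) * T f"
        using T_op_graph_act[OF \<sigma> W xy] by (auto simp: rooted_graphs_def act_def T_def)
    qed
    finally show ?thesis .
  qed
  then have "card ?P * (\<Sum>f\<in>?I. d f * T f) = (\<Sum>\<sigma>\<in>?P. \<Sum>f\<in>?I. d (act \<sigma> f) * T f)"
    by (subst sum_constant[symmetric]) (auto intro!: sum.cong)
  also have "\<dots> = (\<Sum>f\<in>?I. (\<Sum>\<sigma>\<in>?P. d (act \<sigma> f)) * T f)"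
    by (subst sum.swap) (simp add: sum_distrib_right)
  also have "\<dots> = 0"
  proof (rule sum.neutral, rule ballI)
    fix f assume "f \<in> ?I"
    then obtain F a b where f: "f = (F, (a, b))" "F \<in> graphs k" "a \<in> {1..k}" "b \<in> {1..k}" "a \<noteq> b"
      by (auto simp: rooted_graphs_def)
    have "(\<Sum>\<sigma>\<in>?P. d (act \<sigma> f)) = orbit_sum k R F a b - orbit_sum k R' F a b"
      by (simp add: f(1) d_def act_def orbit_sum_def sum_subtractf)
    then show "(\<Sum>\<sigma>\<in>?P. d (act \<sigma> f)) * T f = 0" using orb[OF f(2-5)] by simp
  qed
  finally have "card ?P = 0 \<or> (\<Sum>f\<in>?I. d f * T f) = 0" by simp
  then show ?thesis using diff permutations_ne[of k] by simp
qed

section \<open>Rules with equal orbit sums\<close>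

lemma rule_nonneg: "is_rule k R \<Longrightarrow> F \<in> graphs k \<Longrightarrow> H \<in> graphs k \<Longrightarrow> 0 \<le> R F H"
  and rule_sum: "is_rule k R \<Longrightarrow> F \<in> graphs k \<Longrightarrow> (\<Sum>H\<in>graphs k. R F H) = 1"
  by (auto simp: is_rule_def)

lemma is_ruleI:
  assumes nonneg: "\<And>F H. F \<in> graphs k \<Longrightarrow> H \<in> graphs k \<Longrightarrow> 0 \<le> R F H"
    and sum: "\<And>F. F \<in> graphs k \<Longrightarrow> (\<Sum>H\<in>graphs k. R F H) = 1"
  shows "is_rule k R"
  unfolding is_rule_def
proof (intro conjI ballI)
  fix F H assume FH: "F \<in> graphs k" "H \<in> graphs k"
  show "0 \<le> R F H" by (rule nonneg[OF FH])
  have "R F H \<le> (\<Sum>H\<in>graphs k. R F H)" using FH nonneg by (intro member_le_sum) auto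
  then show "R F H \<le> 1" by (simp add: sum FH)
qed (rule sum)

lemma rule_sum_graph_act:
  assumes "is_rule k R" "\<sigma> permutes {1..k}" "F \<in> graphs k"
  shows "(\<Sum>H\<in>graphs k. R (graph_act \<sigma> F) (graph_act \<sigma> H)) = 1"
  using sum.reindex_bij_betw[OF bij_betw_graph_act[OF assms(2)], of "R (graph_act \<sigma> F)"]
    rule_sum[OF assms(1) graph_act_in_graphs[OF assms(2,3)]] by simp

lemma edge_prob_bounds:
  assumes R: "is_rule k R" and F: "F \<in> graphs k"
  shows "0 \<le> edge_prob k R F a b" "edge_prob k R F a b \<le> 1"
proof -
  show "0 \<le> edge_prob k R F a b"
    unfolding edge_prob_def using rule_nonneg[OF R F] by (intro sum_nonneg) auto
  have "edge_prob k R F a b \<le> (\<Sum>H\<in>graphs k. R F H)"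
    unfolding edge_prob_def using rule_nonneg[OF R F] by (intro sum_mono) auto
  then show "edge_prob k R F a b \<le> 1" by (simp add: rule_sum[OF R F])
qed

lemma edge_prob_zero_imp:
  assumes R: "is_rule k R" and F: "F \<in> graphs k" and H: "H \<in> graphs k" "{a, b} \<in> H"
    and "edge_prob k R F a b = 0"
  shows "R F H = 0"
proof -
  have "\<forall>H\<in>graphs k. R F H * of_bool ({a, b} \<in> H) = 0"
    using assms(5) rule_nonneg[OF R F] unfolding edge_prob_def by (subst (asm) sum_nonneg_eq_0_iff) auto
  with H show ?thesis by force
qed

lemma edge_prob_one_imp:
  assumes R: "is_rule k R" and F: "F \<in> graphs k" and H: "H \<in> graphs k" "{a, b} \<notin> H"
    and "edge_prob k R F a b = 1"
  shows "R F H = 0"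
proof -
  have "(\<Sum>H\<in>graphs k. R F H * of_bool ({a, b} \<notin> H)) = (\<Sum>H\<in>graphs k. R F H) - edge_prob k R F a b"
    unfolding edge_prob_def sum_subtractf[symmetric] by (intro sum.cong) auto
  then have "(\<Sum>H\<in>graphs k. R F H * of_bool ({a, b} \<notin> H)) = 0"
    using assms(5) by (simp add: rule_sum[OF R F])
  then have "\<forall>H\<in>graphs k. R F H * of_bool ({a, b} \<notin> H) = 0"
    using rule_nonneg[OF R F] by (subst (asm) sum_nonneg_eq_0_iff) auto
  with H show ?thesis by force
qed

lemma symmetric_rule_edge_prob:
  assumes "symmetric_rule k R" and \<sigma>: "\<sigma> permutes {1..k}" and F: "F \<in> graphs k"
  shows "edge_prob k R (graph_act \<sigma> F) (\<sigma> a) (\<sigma> b) = edge_prob k R F a b"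
  unfolding edge_prob_graph_act[OF \<sigma>, symmetric] unfolding edge_prob_def
  by (rule sum.cong[OF refl]) (use assms in \<open>simp add: symmetric_rule_def\<close>)

text \<open>An average of probabilities that equals 0 or 1 forces every term to be 0 or 1.\<close>

lemma rule_eq_of_symmetric_deterministic:
  assumes R: "is_rule k R" "symmetric_rule k R" "deterministic_rule k R" and R': "is_rule k R'"
    and orb: "\<And>F a b. F \<in> graphs k \<Longrightarrow> a \<in> {1..k} \<Longrightarrow> b \<in> {1..k} \<Longrightarrow> a \<noteq> b \<Longrightarrow>
      orbit_sum k R' F a b = orbit_sum k R F a b"
  shows "rule_eq k R' R"
  unfolding rule_eq_def
proof
  fix F assume F: "F \<in> graphs k"
  let ?P = "{\<sigma>. \<sigma> permutes {1..k}}"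
  obtain G where G: "G \<in> graphs k" and RG: "\<And>H. H \<in> graphs k \<Longrightarrow> R F H = of_bool (H = G)"
    using R(3) F unfolding deterministic_rule_def by blast
  have p: "edge_prob k R F a b = of_bool ({a, b} \<in> G)" for a b
  proof -
    have "edge_prob k R F a b = (\<Sum>H\<in>graphs k. if H = G then of_bool ({a, b} \<in> H) else 0)"
      unfolding edge_prob_def by (intro sum.cong refl) (simp add: RG)
    then show ?thesis using G by simp
  qed
  have p': "edge_prob k R' F a b = edge_prob k R F a b" if ab: "a \<in> {1..k}" "b \<in> {1..k}" "a \<noteq> b" for a b
  proof -
    let ?q = "\<lambda>\<sigma>. edge_prob k R' (graph_act \<sigma> F) (\<sigma> a) (\<sigma> b)"
    \<comment> \<open>The sign makes all deviations from the target nonnegative, whether the target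
      is 0 or 1; a vanishing sum then kills each of them, and the identity permutation gives
      \<open>F\<close> itself.\<close>
    let ?s = "if {a, b} \<in> G then - 1 else 1 :: real"
    have "orbit_sum k R F a b = (\<Sum>\<sigma>\<in>?P. of_bool ({a, b} \<in> G))"
      unfolding orbit_sum_def by (intro sum.cong refl) (simp add: symmetric_rule_edge_prob[OF R(2) _ F] p)
    then have "(\<Sum>\<sigma>\<in>?P. ?s * (?q \<sigma> - of_bool ({a, b} \<in> G))) = 0"
      using orb[OF F ab] unfolding sum_distrib_left[symmetric] sum_subtractf by (simp add: orbit_sum_def)
    moreover have "0 \<le> ?s * (?q \<sigma> - of_bool ({a, b} \<in> G))" if "\<sigma> \<in> ?P" for \<sigma>
      using edge_prob_bounds[OF R' graph_act_in_graphs[OF _ F]] that by auto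
    ultimately have "?s * (?q id - of_bool ({a, b} \<in> G)) = 0"
      using sum_nonneg_eq_0_iff[OF finite_permutations[OF finite_atLeastAtMost[of 1 k]], of "\<lambda>\<sigma>. ?s * (?q \<sigma> - of_bool ({a, b} \<in> G))"]
        permutes_id[of "{1..k}"] by blast
    then show ?thesis by (simp add: p split: if_splits)
  qed
  have zero: "R' F H = 0" if H: "H \<in> graphs k" "H \<noteq> G" for H
  proof -
    \<comment> \<open>A graph other than \<open>G\<close> differs from it at some pair, whose edge
      probability 0 or 1 excludes it as an outcome.\<close>
    obtain e where e: "e \<in> H \<longleftrightarrow> e \<notin> G" "e \<in> H \<or> e \<in> G" using H(2) by auto
    then obtain a b where ab: "e = {a, b}" "a \<in> {1..k}" "b \<in> {1..k}" "a \<noteq> b"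
      using H(1) G unfolding graphs_def by blast
    show ?thesis
    proof (cases "e \<in> H")
      case True
      then show ?thesis using edge_prob_zero_imp[OF R' F H(1)] p'[OF ab(2-4)] e p ab(1) by simp
    next
      case False
      then show ?thesis using edge_prob_one_imp[OF R' F H(1)] p'[OF ab(2-4)] e p ab(1) by simp
    qed
  qed
  have "(\<Sum>H\<in>graphs k. R' F H) = R' F G + (\<Sum>H\<in>graphs k - {G}. R' F H)"
    using G by (intro sum.remove) auto
  then have "R' F G = 1" using zero by (simp add: rule_sum[OF R' F])
  then show "\<forall>H\<in>graphs k. R' F H = R F H" using zero RG by auto
qed

lemma graphs_2: "graphs 2 = {{}, {{1, 2}}}"
proof -
  have "{{i, j} | i j. i \<in> {1..2::nat} \<and> j \<in> {1..2} \<and> i \<noteq> j} = {{1, 2}}"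
  proof -
    have eq: "{1..2::nat} = {1, 2}" by auto
    show ?thesis unfolding eq
    proof
      show "{{1, 2}} \<subseteq> {{i, j} | i j. i \<in> {1, 2::nat} \<and> j \<in> {1, 2} \<and> i \<noteq> j}"
        by (clarify, rule exI[of _ 1], rule exI[of _ 2]) simp
    qed auto
  qed
  then show ?thesis unfolding graphs_def by (simp only: Pow_insert Pow_empty) auto
qed

text \<open>Both permutations of two vertices fix the only possible edge, so all summands of an
  orbit sum equal the entry \<open>Q F {{1, 2}}\<close>; the other entry of the row is its
  complement to 1.\<close>

lemma rule_eq_order_2:
  assumes R: "is_rule 2 R" and R': "is_rule 2 R'"
    and orb: "\<And>F. F \<in> graphs 2 \<Longrightarrow> orbit_sum 2 R' F 1 2 = orbit_sum 2 R F 1 2"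
  shows "rule_eq 2 R' R"
  unfolding rule_eq_def
proof
  fix F assume F: "F \<in> graphs 2"
  let ?P = "{\<sigma>. \<sigma> permutes {1..2::nat}}"
  have "orbit_sum 2 Q F 1 2 = card ?P * Q F {{1, 2}}" for Q :: "nat set set \<Rightarrow> nat set set \<Rightarrow> real"
  proof -
    have "edge_prob 2 Q (graph_act \<sigma> F) (\<sigma> 1) (\<sigma> 2) = Q F {{1, 2}}" if "\<sigma> permutes {1..2}" for \<sigma>
    proof -
      have "{1..2::nat} = {1, 2}" by auto
      then have im: "{\<sigma> 1, \<sigma> 2} = {1, 2}" using permutes_image[OF that] by simp
      then have "graph_act \<sigma> F = F" using F by (auto simp: graphs_2 graph_act_def)
      then show ?thesis unfolding edge_prob_def graphs_2 im by simp
    qed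
    then show ?thesis by (simp add: orbit_sum_def)
  qed
  then have 1: "R' F {{1, 2}} = R F {{1, 2}}" using orb[OF F] permutations_ne[of 2] by simp
  moreover have "R' F {} = R F {}"
    using rule_sum[OF R F] rule_sum[OF R' F] 1 by (simp add: graphs_2)
  ultimately show "\<forall>H\<in>graphs 2. R' F H = R F H" by (simp add: graphs_2)
qed

section \<open>Constructing a different rule with the same orbit sums\<close>

definition symmetrized :: "nat \<Rightarrow> (nat set set \<Rightarrow> nat set set \<Rightarrow> real) \<Rightarrow> nat set set \<Rightarrow> nat set set \<Rightarrow> real" where
  "symmetrized k R F H =
     (\<Sum>\<sigma> | \<sigma> permutes {1..k}. R (graph_act \<sigma> F) (graph_act \<sigma> H)) / card {\<sigma>. \<sigma> permutes {1..k}}"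

lemma is_rule_symmetrized:
  assumes R: "is_rule k R"
  shows "is_rule k (symmetrized k R)"
proof (rule is_ruleI)
  show "0 \<le> symmetrized k R F H" if "F \<in> graphs k" "H \<in> graphs k" for F H
    unfolding symmetrized_def
  proof (intro divide_nonneg_nonneg sum_nonneg of_nat_0_le_iff)
    fix \<sigma> assume "\<sigma> \<in> {\<sigma>. \<sigma> permutes {1..k}}"
    then have "\<sigma> permutes {1..k}" by simp
    then show "0 \<le> R (graph_act \<sigma> F) (graph_act \<sigma> H)"
      using that by (intro rule_nonneg[OF R] graph_act_in_graphs)
  qed
  fix F assume F: "F \<in> graphs k"
  have "(\<Sum>H\<in>graphs k. symmetrized k R F H) =
      (\<Sum>\<sigma> | \<sigma> permutes {1..k}. \<Sum>H\<in>graphs k. R (graph_act \<sigma> F) (graph_act \<sigma> H)) / card {\<sigma>. \<sigma> permutes {1..k}}"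
    unfolding symmetrized_def sum_divide_distrib[symmetric] by (subst sum.swap) simp
  also have "(\<Sum>\<sigma> | \<sigma> permutes {1..k}. \<Sum>H\<in>graphs k. R (graph_act \<sigma> F) (graph_act \<sigma> H)) = card {\<sigma>. \<sigma> permutes {1..k}}"
    using rule_sum_graph_act[OF R _ F] by simp
  finally show "(\<Sum>H\<in>graphs k. symmetrized k R F H) = 1" using permutations_ne[of k] by simp
qed

lemma symmetric_rule_symmetrized: "symmetric_rule k (symmetrized k R)"
  unfolding symmetric_rule_def
proof (intro ballI allI impI)
  fix F H \<tau> assume \<tau>: "\<tau> permutes {1..k}"
  show "symmetrized k R (graph_act \<tau> F) (graph_act \<tau> H) = symmetrized k R F H"
    unfolding symmetrized_def graph_act_graph_act
    using sum_permutations_compose_right[OF \<tau>, of "\<lambda>\<sigma>. R (graph_act \<sigma> F) (graph_act \<sigma> H)"] by simp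
qed

text \<open>Each relabelled copy of the rule has the same orbit sums, and orbit sums are linear in
  the rule.\<close>

lemma orbit_sum_symmetrized: "orbit_sum k (symmetrized k R) F a b = orbit_sum k R F a b"
proof -
  let ?P = "{\<sigma>. \<sigma> permutes {1..k}}"
  have "edge_prob k (symmetrized k R) F a b = (\<Sum>\<tau>\<in>?P. edge_prob k (\<lambda>F H. R (graph_act \<tau> F) (graph_act \<tau> H)) F a b) / card ?P"
    for F a b
    unfolding edge_prob_def symmetrized_def
    by (subst sum.swap) (simp add: sum_distrib_right flip: sum_divide_distrib)
  then have "orbit_sum k (symmetrized k R) F a b =
      (\<Sum>\<tau>\<in>?P. orbit_sum k (\<lambda>F H. R (graph_act \<tau> F) (graph_act \<tau> H)) F a b) / card ?P"
    unfolding orbit_sum_def by (simp only: sum_divide_distrib[symmetric]) (subst sum.swap, rule refl)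
  also have "\<dots> = (\<Sum>\<tau>\<in>?P. orbit_sum k R F a b) / card ?P"
    by (simp add: orbit_sum_graph_act)
  finally show ?thesis using permutations_ne[of k] by simp
qed

lemma orbit_sum_add_scaled:
  "orbit_sum k (\<lambda>F H. R F H + e * D F H) F a b = orbit_sum k R F a b + e * orbit_sum k D F a b"
  unfolding orbit_sum_def edge_prob_def
  by (simp add: distrib_right sum.distrib sum_distrib_left mult.assoc del: sum_mult_of_bool_eq)

lemma orbit_sum_diff:
  "orbit_sum k (\<lambda>F H. D F H - E F H) F a b = orbit_sum k D F a b - orbit_sum k E F a b"
  unfolding orbit_sum_def edge_prob_def
  by (simp add: left_diff_distrib sum_subtractf del: sum_mult_of_bool_eq)

text \<open>The first transposition carries \<open>i\<close> to \<open>a\<close>, the second carries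
  the image \<open>j'\<close> of \<open>j\<close> to \<open>b\<close>; it leaves \<open>a\<close>
  alone because neither \<open>j'\<close> nor \<open>b\<close> equals \<open>a\<close>.\<close>

lemma transport_pair:
  assumes "i \<in> S" "j \<in> S" "i \<noteq> j" "a \<in> S" "b \<in> S" "a \<noteq> b"
  obtains \<sigma> where "\<sigma> permutes S" "\<sigma> i = a" "\<sigma> j = b"
proof -
  define j' where "j' = Transposition.transpose i a j"
  have j': "j' \<in> S" "j' \<noteq> a" using assms by (auto simp: j'_def Transposition.transpose_def)
  show ?thesis
  proof (rule that[of "Transposition.transpose j' b \<circ> Transposition.transpose i a"])
    show "Transposition.transpose j' b \<circ> Transposition.transpose i a permutes S"
      using assms j' by (intro permutes_compose permutes_swap_id)
    show "(Transposition.transpose j' b \<circ> Transposition.transpose i a) i = a" using assms j' by (simp add: Transposition.transpose_def)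
    show "(Transposition.transpose j' b \<circ> Transposition.transpose i a) j = b" by (simp flip: j'_def)
  qed
qed

text \<open>Permutations act transitively on pairs of distinct vertices, so an invariant graph with
  one edge has all of them. \<open>\<Union>(graphs k)\<close> is the complete graph.\<close>

lemma invariant_graph_trivial:
  assumes H: "H \<in> graphs k" and inv: "\<And>\<sigma>. \<sigma> permutes {1..k} \<Longrightarrow> graph_act \<sigma> H = H"
  shows "H = {} \<or> H = \<Union>(graphs k)"
proof (cases "H = {}")
  case False
  then obtain i j where ij: "{i, j} \<in> H" "i \<in> {1..k}" "j \<in> {1..k}" "i \<noteq> j"
    using H unfolding graphs_def by blast
  have "e \<in> H" if e': "e \<in> \<Union>(graphs k)" for e
  proof -
    obtain a b where e: "e = {a, b}" "a \<in> {1..k}" "b \<in> {1..k}" "a \<noteq> b" using e' unfolding graphs_def by blast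
    obtain \<sigma> where \<sigma>: "\<sigma> permutes {1..k}" "\<sigma> i = a" "\<sigma> j = b" using transport_pair[OF ij(2-4) e(2-4)] .
    then have "{a, b} \<in> graph_act \<sigma> H" using ij(1) by (auto simp: graph_act_def intro!: image_eqI[of _ _ "{i, j}"])
    then show ?thesis using inv[OF \<sigma>(1)] e(1) by simp
  qed
  then show ?thesis using H by auto
qed simp

lemma not_deterministic_two_outcomes:
  assumes R: "is_rule k R" and "\<not> deterministic_rule k R"
  obtains F H1 H2 where "F \<in> graphs k" "H1 \<in> graphs k" "H2 \<in> graphs k" "H1 \<noteq> H2" "0 < R F H1" "0 < R F H2"
proof -
  obtain F where F: "F \<in> graphs k" and no: "\<not> (\<exists>!G. G \<in> graphs k \<and> (\<forall>H\<in>graphs k. R F H = of_bool (H = G)))"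
    using assms(2) unfolding deterministic_rule_def by blast
  have "\<exists>H\<in>graphs k. R F H \<noteq> 0"
    using rule_sum[OF R F] by (metis sum.neutral zero_neq_one)
  then obtain H1 where H1: "H1 \<in> graphs k" "0 < R F H1" using rule_nonneg[OF R F] by (auto simp: less_le)
  have "\<exists>H2\<in>graphs k. H2 \<noteq> H1 \<and> R F H2 \<noteq> 0"
  proof (rule ccontr)
    assume "\<not> ?thesis"
    then have z: "R F H = 0" if "H \<in> graphs k" "H \<noteq> H1" for H using that by blast
    have "(\<Sum>H\<in>graphs k. R F H) = R F H1 + (\<Sum>H\<in>graphs k - {H1}. R F H)"
      using H1 by (intro sum.remove) auto
    then have "R F H1 = 1" using z by (simp add: rule_sum[OF R F])
    then have "\<exists>!G. G \<in> graphs k \<and> (\<forall>H\<in>graphs k. R F H = of_bool (H = G))"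
      using H1 z by (intro ex1I[of _ H1]) (auto split: if_splits)
    with no show False by contradiction
  qed
  then obtain H2 where "H2 \<in> graphs k" "H2 \<noteq> H1" "0 < R F H2" using rule_nonneg[OF R F] by (auto simp: less_le)
  then show ?thesis using that F H1 by blast
qed

definition unit_matrix :: "nat set set \<Rightarrow> nat set set \<Rightarrow> nat set set \<Rightarrow> nat set set \<Rightarrow> real" where
  "unit_matrix F0 H0 F H = of_bool (F = F0 \<and> H = H0)"

lemma sum_unit_matrix:
  "H0 \<in> graphs k \<Longrightarrow> (\<Sum>H\<in>graphs k. unit_matrix F0 H0 F H) = of_bool (F = F0)"
  by (cases "F = F0") (simp_all add: unit_matrix_def of_bool_def)

text \<open>Vanishing row sums of \<open>D\<close> keep the row sums equal to 1, so nonnegative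
  entries are automatically at most 1.\<close>

lemma perturbed_rule:
  assumes R: "is_rule k R" and e: "0 < e"
    and row: "\<And>F. F \<in> graphs k \<Longrightarrow> (\<Sum>H\<in>graphs k. D F H) = 0"
    and low: "\<And>F H. F \<in> graphs k \<Longrightarrow> H \<in> graphs k \<Longrightarrow> 0 \<le> R F H + e * D F H"
    and orb: "\<And>F a b. F \<in> graphs k \<Longrightarrow> a \<in> {1..k} \<Longrightarrow> b \<in> {1..k} \<Longrightarrow> a \<noteq> b \<Longrightarrow> orbit_sum k D F a b = 0"
    and ne: "F0 \<in> graphs k" "H0 \<in> graphs k" "D F0 H0 \<noteq> 0"
  shows "\<exists>R'. is_rule k R' \<and> \<not> rule_eq k R' R \<and>
    (\<forall>F\<in>graphs k. \<forall>a\<in>{1..k}. \<forall>b\<in>{1..k}. a \<noteq> b \<longrightarrow> orbit_sum k R' F a b = orbit_sum k R F a b)"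
proof (intro exI conjI)
  let ?R = "\<lambda>F H. R F H + e * D F H"
  show "is_rule k ?R"
    by (rule is_ruleI[OF low]) (simp_all add: sum.distrib rule_sum[OF R] row flip: sum_distrib_left)
  show "\<not> rule_eq k ?R R" using ne e unfolding rule_eq_def by auto
  show "\<forall>F\<in>graphs k. \<forall>a\<in>{1..k}. \<forall>b\<in>{1..k}. a \<noteq> b \<longrightarrow> orbit_sum k ?R F a b = orbit_sum k R F a b"
    using orb by (simp add: orbit_sum_add_scaled)
qed

lemma single_edge_graph:
  assumes "a \<in> {1..k}" "b \<in> {1..k}" "a \<noteq> b"
  shows "{{a, b}} \<in> graphs k" "{a, b} \<in> \<Union>(graphs k)"
proof -
  show "{{a, b}} \<in> graphs k" using assms unfolding graphs_def by blast
  then show "{a, b} \<in> \<Union>(graphs k)" by blast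
qed

lemma exists_rule_same_orbit_sums:
  assumes R: "is_rule k R" and k: "k \<noteq> 2" and no: "\<not> (symmetric_rule k R \<and> deterministic_rule k R)"
  shows "\<exists>R'. is_rule k R' \<and> \<not> rule_eq k R' R \<and>
    (\<forall>F\<in>graphs k. \<forall>a\<in>{1..k}. \<forall>b\<in>{1..k}. a \<noteq> b \<longrightarrow> orbit_sum k R' F a b = orbit_sum k R F a b)"
proof (cases "symmetric_rule k R")
  case False
  have "\<not> rule_eq k (symmetrized k R) R"
  proof
    assume eq: "rule_eq k (symmetrized k R) R"
    have "symmetric_rule k R"
      unfolding symmetric_rule_def
    proof (intro ballI allI impI)
      fix F H \<sigma> assume FH: "F \<in> graphs k" "H \<in> graphs k" and \<sigma>: "\<sigma> permutes {1..k}"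
      then show "R (graph_act \<sigma> F) (graph_act \<sigma> H) = R F H"
        using eq symmetric_rule_symmetrized[of k R] graph_act_in_graphs[OF \<sigma>]
        unfolding rule_eq_def symmetric_rule_def by metis
    qed
    with False show False by contradiction
  qed
  then show ?thesis using is_rule_symmetrized[OF R] orbit_sum_symmetrized by blast
next
  case sym: True
  with no obtain F0 H1 H2 where F0: "F0 \<in> graphs k" and H: "H1 \<in> graphs k" "H2 \<in> graphs k" "H1 \<noteq> H2"
    and pos: "0 < R F0 H1" "0 < R F0 H2"
    using not_deterministic_two_outcomes[OF R] by blast
  \<comment> \<open>An entry may be diminished by two unit matrices at once, thus by
    \<open>2 * e\<close>; half of the smaller probability keeps it nonnegative.\<close>
  define e where "e = min (R F0 H1) (R F0 H2) / 2"
  have e: "0 < e" "2 * e \<le> R F0 H1" "2 * e \<le> R F0 H2" using pos by (auto simp: e_def)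
  show ?thesis
  proof (cases "\<exists>\<tau>. \<tau> permutes {1..k} \<and> (graph_act \<tau> F0 \<noteq> F0 \<or> graph_act \<tau> H1 \<noteq> H1 \<or> graph_act \<tau> H2 \<noteq> H2)")
    case True
    then obtain \<tau> where \<tau>: "\<tau> permutes {1..k}"
      and moved: "graph_act \<tau> F0 \<noteq> F0 \<or> graph_act \<tau> H1 \<noteq> H1 \<or> graph_act \<tau> H2 \<noteq> H2" by blast
    let ?t = "graph_act \<tau>"
    \<comment> \<open>Adding \<open>D\<close> moves mass in row \<open>F0\<close> from
      \<open>H2\<close> to \<open>H1\<close>. \<open>E\<close> is its image under
      \<open>\<tau>\<close>; both have the same orbit sums, so those of \<open>D - E\<close>
      vanish.\<close>
    define D where "D F H = unit_matrix F0 H1 F H - unit_matrix F0 H2 F H" for F H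
    define E where "E F H = unit_matrix (?t F0) (?t H1) F H - unit_matrix (?t F0) (?t H2) F H" for F H
    have tH: "?t H1 \<in> graphs k" "?t H2 \<in> graphs k" using graph_act_in_graphs[OF \<tau>] H by auto
    have inj: "?t F = ?t F' \<longleftrightarrow> F = F'" for F F' using graph_act_inv(1)[OF \<tau>] by metis
    have DE: "D = (\<lambda>F H. E (?t F) (?t H))" by (simp add: fun_eq_iff D_def E_def unit_matrix_def inj)
    have symR: "R (?t F0) (?t H1) = R F0 H1" using sym F0 H \<tau> by (simp add: symmetric_rule_def)
    show ?thesis
    proof (rule perturbed_rule[where D="\<lambda>F H. D F H - E F H", OF R e(1)])
      show "(\<Sum>H\<in>graphs k. D F H - E F H) = 0" for F
        using H tH by (simp add: D_def E_def sum_subtractf sum_unit_matrix)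
      show "orbit_sum k (\<lambda>F H. D F H - E F H) F a b = 0" for F a b
        unfolding orbit_sum_diff DE using orbit_sum_graph_act[OF \<tau>, of E] by simp
      show "0 \<le> R F H' + e * (D F H' - E F H')" if "F \<in> graphs k" "H' \<in> graphs k" for F H'
      proof -
        \<comment> \<open>Mass is lost at \<open>(F0, H2)\<close> through \<open>D\<close> and at
          \<open>(?t F0, ?t H1)\<close> through \<open>E\<close>; these positions may coincide,
          hence the 2. By symmetry of \<open>R\<close> the second one carries the probability
          \<open>R F0 H1\<close>.\<close>
        have "D F H' - E F H' \<ge> - (if (F = F0 \<and> H' = H2) \<or> (F = ?t F0 \<and> H' = ?t H1) then 2 else 0)"
          by (auto simp: D_def E_def unit_matrix_def)
        then have "e * (D F H' - E F H') \<ge> e * - (if (F = F0 \<and> H' = H2) \<or> (F = ?t F0 \<and> H' = ?t H1) then 2 else 0)"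
          using e(1) by (intro mult_left_mono) auto
        moreover have "e * (if (F = F0 \<and> H' = H2) \<or> (F = ?t F0 \<and> H' = ?t H1) then 2 else 0) \<le> R F H'"
          using e symR rule_nonneg[OF R that] by auto
        ultimately show ?thesis by linarith
      qed
      show "F0 \<in> graphs k" by (rule F0)
      \<comment> \<open>At \<open>(F0, H1)\<close> the 1 from \<open>D\<close> is cancelled only if
        \<open>\<tau>\<close> fixes both \<open>F0\<close> and \<open>H1\<close>; then it moves
        \<open>H2\<close>, and the entry at \<open>(F0, H2)\<close> is -1.\<close>
      let ?H = "if ?t F0 \<noteq> F0 \<or> ?t H1 \<noteq> H1 then H1 else H2"
      show "?H \<in> graphs k" using H by simp
      show "D F0 ?H - E F0 ?H \<noteq> 0"
        using moved H(3) by (auto simp: D_def E_def unit_matrix_def)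
    qed
  next
    case False
    have fixed: "H1 = {} \<or> H1 = \<Union>(graphs k)" "H2 = {} \<or> H2 = \<Union>(graphs k)"
      using invariant_graph_trivial[OF H(1)] invariant_graph_trivial[OF H(2)] False by blast+
    let ?E = "\<Union>(graphs k)"
    have emp: "{} \<in> graphs k" and full: "?E \<in> graphs k" by (auto simp: graphs_def)
    have posE: "2 * e \<le> R F0 {}" "2 * e \<le> R F0 ?E" using fixed H(3) e by auto
    \<comment> \<open>The two outcomes are different, so the complete graph has an edge; this
      excludes \<open>k = 1\<close>, and \<open>k = 2\<close> is excluded by assumption.\<close>
    have "?E \<noteq> {}" using fixed H(3) by auto
    then have "2 \<le> k" unfolding graphs_def by (auto simp: Suc_le_eq)
    with k have k3: "3 \<le> k" by simp
    define f where "f = {1, 2::nat}"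
    have fE: "f \<in> ?E" unfolding f_def using k3 by (intro single_edge_graph) auto
    have gE: "{1, 3} \<in> ?E" using k3 by (intro single_edge_graph) auto
    have gf: "{1, 3::nat} \<noteq> f" by (auto simp: f_def doubleton_eq_iff)
    have ff: "{f} \<in> graphs k" "?E - {f} \<in> graphs k" using fE by (auto simp: graphs_def)
    \<comment> \<open>Every pair lies in exactly one of \<open>{f}\<close> and
      \<open>?E - {f}\<close>, and in exactly one of \<open>{}\<close> and \<open>?E\<close>. So
      moving equal mass from the latter two graphs to the former two changes no edge probability at
      all, even before summing over permutations.\<close>
    define D where "D F H = (unit_matrix F0 {f} F H + unit_matrix F0 (?E - {f}) F H) -
      (unit_matrix F0 {} F H + unit_matrix F0 ?E F H)" for F H
    have ep: "edge_prob k (unit_matrix F0 H0) F a b = of_bool (F = F0 \<and> {a, b} \<in> H0)" if "H0 \<in> graphs k" for H0 F a b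
    proof -
      have "edge_prob k (unit_matrix F0 H0) F a b = (\<Sum>H\<in>graphs k. if H = H0 then of_bool (F = F0 \<and> {a, b} \<in> H0) else 0)"
        unfolding edge_prob_def unit_matrix_def by (intro sum.cong) auto
      then show ?thesis using that by simp
    qed
    have epD: "edge_prob k D F a b = 0" if "a \<in> {1..k}" "b \<in> {1..k}" "a \<noteq> b" for F a b
    proof -
      have "{a, b} \<in> ?E" using that by (rule single_edge_graph)
      moreover have "edge_prob k D F a b = (edge_prob k (unit_matrix F0 {f}) F a b + edge_prob k (unit_matrix F0 (?E - {f})) F a b)
          - (edge_prob k (unit_matrix F0 {}) F a b + edge_prob k (unit_matrix F0 ?E) F a b)"
        unfolding edge_prob_def D_def by (simp add: sum.distrib sum_subtractf distrib_right left_diff_distrib)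
      ultimately show ?thesis by (auto simp: ep emp full ff)
    qed
    show ?thesis
    proof (rule perturbed_rule[where D=D, OF R e(1)])
      show "(\<Sum>H\<in>graphs k. D F H) = 0" for F
        unfolding D_def sum_subtractf sum.distrib by (simp add: sum_unit_matrix emp full ff)
      show "orbit_sum k D F a b = 0" if "F \<in> graphs k" "a \<in> {1..k}" "b \<in> {1..k}" "a \<noteq> b" for F a b
        unfolding orbit_sum_def
      proof (rule sum.neutral, rule ballI)
        fix \<sigma> assume "\<sigma> \<in> {\<sigma>. \<sigma> permutes {1..k}}"
        then have \<sigma>: "\<sigma> permutes {1..k}" by simp
        show "edge_prob k D (graph_act \<sigma> F) (\<sigma> a) (\<sigma> b) = 0"
          using that(2-4) by (intro epD) (simp_all only: permutes_in_image[OF \<sigma>] inj_eq[OF permutes_inj[OF \<sigma>]] not_False_eq_True)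
      qed
      show "0 \<le> R F H + e * D F H" if "F \<in> graphs k" "H \<in> graphs k" for F H
      proof -
        have "D F H \<ge> - (if F = F0 \<and> (H = {} \<or> H = ?E) then 2 else 0)"
          by (auto simp: D_def unit_matrix_def)
        then have "e * D F H \<ge> e * - (if F = F0 \<and> (H = {} \<or> H = ?E) then 2 else 0)"
          using e(1) by (intro mult_left_mono) auto
        moreover have "e * (if F = F0 \<and> (H = {} \<or> H = ?E) then 2 else 0) \<le> R F H"
          using posE rule_nonneg[OF R that] by auto
        ultimately show ?thesis by linarith
      qed
      show "F0 \<in> graphs k" by (rule F0)
      show "{f} \<in> graphs k" by (rule ff)
      show "D F0 {f} \<noteq> 0" 
      proof -
        \<comment> \<open>The edge \<open>{1, 3}\<close>, present because of the third vertex, tells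
          \<open>{f}\<close> from its complement and from the complete graph, so the entry of
          \<open>D\<close> at \<open>{f}\<close> is 1.\<close>
        have 1: "{1, 3} \<notin> {f}" "{1, 3} \<in> ?E - {f}" using gE gf by simp_all
        then have ne: "({f} = ?E - {f}) = False" "({f} = ?E) = False" "({f} = {}) = False" by (metis Diff_iff empty_not_insert)+
        show ?thesis unfolding D_def unit_matrix_def ne by simp
      qed
    qed
  qed
qed

theorem theorem1p4:
  fixes M :: "'a measure"
    and k :: nat
    and R :: "nat set set \<Rightarrow> nat set set \<Rightarrow> real"
  assumes "prob_space M" and "atomless M" and "separable_sigma_algebra M"
    and "k \<ge> 1"
    and "is_rule k R"
  shows "unique_rule M k R \<longleftrightarrow> (symmetric_rule k R \<and> deterministic_rule k R) \<or> k = 2"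
proof -
  interpret prob_space M by fact
  show ?thesis
  proof
    assume unique: "unique_rule M k R"
    show "(symmetric_rule k R \<and> deterministic_rule k R) \<or> k = 2"
    proof (rule ccontr)
      assume "\<not> ?thesis"
      then obtain R' where "is_rule k R'" "\<not> rule_eq k R' R"
        and "\<forall>F\<in>graphs k. \<forall>a\<in>{1..k}. \<forall>b\<in>{1..k}. a \<noteq> b \<longrightarrow> orbit_sum k R' F a b = orbit_sum k R F a b"
        using exists_rule_same_orbit_sums[OF \<open>is_rule k R\<close>] by blast
      moreover from this(3) have "same_trajectories M k R' k R"
        by (intro same_trajectories_of_velocity_eq velocity_eq_of_orbit_sum_eq) auto
      ultimately show False using unique unfolding unique_rule_def by blast
    qed
  next
    assume cond: "(symmetric_rule k R \<and> deterministic_rule k R) \<or> k = 2"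
    show "unique_rule M k R"
      unfolding unique_rule_def
    proof (rule notI, elim exE conjE)
      fix R' assume R': "is_rule k R'" "\<not> rule_eq k R' R" and same: "same_trajectories M k R' k R"
      have orb: "orbit_sum k R' F a b = orbit_sum k R F a b"
        if "F \<in> graphs k" "a \<in> {1..k}" "b \<in> {1..k}" "a \<noteq> b" for F a b
        by (rule orbit_sum_eq_of_step_velocity[OF step_velocity_eq_of_same_trajectories[OF \<open>atomless M\<close> same] that])
      from cond have "rule_eq k R' R"
      proof
        assume "symmetric_rule k R \<and> deterministic_rule k R"
        then show ?thesis using rule_eq_of_symmetric_deterministic[OF \<open>is_rule k R\<close> _ _ R'(1) orb] by blast
      next
        assume "k = 2"
        then show ?thesis using rule_eq_order_2[of R R'] \<open>is_rule k R\<close> R'(1) orb by simp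
      qed
      with R'(2) show False by contradiction
    qed
  qed
qed

end
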